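(* Let $(\mathfrak g,r')$ be a finite dimensional quasitriangular Lie bialgebra over a field $\mathbb K$ of characteristic $0$. For any scalar $s\in\mathbb K$, $$C_s:=\mathrm{Ker}\bigl(\delta-s(D\otimes\mathrm{id})\circ\Delta_0\bigr)$$ is a commutative subalgebra of $U(\mathfrak g^* )$.
   Context: A quasitriangular Lie bialgebra (QTLBA) is a pair $(\mathfrak g,r')$ of a Lie algebra $\mathfrak g$ and $r'\in\mathfrak g^{\otimes2}$ with $[r'^{1,2},r'^{1,3}]+[r'^{1,2},r'^{2,3}]+[r'^{1,3},r'^{2,3}]=0$ and $t:=r'+r'^{2,1}\in S^2(\mathfrak g)^{\mathfrak g}$; its cobracket is $x\mapsto[x\otimes1+1\otimes x,r]$ with $r=(r'-r'^{2,1})/2$. $\mathfrak g^*$ is the dual Lie bialgebra (bracket dual to the cobracket of $\mathfrak g$, cobracket dual to the bracket of $\mathfrak g$). $\Delta_0$ is the cocommutative coproduct of $U(\mathfrak g^* )$. $\delta:U(\mathfrak g^* )\to\wedge^2U(\mathfrak g^* )\subset U(\mathfrak g^* )^{\otimes2}$ is the co-Poisson map: it extends the Lie cobracket of $\mathfrak g^*$ and satisfies $\delta(xy)=\delta(x)\Delta_0(y)+\Delta_0(x)\delta(y)$. $D:\mathfrak g^*\to\mathfrak g^*$ is the composition of the Lie cobracket $\mathfrak g^*\to\wedge^2(\mathfrak g^* )$ with the Lie bracket of $\mathfrak g^*$; it is a derivation and a coderivation of $\mathfrak g^*$, and $D$ also denotes the induced derivation of $U(\mathfrak g^* )$. *)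

theory Defs
  imports
    Complex_Main
    "HOL-Algebra.QuotRing"
    "HOL-Library.Poly_Mapping"
    "HOL-Library.Function_Algebras"
begin

section \<open>Vector spaces with carriers and tensor squares\<close>

text \<open>The spaces below (a Lie algebra given by a type, its dual as a set of functionals, an
  enveloping algebra as a set of cosets) live on different kinds of carriers over the same field
  \<open>'k\<close>; the following records only collect their operations.\<close>

record ('k, 'a) vspace =
  vset :: "'a set"
  vadd :: "'a \<Rightarrow> 'a \<Rightarrow> 'a"
  vsmul :: "'k \<Rightarrow> 'a \<Rightarrow> 'a"

record ('k, 'a) liealg = "('k, 'a) vspace" +
  lbr :: "'a \<Rightarrow> 'a \<Rightarrow> 'a"

record ('k, 'a) assoc_alg = "('k, 'a) vspace" +
  amul :: "'a \<Rightarrow> 'a \<Rightarrow> 'a"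
  aone :: "'a"

definition bilinear_form :: "('k::field, 'a, 'm) vspace_scheme \<Rightarrow> ('a \<Rightarrow> 'a \<Rightarrow> 'k) \<Rightarrow> bool" where
  "bilinear_form V \<beta> \<longleftrightarrow>
     (\<forall>x\<in>vset V. \<forall>y\<in>vset V. \<forall>z\<in>vset V.
        \<beta> (vadd V x y) z = \<beta> x z + \<beta> y z \<and> \<beta> z (vadd V x y) = \<beta> z x + \<beta> z y) \<and>
     (\<forall>c. \<forall>x\<in>vset V. \<forall>z\<in>vset V.
        \<beta> (vsmul V c x) z = c * \<beta> x z \<and> \<beta> z (vsmul V c x) = c * \<beta> z x)"

definition trilinear_form ::
    "('k::field, 'a, 'm) vspace_scheme \<Rightarrow> ('a \<Rightarrow> 'a \<Rightarrow> 'a \<Rightarrow> 'k) \<Rightarrow> bool" where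
  "trilinear_form V \<tau> \<longleftrightarrow>
     (\<forall>z\<in>vset V. bilinear_form V (\<lambda>x y. \<tau> x y z) \<and> bilinear_form V (\<lambda>x y. \<tau> x z y)
               \<and> bilinear_form V (\<lambda>x y. \<tau> z x y))"

text \<open>\<open>V \<otimes> V\<close> is realised as the span of the functionals \<open>a \<otimes> b = (\<beta> \<mapsto> \<beta> a b)\<close> on the space
  of bilinear forms of \<open>V\<close> (extended by \<open>0\<close> to all other functions, so that equality of tensors is
  equality of functions). Over a field the canonical map from \<open>V \<otimes> V\<close> to the dual of the space of
  bilinear forms is injective in any dimension, so this is the tensor square; the lemma
  \<open>tensor2_universal\<close> below is its universal property.\<close>

definition on_forms ::
    "('k::field, 'a, 'm) vspace_scheme \<Rightarrow> (('a \<Rightarrow> 'a \<Rightarrow> 'k) \<Rightarrow> 'k) \<Rightarrow> ('a \<Rightarrow> 'a \<Rightarrow> 'k) \<Rightarrow> 'k" where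
  "on_forms V t = (\<lambda>\<beta>. if bilinear_form V \<beta> then t \<beta> else 0)"

definition pure :: "('k::field, 'a, 'm) vspace_scheme \<Rightarrow> 'a \<Rightarrow> 'a \<Rightarrow> ('a \<Rightarrow> 'a \<Rightarrow> 'k) \<Rightarrow> 'k" where
  "pure V a b = on_forms V (\<lambda>\<beta>. \<beta> a b)"

text \<open>Scalars need no separate clause, as \<open>c (a \<otimes> b) = (c a) \<otimes> b\<close>.\<close>

inductive_set tensor2 :: "('k::field, 'a, 'm) vspace_scheme \<Rightarrow> (('a \<Rightarrow> 'a \<Rightarrow> 'k) \<Rightarrow> 'k) set"
  for V :: "('k::field, 'a, 'm) vspace_scheme" where
  zero: "0 \<in> tensor2 V"
| add_pure: "t \<in> tensor2 V \<Longrightarrow> a \<in> vset V \<Longrightarrow> b \<in> vset V \<Longrightarrow> t + pure V a b \<in> tensor2 V"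

definition tsmul :: "'k::field \<Rightarrow> ('f \<Rightarrow> 'k) \<Rightarrow> 'f \<Rightarrow> 'k" where
  "tsmul c t = (\<lambda>\<beta>. c * t \<beta>)"

text \<open>A linear map out of the tensor square is given by substituting in the form \<open>\<beta>\<close>; e.g. the next
  three send \<open>a \<otimes> b\<close> to \<open>b \<otimes> a\<close>, to \<open>f a \<otimes> g b\<close> and (in two arguments \<open>a \<otimes> b\<close>, \<open>c \<otimes> d\<close>) to
  \<open>a c \<otimes> b d\<close>.\<close>

definition tflip :: "(('a \<Rightarrow> 'a \<Rightarrow> 'k) \<Rightarrow> 'k) \<Rightarrow> ('a \<Rightarrow> 'a \<Rightarrow> 'k) \<Rightarrow> 'k" where
  "tflip t = (\<lambda>\<beta>. t (\<lambda>a b. \<beta> b a))"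

definition tmap :: "('k::field, 'b, 'm) vspace_scheme \<Rightarrow> ('a \<Rightarrow> 'b) \<Rightarrow> ('a \<Rightarrow> 'b) \<Rightarrow>
    (('a \<Rightarrow> 'a \<Rightarrow> 'k) \<Rightarrow> 'k) \<Rightarrow> ('b \<Rightarrow> 'b \<Rightarrow> 'k) \<Rightarrow> 'k" where
  "tmap W f g t = on_forms W (\<lambda>\<beta>. t (\<lambda>a b. \<beta> (f a) (g b)))"

definition tmul :: "('k::field, 'a, 'm) assoc_alg_scheme \<Rightarrow> (('a \<Rightarrow> 'a \<Rightarrow> 'k) \<Rightarrow> 'k) \<Rightarrow>
    (('a \<Rightarrow> 'a \<Rightarrow> 'k) \<Rightarrow> 'k) \<Rightarrow> ('a \<Rightarrow> 'a \<Rightarrow> 'k) \<Rightarrow> 'k" where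
  "tmul A t u = on_forms A (\<lambda>\<beta>. t (\<lambda>a b. u (\<lambda>c d. \<beta> (amul A a c) (amul A b d))))"

lemma pure_in_tensor2: "a \<in> vset V \<Longrightarrow> b \<in> vset V \<Longrightarrow> pure V a b \<in> tensor2 V"
  using tensor2.add_pure[OF tensor2.zero] by fastforce

lemma tensor2_add:
  assumes "t \<in> tensor2 V" "u \<in> tensor2 V" shows "t + u \<in> tensor2 V"
  using assms(2,1)
  by (induction) (simp_all add: tensor2.add_pure flip: add.assoc)

lemma (in vector_space) functional_separates:
  assumes "x \<noteq> 0"
  shows "\<exists>\<phi>. Vector_Spaces.linear scale (*) \<phi> \<and> \<phi> x \<noteq> 0"
proof -
  interpret vsp: vector_space_pair scale "(*) :: 'a \<Rightarrow> 'a \<Rightarrow> 'a"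
    by unfold_locales (auto simp: algebra_simps)
  have "independent {x}"
    using assms by (simp add: independent_insert)
  from vsp.linear_independent_extend[OF this, of "\<lambda>_. 1"] show ?thesis
    by (metis insertI1 zero_neq_one)
qed

text \<open>Uniqueness of the map is immediate from the induction rule of \<^const>\<open>tensor2\<close>.\<close>

lemma tensor2_universal:
  fixes V :: "('k::field, 'a, 'm) vspace_scheme"
    and sc :: "'k \<Rightarrow> 'w::ab_group_add \<Rightarrow> 'w" and f :: "'a \<Rightarrow> 'a \<Rightarrow> 'w"
  assumes "vector_space sc"
    and f_add: "\<And>x y z. x \<in> vset V \<Longrightarrow> y \<in> vset V \<Longrightarrow> z \<in> vset V \<Longrightarrow>
          f (vadd V x y) z = f x z + f y z \<and> f z (vadd V x y) = f z x + f z y"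
    and f_smul: "\<And>c x z. x \<in> vset V \<Longrightarrow> z \<in> vset V \<Longrightarrow>
          f (vsmul V c x) z = sc c (f x z) \<and> f z (vsmul V c x) = sc c (f z x)"
  shows "\<exists>F. (\<forall>a\<in>vset V. \<forall>b\<in>vset V. F (pure V a b) = f a b) \<and>
             (\<forall>t\<in>tensor2 V. \<forall>u\<in>tensor2 V. F (t + u) = F t + F u) \<and>
             (\<forall>c. \<forall>t\<in>tensor2 V. F (tsmul c t) = sc c (F t))"
proof -
  interpret W: vector_space sc by fact
  define R where "R t w \<longleftrightarrow> (\<forall>\<phi>. Vector_Spaces.linear sc (*) \<phi> \<longrightarrow> \<phi> w = t (\<lambda>a b. \<phi> (f a b)))"
    for t :: "('a \<Rightarrow> 'a \<Rightarrow> 'k) \<Rightarrow> 'k" and w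
  have lin: "\<phi> (x + y) = \<phi> x + \<phi> y" "\<phi> (sc c x) = c * \<phi> x" "\<phi> 0 = 0" "\<phi> (x - y) = \<phi> x - \<phi> y"
    if "Vector_Spaces.linear sc (*) \<phi>" for \<phi> c x y
  proof -
    interpret Vector_Spaces.linear sc "(*)" \<phi> by fact
    show "\<phi> (x + y) = \<phi> x + \<phi> y" "\<phi> (sc c x) = c * \<phi> x" "\<phi> 0 = 0" "\<phi> (x - y) = \<phi> x - \<phi> y"
      by (simp_all add: add scale zero diff)
  qed
  have uniq: "w = w'" if "R t w" "R t w'" for t w w'
  proof (rule ccontr)
    assume "w \<noteq> w'"
    then obtain \<phi> where \<phi>: "Vector_Spaces.linear sc (*) \<phi>" "\<phi> (w - w') \<noteq> 0"
      using W.functional_separates[of "w - w'"] by auto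
    moreover have "\<phi> w = \<phi> w'"
      using that(1)[unfolded R_def, rule_format, OF \<phi>(1)]
        that(2)[unfolded R_def, rule_format, OF \<phi>(1)] by simp
    ultimately show False
      using lin(4)[OF \<phi>(1)] by simp
  qed
  have pureR: "R (pure V a b) (f a b)" if "a \<in> vset V" "b \<in> vset V" for a b
    using that by (auto simp: R_def pure_def on_forms_def bilinear_form_def f_add f_smul lin)
  have addR: "R (t + u) (w + w')" if "R t w" "R u w'" for t u w w'
    using that by (auto simp: R_def lin)
  have smulR: "R (tsmul c t) (sc c w)" if "R t w" for c t w
    using that by (auto simp: R_def lin tsmul_def)
  have ex: "\<exists>w. R t w" if "t \<in> tensor2 V" for t
    using that
  proof induction
    case zero
    have "R 0 0" by (auto simp: R_def lin)
    then show ?case ..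
  next
    case (add_pure t a b)
    then show ?case using addR pureR by blast
  qed
  define F where "F t = (THE w. R t w)" for t
  have F: "F t = w" if "R t w" for t w
    unfolding F_def using that uniq by blast
  show ?thesis
  proof (intro exI[of _ F] conjI ballI allI)
    show "F (pure V a b) = f a b" if "a \<in> vset V" "b \<in> vset V" for a b
      using that by (intro F pureR)
    have RF: "R t (F t)" if "t \<in> tensor2 V" for t
      using ex[OF that] F by auto
    show "F (t + u) = F t + F u" if "t \<in> tensor2 V" "u \<in> tensor2 V" for t u
      using that by (intro F addR RF)
    show "F (tsmul c t) = sc c (F t)" if "t \<in> tensor2 V" for c t
      using that by (intro F smulR RF)
  qed
qed


section \<open>Quasitriangular Lie bialgebras\<close>

definition lie_algebra :: "('k::field \<Rightarrow> 'g::ab_group_add \<Rightarrow> 'g) \<Rightarrow> ('g \<Rightarrow> 'g \<Rightarrow> 'g) \<Rightarrow> bool" where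
  "lie_algebra sc br \<longleftrightarrow> vector_space sc \<and>
     (\<forall>x y z. br (x + y) z = br x z + br y z \<and> br z (x + y) = br z x + br z y) \<and>
     (\<forall>c x y. br (sc c x) y = sc c (br x y) \<and> br x (sc c y) = sc c (br x y)) \<and>
     (\<forall>x. br x x = 0) \<and>
     (\<forall>x y z. br x (br y z) + br y (br z x) + br z (br x y) = 0)"

definition type_space :: "('k::field \<Rightarrow> 'g::ab_group_add \<Rightarrow> 'g) \<Rightarrow> ('k, 'g) vspace" where
  "type_space sc = \<lparr>vset = UNIV, vadd = (+), vsmul = sc\<rparr>"

text \<open>\<open>ad2 sc br x t = [x \<otimes> 1 + 1 \<otimes> x, t]\<close>.\<close>

definition ad2 :: "('k::field \<Rightarrow> 'g::ab_group_add \<Rightarrow> 'g) \<Rightarrow> ('g \<Rightarrow> 'g \<Rightarrow> 'g) \<Rightarrow> 'g \<Rightarrow>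
    (('g \<Rightarrow> 'g \<Rightarrow> 'k) \<Rightarrow> 'k) \<Rightarrow> ('g \<Rightarrow> 'g \<Rightarrow> 'k) \<Rightarrow> 'k" where
  "ad2 sc br x t = on_forms (type_space sc) (\<lambda>\<beta>. t (\<lambda>a b. \<beta> (br x a) b + \<beta> a (br x b)))"

text \<open>For \<open>r' = \<Sum> a \<otimes> b = \<Sum> c \<otimes> d\<close> the three summands are the values at \<open>\<tau>\<close> of
  \<open>[r'\<^sup>1\<^sup>2, r'\<^sup>1\<^sup>3] = \<Sum> [a, c] \<otimes> b \<otimes> d\<close>, \<open>[r'\<^sup>1\<^sup>2, r'\<^sup>2\<^sup>3] = \<Sum> a \<otimes> [b, c] \<otimes> d\<close> and
  \<open>[r'\<^sup>1\<^sup>3, r'\<^sup>2\<^sup>3] = \<Sum> a \<otimes> c \<otimes> [b, d]\<close>; as for the tensor square, a tensor of degree three is zero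
  iff all trilinear forms vanish on it.\<close>

definition CYBE :: "('k::field \<Rightarrow> 'g::ab_group_add \<Rightarrow> 'g) \<Rightarrow> ('g \<Rightarrow> 'g \<Rightarrow> 'g) \<Rightarrow>
    (('g \<Rightarrow> 'g \<Rightarrow> 'k) \<Rightarrow> 'k) \<Rightarrow> bool" where
  "CYBE sc br r' \<longleftrightarrow> (\<forall>\<tau>. trilinear_form (type_space sc) \<tau> \<longrightarrow>
       r' (\<lambda>a b. r' (\<lambda>c d. \<tau> (br a c) b d))
     + r' (\<lambda>a b. r' (\<lambda>c d. \<tau> a (br b c) d))
     + r' (\<lambda>a b. r' (\<lambda>c d. \<tau> a c (br b d))) = 0)"

definition QTLBA :: "('k::field \<Rightarrow> 'g::ab_group_add \<Rightarrow> 'g) \<Rightarrow> ('g \<Rightarrow> 'g \<Rightarrow> 'g) \<Rightarrow>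
    (('g \<Rightarrow> 'g \<Rightarrow> 'k) \<Rightarrow> 'k) \<Rightarrow> bool" where
  "QTLBA sc br r' \<longleftrightarrow>
     lie_algebra sc br \<and> r' \<in> tensor2 (type_space sc) \<and> CYBE sc br r' \<and>
     (let t = r' + tflip r' in tflip t = t \<and> (\<forall>x. ad2 sc br x t = 0))"

definition cobracket :: "('k::field \<Rightarrow> 'g::ab_group_add \<Rightarrow> 'g) \<Rightarrow> ('g \<Rightarrow> 'g \<Rightarrow> 'g) \<Rightarrow>
    (('g \<Rightarrow> 'g \<Rightarrow> 'k) \<Rightarrow> 'k) \<Rightarrow> 'g \<Rightarrow> ('g \<Rightarrow> 'g \<Rightarrow> 'k) \<Rightarrow> 'k" where
  "cobracket sc br r' x = ad2 sc br x (tsmul (1/2) (r' - tflip r'))"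


section \<open>The dual Lie bialgebra\<close>

definition dual_lie :: "('k::field \<Rightarrow> 'g::ab_group_add \<Rightarrow> 'g) \<Rightarrow> ('g \<Rightarrow> 'g \<Rightarrow> 'g) \<Rightarrow>
    (('g \<Rightarrow> 'g \<Rightarrow> 'k) \<Rightarrow> 'k) \<Rightarrow> ('k, 'g \<Rightarrow> 'k) liealg" where
  "dual_lie sc br r' =
     \<lparr>vset = {\<xi>. Vector_Spaces.linear sc (*) \<xi>},
      vadd = (\<lambda>\<xi> \<eta> x. \<xi> x + \<eta> x),
      vsmul = (\<lambda>c \<xi> x. c * \<xi> x),
      lbr = (\<lambda>\<xi> \<eta> x. cobracket sc br r' x (\<lambda>a b. \<xi> a * \<eta> b))\<rparr>"

text \<open>The element of \<open>\<gg>\<^sup>* \<otimes> \<gg>\<^sup>*\<close> whose value on \<open>x \<otimes> y\<close> is \<open>\<xi> [x, y]\<close>; for finite dimensional \<open>\<gg>\<close>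
  it exists and is unique.\<close>

definition dual_cobracket :: "('k::field \<Rightarrow> 'g::ab_group_add \<Rightarrow> 'g) \<Rightarrow> ('g \<Rightarrow> 'g \<Rightarrow> 'g) \<Rightarrow>
    (('g \<Rightarrow> 'g \<Rightarrow> 'k) \<Rightarrow> 'k) \<Rightarrow> ('g \<Rightarrow> 'k) \<Rightarrow>
    (('g \<Rightarrow> 'k) \<Rightarrow> ('g \<Rightarrow> 'k) \<Rightarrow> 'k) \<Rightarrow> 'k" where
  "dual_cobracket sc br r' \<xi> =
     (THE t. t \<in> tensor2 (dual_lie sc br r') \<and>
             (\<forall>x y. t (\<lambda>\<eta> \<zeta>. \<eta> x * \<zeta> y) = \<xi> (br x y)))"

text \<open>The wedge square is a subspace of the tensor square, and the bracket is the linear map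
  \<open>\<eta> \<otimes> \<zeta> \<mapsto> [\<eta>, \<zeta>]\<close>, here evaluated at \<open>x\<close>.\<close>

definition dual_D :: "('k::field \<Rightarrow> 'g::ab_group_add \<Rightarrow> 'g) \<Rightarrow> ('g \<Rightarrow> 'g \<Rightarrow> 'g) \<Rightarrow>
    (('g \<Rightarrow> 'g \<Rightarrow> 'k) \<Rightarrow> 'k) \<Rightarrow> ('g \<Rightarrow> 'k) \<Rightarrow> 'g \<Rightarrow> 'k" where
  "dual_D sc br r' \<xi> =
     (\<lambda>x. dual_cobracket sc br r' \<xi> (\<lambda>\<eta> \<zeta>. lbr (dual_lie sc br r') \<eta> \<zeta> x))"


section \<open>The universal enveloping algebra\<close>

datatype 'a word = Word (letters: "'a list")

instantiation word :: (type) monoid_add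
begin
definition "0 = Word []"
definition "u + v = Word (letters u @ letters v)"
instance by standard (auto simp: zero_word_def plus_word_def)
end

text \<open>By the convolution product of \<^theory>\<open>HOL-Library.Poly_Mapping\<close>, the type \<open>'a word \<Rightarrow>\<^sub>0 'k\<close> is
  the free associative unital algebra on \<open>'a\<close>.\<close>

definition gen :: "'a \<Rightarrow> 'a word \<Rightarrow>\<^sub>0 'k::field" where
  "gen a = Poly_Mapping.single (Word [a]) 1"

definition scal :: "'k::field \<Rightarrow> 'a word \<Rightarrow>\<^sub>0 'k" where
  "scal c = Poly_Mapping.single 0 c"

definition free_alg :: "('k::field, 'a, 'm) liealg_scheme \<Rightarrow> ('a word \<Rightarrow>\<^sub>0 'k) ring" where
  "free_alg L =
     \<lparr>carrier = {p. \<forall>w\<in>Poly_Mapping.keys p. set (letters w) \<subseteq> vset L}, mult = (*), one = 1, zero = 0, add = (+)\<rparr>"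

definition env_rels :: "('k::field, 'a, 'm) liealg_scheme \<Rightarrow> ('a word \<Rightarrow>\<^sub>0 'k) set" where
  "env_rels L =
     {gen (vadd L a b) - gen a - gen b | a b. a \<in> vset L \<and> b \<in> vset L} \<union>
     {gen (vsmul L c a) - scal c * gen a | c a. a \<in> vset L} \<union>
     {gen a * gen b - gen b * gen a - gen (lbr L a b) | a b. a \<in> vset L \<and> b \<in> vset L}"

definition env_ideal :: "('k::field, 'a, 'm) liealg_scheme \<Rightarrow> ('a word \<Rightarrow>\<^sub>0 'k) set" where
  "env_ideal L = Idl\<^bsub>free_alg L\<^esub> (env_rels L)"

definition env_class ::
    "('k::field, 'a, 'm) liealg_scheme \<Rightarrow> ('a word \<Rightarrow>\<^sub>0 'k) \<Rightarrow> ('a word \<Rightarrow>\<^sub>0 'k) set" where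
  "env_class L p = env_ideal L +>\<^bsub>free_alg L\<^esub> p"

definition env_alg :: "('k::field, 'a, 'm) liealg_scheme \<Rightarrow> ('k, ('a word \<Rightarrow>\<^sub>0 'k) set) assoc_alg" where
  "env_alg L = (let Q = free_alg L Quot env_ideal L in
     \<lparr>vset = carrier Q,
      vadd = add Q,
      vsmul = (\<lambda>c X. mult Q (env_class L (scal c)) X),
      amul = mult Q,
      aone = one Q\<rparr>)"

definition env_incl :: "('k::field, 'a, 'm) liealg_scheme \<Rightarrow> 'a \<Rightarrow> ('a word \<Rightarrow>\<^sub>0 'k) set" where
  "env_incl L a = env_class L (gen a)"


section \<open>Structure maps of the enveloping algebra\<close>

text \<open>Each of the following three predicates determines the map uniquely on the carrier of
  \<open>U(L)\<close>, which is generated by the image of \<open>L\<close>.\<close>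

definition linear_to_tensor2 ::
    "('k::field, 'a, 'm) vspace_scheme \<Rightarrow> ('a \<Rightarrow> ('a \<Rightarrow> 'a \<Rightarrow> 'k) \<Rightarrow> 'k) \<Rightarrow> bool" where
  "linear_to_tensor2 V F \<longleftrightarrow>
     (\<forall>X\<in>vset V. F X \<in> tensor2 V) \<and>
     (\<forall>X\<in>vset V. \<forall>Y\<in>vset V. F (vadd V X Y) = F X + F Y) \<and>
     (\<forall>c. \<forall>X\<in>vset V. F (vsmul V c X) = tsmul c (F X))"

definition cocommutative_coproduct :: "('k::field, 'a, 'm) liealg_scheme \<Rightarrow>
    (('a word \<Rightarrow>\<^sub>0 'k) set \<Rightarrow>
      (('a word \<Rightarrow>\<^sub>0 'k) set \<Rightarrow> ('a word \<Rightarrow>\<^sub>0 'k) set \<Rightarrow> 'k) \<Rightarrow> 'k) \<Rightarrow> bool" where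
  "cocommutative_coproduct L \<Delta> \<longleftrightarrow> (let U = env_alg L in
     linear_to_tensor2 U \<Delta> \<and>
     \<Delta> (aone U) = pure U (aone U) (aone U) \<and>
     (\<forall>X\<in>vset U. \<forall>Y\<in>vset U. \<Delta> (amul U X Y) = tmul U (\<Delta> X) (\<Delta> Y)) \<and>
     (\<forall>a\<in>vset L. \<Delta> (env_incl L a) = pure U (env_incl L a) (aone U) + pure U (aone U) (env_incl L a)))"

definition co_Poisson :: "('k::field, 'a, 'm) liealg_scheme \<Rightarrow>
    ('a \<Rightarrow> ('a \<Rightarrow> 'a \<Rightarrow> 'k) \<Rightarrow> 'k) \<Rightarrow>
    (('a word \<Rightarrow>\<^sub>0 'k) set \<Rightarrow>
      (('a word \<Rightarrow>\<^sub>0 'k) set \<Rightarrow> ('a word \<Rightarrow>\<^sub>0 'k) set \<Rightarrow> 'k) \<Rightarrow> 'k) \<Rightarrow>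
    (('a word \<Rightarrow>\<^sub>0 'k) set \<Rightarrow>
      (('a word \<Rightarrow>\<^sub>0 'k) set \<Rightarrow> ('a word \<Rightarrow>\<^sub>0 'k) set \<Rightarrow> 'k) \<Rightarrow> 'k) \<Rightarrow> bool" where
  "co_Poisson L d \<Delta> \<delta> \<longleftrightarrow> (let U = env_alg L in
     linear_to_tensor2 U \<delta> \<and>
     (\<forall>X\<in>vset U. tflip (\<delta> X) = - \<delta> X) \<and>
     (\<forall>a\<in>vset L. \<delta> (env_incl L a) = tmap U (env_incl L) (env_incl L) (d a)) \<and>
     (\<forall>X\<in>vset U. \<forall>Y\<in>vset U. \<delta> (amul U X Y) = tmul U (\<delta> X) (\<Delta> Y) + tmul U (\<Delta> X) (\<delta> Y)))"

definition induced_derivation :: "('k::field, 'a, 'm) liealg_scheme \<Rightarrow> ('a \<Rightarrow> 'a) \<Rightarrow>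
    (('a word \<Rightarrow>\<^sub>0 'k) set \<Rightarrow> ('a word \<Rightarrow>\<^sub>0 'k) set) \<Rightarrow> bool" where
  "induced_derivation L d D \<longleftrightarrow> (let U = env_alg L in
     (\<forall>X\<in>vset U. D X \<in> vset U) \<and>
     (\<forall>X\<in>vset U. \<forall>Y\<in>vset U. D (vadd U X Y) = vadd U (D X) (D Y)) \<and>
     (\<forall>c. \<forall>X\<in>vset U. D (vsmul U c X) = vsmul U c (D X)) \<and>
     (\<forall>a\<in>vset L. D (env_incl L a) = env_incl L (d a)) \<and>
     (\<forall>X\<in>vset U. \<forall>Y\<in>vset U. D (amul U X Y) = vadd U (amul U (D X) Y) (amul U X (D Y))))"

definition C_ker :: "('k::field, 'a, 'm) assoc_alg_scheme \<Rightarrow>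
    ('a \<Rightarrow> ('a \<Rightarrow> 'a \<Rightarrow> 'k) \<Rightarrow> 'k) \<Rightarrow> ('a \<Rightarrow> ('a \<Rightarrow> 'a \<Rightarrow> 'k) \<Rightarrow> 'k) \<Rightarrow>
    ('a \<Rightarrow> 'a) \<Rightarrow> 'k \<Rightarrow> 'a set" where
  "C_ker U \<Delta> \<delta> D s = {X \<in> vset U. \<delta> X - tsmul s (tmap U D id (\<Delta> X)) = 0}"

definition subalgebra_of :: "('k::field, 'a, 'm) assoc_alg_scheme \<Rightarrow> 'a set \<Rightarrow> bool" where
  "subalgebra_of A C \<longleftrightarrow> C \<subseteq> vset A \<and> aone A \<in> C \<and>
     (\<forall>X\<in>C. \<forall>Y\<in>C. vadd A X Y \<in> C \<and> amul A X Y \<in> C) \<and> (\<forall>c. \<forall>X\<in>C. vsmul A c X \<in> C)"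

definition commutative_subalgebra :: "('k::field, 'a, 'm) assoc_alg_scheme \<Rightarrow> 'a set \<Rightarrow> bool" where
  "commutative_subalgebra A C \<longleftrightarrow>
     subalgebra_of A C \<and> (\<forall>X\<in>C. \<forall>Y\<in>C. amul A X Y = amul A Y X)"

end

theory Submission
  imports Defs
begin

text \<open>Let \<open>\<gg>\<close> be the given Lie algebra and \<open>U = U(\<gg>\<^sup>*)\<close>. The theorem is the classical shadow of the
  fact that twisted traces on a quasitriangular Hopf algebra commute under convolution, but the
  proof stays inside the Drinfeld double of \<open>\<gg>\<close>.

  The idea is as follows. The double \<open>\<gg> \<oplus> \<gg>\<^sup>*\<close> acts on \<open>U\<close>: \<open>\<gg>\<^sup>*\<close> by left multiplication and \<open>\<gg>\<close> by
  dressing operators, which kill \<open>1\<close>. Elements of \<open>C\<^sub>s\<close> are invariant under \<open>\<gg>\<close>, so right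
  multiplication \<open>R\<^sub>Y\<close> by some \<open>Y \<in> C\<^sub>s\<close> commutes with the whole double. On the other hand, \<open>r'\<close>
  gives two maps \<open>\<gg>\<^sup>* \<rightarrow> \<gg>\<close>, one for each of its legs, and their graphs (one of them with a sign) are
  two ideals of the double that commute with each other, because they are orthogonal for its
  invariant pairing. Each of these ideals is a complement of \<open>\<gg>\<close>, so each generates \<open>U\<close> from \<open>1\<close>.
  Now let \<open>X, Y \<in> C\<^sub>s\<close> and write \<open>X = a \<cdot> 1\<close> and \<open>Y = b \<cdot> 1\<close>, where \<open>a\<close> and \<open>b\<close> are polynomials in
  the operators of the first and of the second ideal. Then \<open>X Y = R\<^sub>Y (a \<cdot> 1) = a \<cdot> Y = a b \<cdot> 1 = b
  a \<cdot> 1 = b \<cdot> X = R\<^sub>X (b \<cdot> 1) = Y X\<close>.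

  The dressing operators come from \<open>\<delta>\<^sub>s = \<delta> - s (D \<otimes> id) \<circ> \<Delta>\<^sub>0\<close> itself. Writing
  \<open>\<delta>\<^sub>s X = \<Sum> X' \<otimes> X''\<close>, the element \<open>W(X) = \<Sum> X' S(X''\<^sub>2) \<otimes> X''\<^sub>1\<close> lies in \<open>\<gg>\<^sup>* \<otimes> U\<close>
  (\<open>dress_vanish\<close>), and contracting its first leg with \<open>x \<in> \<gg>\<close> is the action of \<open>x\<close>. By construction
  \<open>W\<close> vanishes on \<open>C\<^sub>s\<close>. To contract with \<open>x\<close>, the functional \<open>\<xi> \<mapsto> \<xi> x\<close> on \<open>\<gg>\<^sup>*\<close> has to be extended
  to \<open>U\<close>; this is the degree one part of the Poincare-Birkhoff-Witt theorem (\<open>functional_extends\<close>).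

  The derivation property of \<open>\<delta>\<^sub>s\<close> yields the commutation rule of these operators with left
  multiplications (\<open>dress_mult\<close>). It is the rule of the double up to a multiple of \<open>D\<close> that depends
  on \<open>s\<close>. To absorb this term, write \<open>r' = \<Sum> a \<otimes> b\<close> and \<open>u = \<Sum> [a, b]\<close>. The Yang-Baxter equation
  implies that \<open>u\<close> leaves \<open>r'\<close> invariant (\<open>u_invariant\<close>), so \<open>u\<close> is a character of \<open>\<gg>\<^sup>*\<close>, and \<open>D\<close> is
  the coadjoint action of \<open>u\<close> (\<open>DL_act\<close>). Shifting the action of \<open>\<gg>\<^sup>*\<close> by a multiple \<open>\<kappa>\<close> of this
  character makes the extra term disappear (\<open>shifted_lmul_dress_at\<close>), and all values of \<open>s\<close> are
  treated alike. Dressing operators then represent \<open>\<gg>\<close> (\<open>dress_at_dress_at\<close>), the two ideals commute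
  (\<open>graph_op_commute\<close>), and the computation above is \<open>C_ker_commute\<close>.

  All of this is carried out on linear functionals on \<open>U\<close>, which separate its points: every operator
  is replaced by its transpose, so that equations live in an additive group of functions, and
  tensors are only ever evaluated on bilinear forms.\<close>

section \<open>Evaluating tensors on bilinear forms\<close>

lemma tensor2_rep:
  assumes "t \<in> tensor2 V"
  obtains xs where "set xs \<subseteq> vset V \<times> vset V" "t = on_forms V (\<lambda>\<beta>. \<Sum>(a, b)\<leftarrow>xs. \<beta> a b)"
proof -
  have "\<exists>xs. set xs \<subseteq> vset V \<times> vset V \<and> t = on_forms V (\<lambda>\<beta>. \<Sum>(a, b)\<leftarrow>xs. \<beta> a b)"
    using assms
  proof induction
    case zero
    then show ?case by (intro exI[of _ "[]"]) (auto simp: on_forms_def)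
  next
    case (add_pure t a b)
    then obtain xs where "set xs \<subseteq> vset V \<times> vset V" "t = on_forms V (\<lambda>\<beta>. \<Sum>(a, b)\<leftarrow>xs. \<beta> a b)"
      by blast
    with add_pure show ?case
      by (intro exI[of _ "(a, b) # xs"]) (auto simp: on_forms_def pure_def fun_eq_iff)
  qed
  with that show ?thesis by blast
qed

lemma tensor2_not_form: "t \<in> tensor2 V \<Longrightarrow> \<not> bilinear_form V \<beta> \<Longrightarrow> t \<beta> = 0"
  by (erule tensor2_rep) (simp add: on_forms_def)

lemma bilinear_form_plus:
  "bilinear_form V \<beta> \<Longrightarrow> bilinear_form V \<gamma> \<Longrightarrow> bilinear_form V (\<lambda>a b. \<beta> a b + \<gamma> a b)"
  unfolding bilinear_form_def by (simp add: algebra_simps)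

lemma bilinear_form_times: "bilinear_form V \<beta> \<Longrightarrow> bilinear_form V (\<lambda>a b. c * \<beta> a b)"
  unfolding bilinear_form_def by (simp add: algebra_simps)

lemma bilinear_form_minus:
  "bilinear_form V \<beta> \<Longrightarrow> bilinear_form V \<gamma> \<Longrightarrow> bilinear_form V (\<lambda>a b. \<beta> a b - \<gamma> a b)"
  unfolding bilinear_form_def by (simp add: algebra_simps)

lemma bilinear_form_zero: "bilinear_form V (\<lambda>a b. 0)"
  unfolding bilinear_form_def by simp

lemma tensor2_plus:
  assumes "t \<in> tensor2 V" "bilinear_form V \<beta>" "bilinear_form V \<gamma>"
  shows "t (\<lambda>a b. \<beta> a b + \<gamma> a b) = t \<beta> + t \<gamma>"
  using assms bilinear_form_plus[OF assms(2,3)]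
  by (elim tensor2_rep) (simp add: on_forms_def case_prod_unfold sum_list_addf)

lemma tensor2_times:
  assumes "t \<in> tensor2 V" "bilinear_form V \<beta>"
  shows "t (\<lambda>a b. c * \<beta> a b) = c * t \<beta>"
  using assms bilinear_form_times[OF assms(2), of c]
  by (elim tensor2_rep) (simp add: on_forms_def case_prod_unfold sum_list_const_mult)

lemma tensor2_minus:
  assumes "t \<in> tensor2 V" "bilinear_form V \<beta>" "bilinear_form V \<gamma>"
  shows "t (\<lambda>a b. \<beta> a b - \<gamma> a b) = t \<beta> - t \<gamma>"
  using assms bilinear_form_minus[OF assms(2,3)]
  by (elim tensor2_rep) (simp add: on_forms_def case_prod_unfold sum_list_subtractf)

lemma tensor2_form_zero: "t \<in> tensor2 V \<Longrightarrow> t (\<lambda>a b. 0) = 0"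
  by (elim tensor2_rep) (simp add: on_forms_def case_prod_unfold)

lemma bilinear_form_cong:
  assumes "\<And>a b. a \<in> vset V \<Longrightarrow> b \<in> vset V \<Longrightarrow> \<beta> a b = \<gamma> a b"
    and "\<And>a b. a \<in> vset V \<Longrightarrow> b \<in> vset V \<Longrightarrow> vadd V a b \<in> vset V"
    and "\<And>c a. a \<in> vset V \<Longrightarrow> vsmul V c a \<in> vset V"
  shows "bilinear_form V \<beta> \<longleftrightarrow> bilinear_form V \<gamma>"
  unfolding bilinear_form_def using assms by simp

lemma tensor2_cong:
  assumes "t \<in> tensor2 V"
    and "\<And>a b. a \<in> vset V \<Longrightarrow> b \<in> vset V \<Longrightarrow> \<beta> a b = \<gamma> a b"
    and "\<And>a b. a \<in> vset V \<Longrightarrow> b \<in> vset V \<Longrightarrow> vadd V a b \<in> vset V"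
    and "\<And>c a. a \<in> vset V \<Longrightarrow> vsmul V c a \<in> vset V"
  shows "t \<beta> = t \<gamma>"
proof -
  obtain xs where xs: "set xs \<subseteq> vset V \<times> vset V" "t = on_forms V (\<lambda>\<beta>. \<Sum>(a, b)\<leftarrow>xs. \<beta> a b)"
    using tensor2_rep[OF assms(1)] .
  have "(\<Sum>(a, b)\<leftarrow>xs. \<beta> a b) = (\<Sum>(a, b)\<leftarrow>xs. \<gamma> a b)"
    using xs(1) assms(2) by (intro arg_cong[of _ _ sum_list] map_cong) auto
  then show ?thesis
    using bilinear_form_cong[of V \<beta> \<gamma>, OF assms(2-)] by (simp add: xs(2) on_forms_def)
qed

text \<open>Contracting a tensor against a family of forms that depends linearly on a parameter is again
  linear in the parameter; this is how forms such as \<open>(a, b) \<mapsto> u (\<lambda>c d. \<beta> (a c) (b d))\<close> are seen to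
  be bilinear.\<close>

lemma bilinear_form_contract:
  assumes u: "u \<in> tensor2 W"
    and form: "\<And>a b. a \<in> vset V \<Longrightarrow> b \<in> vset V \<Longrightarrow> bilinear_form W (f a b)"
    and lin: "\<And>c d. c \<in> vset W \<Longrightarrow> d \<in> vset W \<Longrightarrow> bilinear_form V (\<lambda>a b. f a b c d)"
    and closed: "\<And>a b. a \<in> vset V \<Longrightarrow> b \<in> vset V \<Longrightarrow> vadd V a b \<in> vset V"
      "\<And>c a. a \<in> vset V \<Longrightarrow> vsmul V c a \<in> vset V"
  shows "bilinear_form V (\<lambda>a b. u (f a b))"
proof -
  obtain xs where xs: "set xs \<subseteq> vset W \<times> vset W" "u = on_forms W (\<lambda>\<beta>. \<Sum>(a, b)\<leftarrow>xs. \<beta> a b)"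
    using tensor2_rep[OF u] .
  have "bilinear_form V (\<lambda>a b. \<Sum>(c, d)\<leftarrow>xs. f a b c d)"
    using xs(1)
  proof (induction xs)
    case Nil
    then show ?case by (simp add: bilinear_form_zero)
  next
    case (Cons x xs)
    then show ?case
      by (cases x) (auto intro!: bilinear_form_plus lin)
  qed
  moreover have "u (f a b) = (\<Sum>(c, d)\<leftarrow>xs. f a b c d)" if "a \<in> vset V" "b \<in> vset V" for a b
    using form[OF that] by (simp add: xs(2) on_forms_def)
  ultimately show ?thesis
    using bilinear_form_cong[of V "\<lambda>a b. u (f a b)" "\<lambda>a b. \<Sum>(c, d)\<leftarrow>xs. f a b c d"] closed by simp
qed

section \<open>Linear functionals on the enveloping algebra\<close>

type_synonym ('a, 'k) env = "('a word \<Rightarrow>\<^sub>0 'k) set"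

text \<open>Functionals vanish off the carrier, so that two of them agree on the carrier iff they are
  equal as functions.\<close>

definition linforms :: "('k::field, 'a, 'm) vspace_scheme \<Rightarrow> ('a \<Rightarrow> 'k) set" where
  "linforms V = {F. (\<forall>X\<in>vset V. \<forall>Y\<in>vset V. F (vadd V X Y) = F X + F Y) \<and>
     (\<forall>c. \<forall>X\<in>vset V. F (vsmul V c X) = c * F X) \<and> (\<forall>X. X \<notin> vset V \<longrightarrow> F X = 0)}"

lemma poly_mapping_sum_singles:
  fixes p :: "'w \<Rightarrow>\<^sub>0 'k::comm_monoid_add"
  shows "p = (\<Sum>w\<in>Poly_Mapping.keys p. Poly_Mapping.single w (Poly_Mapping.lookup p w))"
proof (rule poly_mapping_eqI)
  fix v
  have "Poly_Mapping.lookup (\<Sum>w\<in>Poly_Mapping.keys p. Poly_Mapping.single w (Poly_Mapping.lookup p w)) v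
      = (\<Sum>w\<in>Poly_Mapping.keys p. if w = v then Poly_Mapping.lookup p w else 0)"
    by (simp add: lookup_sum lookup_single when_def)
  also have "\<dots> = Poly_Mapping.lookup p v"
    by (auto simp: sum.delta' in_keys_iff)
  finally show "Poly_Mapping.lookup p v = Poly_Mapping.lookup
    (\<Sum>w\<in>Poly_Mapping.keys p. Poly_Mapping.single w (Poly_Mapping.lookup p w)) v" by simp
qed

locale enveloping =
  fixes L :: "('k::field, 'a, 'm) liealg_scheme"
  assumes L_add: "a \<in> vset L \<Longrightarrow> b \<in> vset L \<Longrightarrow> vadd L a b \<in> vset L"
    and L_smul: "a \<in> vset L \<Longrightarrow> vsmul L c a \<in> vset L"
    and L_br: "a \<in> vset L \<Longrightarrow> b \<in> vset L \<Longrightarrow> lbr L a b \<in> vset L"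
begin

abbreviation "U \<equiv> env_alg L"
abbreviation "\<Phi> \<equiv> linforms U"
abbreviation Uadd (infixl "\<boxplus>" 65) where "Uadd \<equiv> vadd U"
abbreviation Umul (infixl "\<odot>" 70) where "Umul \<equiv> amul U"
abbreviation Usmul (infixr "\<boxdot>" 75) where "Usmul \<equiv> vsmul U"
abbreviation "\<iota> \<equiv> env_incl L"
abbreviation "FA \<equiv> carrier (free_alg L)"
abbreviation "cls \<equiv> env_class L"

lemma FA_iff: "p \<in> FA \<longleftrightarrow> (\<forall>w\<in>Poly_Mapping.keys p. set (letters w) \<subseteq> vset L)"
  by (simp add: free_alg_def)

lemma letters_plus: "letters (u + v) = letters u @ letters v"
  by (simp add: plus_word_def)

lemma letters_zero: "letters 0 = []"
  by (simp add: zero_word_def)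

lemma FA_simps: "mult (free_alg L) = (*)" "add (free_alg L) = (+)"
    "one (free_alg L) = 1" "zero (free_alg L) = 0"
  by (simp_all add: free_alg_def)

lemma FA_add: "p \<in> FA \<Longrightarrow> q \<in> FA \<Longrightarrow> p + q \<in> FA"
  using keys_add[of p q] by (auto simp: FA_iff)

lemma FA_single: "set w \<subseteq> vset L \<Longrightarrow> Poly_Mapping.single (Word w) c \<in> FA"
  by (auto simp: FA_iff)

lemma FA_scal: "scal c \<in> FA"
  unfolding scal_def zero_word_def by (rule FA_single) simp

lemma FA_one: "1 \<in> FA" and FA_zero: "0 \<in> FA"
  by (simp_all add: FA_iff letters_zero)

lemma FA_uminus: "p \<in> FA \<Longrightarrow> - p \<in> FA"
  by (simp add: FA_iff)

lemma FA_minus: "p \<in> FA \<Longrightarrow> q \<in> FA \<Longrightarrow> p - q \<in> FA"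
  using FA_add[of p "- q"] FA_uminus by simp

lemma FA_mult: "p \<in> FA \<Longrightarrow> q \<in> FA \<Longrightarrow> p * q \<in> FA"
  using keys_mult[of p q] by (fastforce simp: FA_iff letters_plus)

lemma FA_gen: "a \<in> vset L \<Longrightarrow> gen a \<in> FA"
  unfolding gen_def by (rule FA_single) simp

lemma ring_FA: "ring (free_alg L)"
proof (rule ringI)
  show "abelian_group (free_alg L)"
    by (rule abelian_groupI)
      (auto simp: FA_simps FA_add FA_zero add.assoc add.commute intro!: bexI[of _ "- _"] FA_uminus)
  show "Group.monoid (free_alg L)"
    by (rule monoidI) (auto simp: FA_simps FA_mult FA_one mult.assoc)
qed (auto simp: FA_simps algebra_simps)

lemma env_rels_FA: "env_rels L \<subseteq> FA"
  unfolding env_rels_def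
  by (auto intro!: FA_minus FA_gen FA_mult FA_scal L_add L_smul L_br)

lemma ideal_env: "ideal (env_ideal L) (free_alg L)"
  unfolding env_ideal_def by (rule ring.genideal_ideal[OF ring_FA env_rels_FA])

sublocale F: ring "free_alg L" by (rule ring_FA)
sublocale I: ideal "env_ideal L" "free_alg L" by (rule ideal_env)

lemma vset_U: "vset U = cls ` FA"
  by (auto simp: env_alg_def Let_def FactRing_def A_RCOSETS_def' env_class_def)

lemma cls_in: "p \<in> FA \<Longrightarrow> cls p \<in> vset U"
  by (simp add: vset_U)

lemma cls_add: "p \<in> FA \<Longrightarrow> q \<in> FA \<Longrightarrow> cls p \<boxplus> cls q = cls (p + q)"
  by (simp add: env_alg_def Let_def FactRing_def env_class_def I.a_rcos_sum FA_simps)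

lemma cls_mult: "p \<in> FA \<Longrightarrow> q \<in> FA \<Longrightarrow> cls p \<odot> cls q = cls (p * q)"
  by (simp add: env_alg_def Let_def FactRing_def env_class_def I.rcoset_mult_add FA_simps)

lemma cls_smul: "p \<in> FA \<Longrightarrow> c \<boxdot> cls p = cls (scal c * p)"
  using cls_mult[OF FA_scal]
  by (simp add: env_alg_def Let_def)

lemma cls_one: "aone U = cls 1"
  by (simp add: env_alg_def Let_def FactRing_def env_class_def FA_simps)

lemma cls_eqI:
  assumes "p \<in> FA" "q \<in> FA" "p - q \<in> env_ideal L"
  shows "cls p = cls q"
proof -
  have "p \<in> cls q"
    using assms(3) unfolding env_class_def a_r_coset_def r_coset_def
    by (auto simp: FA_simps intro!: bexI[of _ "p - q"])
  then show ?thesis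
    using F.a_repr_independence[of p "env_ideal L" q] assms(2) I.a_subgroup
    by (simp add: env_class_def)
qed

lemma cls_eqD:
  assumes "p \<in> FA" "q \<in> FA" "cls p = cls q"
  shows "p - q \<in> env_ideal L"
proof -
  have "p \<in> cls q"
    using assms I.a_rcos_self[of p] by (simp add: env_class_def)
  then obtain h where "h \<in> env_ideal L" "p = h + q"
    unfolding env_class_def a_r_coset_def r_coset_def by (auto simp: FA_simps)
  then show ?thesis by simp
qed

lemma rels_ideal: "r \<in> env_rels L \<Longrightarrow> r \<in> env_ideal L"
  unfolding env_ideal_def using F.genideal_self[OF env_rels_FA] by blast

lemma scal_mult: "scal c * scal d = (scal (c * d) :: 'a word \<Rightarrow>\<^sub>0 'k)"
  by (simp add: scal_def mult_single)

lemma scal_add: "scal (c + d) = (scal c + scal d :: 'a word \<Rightarrow>\<^sub>0 'k)"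
  by (simp add: scal_def single_add)

lemma scal_single: "scal c * Poly_Mapping.single w d = Poly_Mapping.single w (c * d)"
  by (simp add: scal_def mult_single)

lemma FA_induct [consumes 1, case_names single add]:
  assumes "p \<in> FA"
    and single: "\<And>w c. set w \<subseteq> vset L \<Longrightarrow> P (Poly_Mapping.single (Word w) c)"
    and add: "\<And>p q. p \<in> FA \<Longrightarrow> q \<in> FA \<Longrightarrow> P p \<Longrightarrow> P q \<Longrightarrow> P (p + q)"
  shows "P p"
proof -
  have "(\<Sum>w\<in>K. Poly_Mapping.single w (Poly_Mapping.lookup p w)) \<in> FA \<and>
      P (\<Sum>w\<in>K. Poly_Mapping.single w (Poly_Mapping.lookup p w))"
    if "finite K" "K \<subseteq> Poly_Mapping.keys p" for K
    using that
  proof (induction K rule: finite_induct)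
    case empty
    then show ?case using single[of "[]" 0] by (simp add: FA_zero)
  next
    case (insert w K)
    then have w: "set (letters w) \<subseteq> vset L"
      using assms(1) by (auto simp: FA_iff)
    then show ?case
      using insert add single[OF w] FA_single[OF w] by (simp add: FA_add)
  qed
  from this[of "Poly_Mapping.keys p"] show ?thesis
    using poly_mapping_sum_singles[of p] by simp
qed

lemma scal_central: "p * scal c = scal c * (p :: 'a word \<Rightarrow>\<^sub>0 'k)"
proof -
  have "(\<Sum>w\<in>K. Poly_Mapping.single w (f w)) * scal c = scal c * (\<Sum>w\<in>K. Poly_Mapping.single w (f w))"
    if "finite K" for K and f :: "'a word \<Rightarrow> 'k"
    using that by (induction K) (simp_all add: algebra_simps scal_def mult_single)
  from this[of "Poly_Mapping.keys p" "Poly_Mapping.lookup p"] show ?thesis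
    using poly_mapping_sum_singles[of p] by simp
qed

lemma U_cases:
  assumes "X \<in> vset U" obtains p where "p \<in> FA" "X = cls p"
  using assms by (auto simp: vset_U)

lemma U_one: "aone U \<in> vset U"
  by (simp add: cls_one cls_in FA_one)

lemma U_add: "X \<in> vset U \<Longrightarrow> Y \<in> vset U \<Longrightarrow> X \<boxplus> Y \<in> vset U"
  by (auto elim!: U_cases simp: cls_add cls_in FA_add)

lemma U_mul: "X \<in> vset U \<Longrightarrow> Y \<in> vset U \<Longrightarrow> X \<odot> Y \<in> vset U"
  by (auto elim!: U_cases simp: cls_mult cls_in FA_mult)

lemma U_smul: "X \<in> vset U \<Longrightarrow> c \<boxdot> X \<in> vset U"
  by (auto elim!: U_cases simp: cls_smul cls_in FA_mult FA_scal)

lemma U_incl: "a \<in> vset L \<Longrightarrow> \<iota> a \<in> vset U"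
  by (simp add: env_incl_def cls_in FA_gen)

lemma U_one_mul: "X \<in> vset U \<Longrightarrow> aone U \<odot> X = X"
  and U_mul_one: "X \<in> vset U \<Longrightarrow> X \<odot> aone U = X"
  by (auto elim!: U_cases simp: cls_one cls_mult FA_one)

lemma U_assoc: "X \<in> vset U \<Longrightarrow> Y \<in> vset U \<Longrightarrow> Z \<in> vset U \<Longrightarrow> X \<odot> Y \<odot> Z = X \<odot> (Y \<odot> Z)"
  by (auto elim!: U_cases simp: cls_mult FA_mult mult.assoc)

lemma U_distl: "X \<in> vset U \<Longrightarrow> Y \<in> vset U \<Longrightarrow> Z \<in> vset U \<Longrightarrow> (X \<boxplus> Y) \<odot> Z = X \<odot> Z \<boxplus> Y \<odot> Z"
  and U_distr: "X \<in> vset U \<Longrightarrow> Y \<in> vset U \<Longrightarrow> Z \<in> vset U \<Longrightarrow> Z \<odot> (X \<boxplus> Y) = Z \<odot> X \<boxplus> Z \<odot> Y"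
  by (auto elim!: U_cases simp: cls_mult cls_add FA_add FA_mult algebra_simps)

lemma U_smul_mul: "X \<in> vset U \<Longrightarrow> Y \<in> vset U \<Longrightarrow> (c \<boxdot> X) \<odot> Y = c \<boxdot> (X \<odot> Y)"
  by (auto elim!: U_cases simp: cls_mult cls_smul FA_scal FA_mult mult.assoc)

lemma U_mul_smul:
  assumes "X \<in> vset U" "Y \<in> vset U" shows "X \<odot> (c \<boxdot> Y) = c \<boxdot> (X \<odot> Y)"
proof -
  obtain p q where "p \<in> FA" "X = cls p" "q \<in> FA" "Y = cls q"
    using assms by (auto elim!: U_cases)
  moreover have "p * (scal c * q) = scal c * (p * q)"
    using scal_central[of p c] by (metis mult.assoc)
  ultimately show ?thesis by (simp add: cls_mult cls_smul FA_scal FA_mult)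
qed

lemma incl_add:
  assumes "a \<in> vset L" "b \<in> vset L" shows "\<iota> (vadd L a b) = \<iota> a \<boxplus> \<iota> b"
proof -
  have "gen (vadd L a b) - (gen a + gen b) \<in> env_ideal L"
    using assms unfolding diff_diff_eq[symmetric]
    by (intro rels_ideal) (unfold env_rels_def, blast)
  then show ?thesis
    using assms unfolding env_incl_def
    by (simp add: cls_add FA_gen FA_add L_add cls_eqI)
qed

lemma incl_smul:
  assumes "a \<in> vset L" shows "\<iota> (vsmul L c a) = c \<boxdot> \<iota> a"
proof -
  have "gen (vsmul L c a) - scal c * gen a \<in> env_ideal L"
    using assms by (intro rels_ideal) (unfold env_rels_def, blast)
  then show ?thesis
    using assms unfolding env_incl_def
    by (simp add: cls_smul FA_gen FA_mult FA_scal L_smul cls_eqI)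
qed

lemma incl_comm:
  assumes "a \<in> vset L" "b \<in> vset L"
  shows "\<iota> a \<odot> \<iota> b = \<iota> b \<odot> \<iota> a \<boxplus> \<iota> (lbr L a b)"
proof -
  have "gen a * gen b - (gen b * gen a + gen (lbr L a b)) \<in> env_ideal L"
    using assms unfolding diff_diff_eq[symmetric]
    by (intro rels_ideal) (unfold env_rels_def, blast)
  then show ?thesis
    using assms unfolding env_incl_def
    by (simp add: cls_mult cls_add FA_gen FA_mult FA_add L_br cls_eqI)
qed

definition env_word :: "'a list \<Rightarrow> ('a, 'k) env" where
  "env_word w = foldr (\<lambda>a X. \<iota> a \<odot> X) w (aone U)"

lemma env_word_simps: "env_word [] = aone U" "env_word (a # w) = \<iota> a \<odot> env_word w"
  by (simp_all add: env_word_def)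

lemma env_word_cls: "set w \<subseteq> vset L \<Longrightarrow> env_word w = cls (Poly_Mapping.single (Word w) 1)"
proof (induction w)
  case Nil
  have "(1 :: 'a word \<Rightarrow>\<^sub>0 'k) = Poly_Mapping.single (Word []) 1"
    by (metis single_one zero_word_def)
  then show ?case by (simp add: env_word_simps cls_one)
next
  case (Cons a w)
  then show ?case
    by (simp add: env_word_simps env_incl_def cls_mult FA_gen FA_single)
      (simp add: gen_def mult_single plus_word_def)
qed

lemma env_word_in: "set w \<subseteq> vset L \<Longrightarrow> env_word w \<in> vset U"
  by (simp add: env_word_cls cls_in FA_single)

lemma U_word_induct [consumes 1, case_names word smul add]:
  assumes "X \<in> vset U"
    and word: "\<And>w. set w \<subseteq> vset L \<Longrightarrow> P (env_word w)"
    and smul: "\<And>c X. X \<in> vset U \<Longrightarrow> P X \<Longrightarrow> P (c \<boxdot> X)"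
    and add: "\<And>X Y. X \<in> vset U \<Longrightarrow> Y \<in> vset U \<Longrightarrow> P X \<Longrightarrow> P Y \<Longrightarrow> P (X \<boxplus> Y)"
  shows "P X"
proof -
  obtain p where p: "p \<in> FA" "X = cls p" using U_cases[OF assms(1)] .
  from p(1) have "P (cls p)"
  proof (induction p rule: FA_induct)
    case (single w c)
    have "cls (Poly_Mapping.single (Word w) c) = c \<boxdot> env_word w"
      using single by (simp add: env_word_cls cls_smul FA_single scal_single)
    then show ?case using smul word single env_word_in by metis
  next
    case (add p q)
    then show ?case using assms(4) cls_in cls_add by metis
  qed
  with p show ?thesis by simp
qed

lemma U_induct [consumes 1, case_names one mul smul add]:
  assumes "X \<in> vset U"
    and one: "P (aone U)"
    and mul: "\<And>a X. a \<in> vset L \<Longrightarrow> X \<in> vset U \<Longrightarrow> P X \<Longrightarrow> P (\<iota> a \<odot> X)"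
    and smul: "\<And>c X. X \<in> vset U \<Longrightarrow> P X \<Longrightarrow> P (c \<boxdot> X)"
    and add: "\<And>X Y. X \<in> vset U \<Longrightarrow> Y \<in> vset U \<Longrightarrow> P X \<Longrightarrow> P Y \<Longrightarrow> P (X \<boxplus> Y)"
  shows "P X"
  using assms(1)
proof (induction X rule: U_word_induct)
  case (word w)
  then show ?case
    by (induction w) (simp_all add: env_word_simps one mul env_word_in)
qed (fact smul add)+

lemma \<Phi>_add: "F \<in> \<Phi> \<Longrightarrow> X \<in> vset U \<Longrightarrow> Y \<in> vset U \<Longrightarrow> F (X \<boxplus> Y) = F X + F Y"
  and \<Phi>_smul: "F \<in> \<Phi> \<Longrightarrow> X \<in> vset U \<Longrightarrow> F (c \<boxdot> X) = c * F X"
  and \<Phi>_out: "F \<in> \<Phi> \<Longrightarrow> X \<notin> vset U \<Longrightarrow> F X = 0"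
  by (simp_all add: linforms_def)

lemma \<Phi>_eqI:
  assumes "F \<in> \<Phi>" "G \<in> \<Phi>" "\<And>w. set w \<subseteq> vset L \<Longrightarrow> F (env_word w) = G (env_word w)"
  shows "F = G"
proof
  fix X
  show "F X = G X"
  proof (cases "X \<in> vset U")
    case True
    then show ?thesis
      by (induction X rule: U_word_induct) (simp_all add: assms \<Phi>_add[OF assms(1)] \<Phi>_add[OF assms(2)]
          \<Phi>_smul[OF assms(1)] \<Phi>_smul[OF assms(2)])
  qed (simp add: assms \<Phi>_out)
qed

lemma functional_descends:
  fixes T :: "('a word \<Rightarrow>\<^sub>0 'k) \<Rightarrow> 'k"
  assumes add: "\<And>p q. T (p + q) = T p + T q" and scal: "\<And>c p. T (scal c * p) = c * T p"
    and ideal: "\<And>p. p \<in> env_ideal L \<Longrightarrow> T p = 0"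
  obtains F where "F \<in> \<Phi>" "\<And>p. p \<in> FA \<Longrightarrow> F (cls p) = T p"
proof -
  define F where "F X = (if X \<in> vset U then T (SOME p. p \<in> FA \<and> X = cls p) else 0)" for X
  have F: "F (cls p) = T p" if p: "p \<in> FA" for p
  proof -
    define r where "r = (SOME q. q \<in> FA \<and> cls p = cls q)"
    have "\<exists>q. q \<in> FA \<and> cls p = cls q" using p by blast
    then have r: "r \<in> FA" "cls p = cls r"
      unfolding r_def by (metis (mono_tags, lifting) someI_ex)+
    have "T (p - r) = 0"
      using cls_eqD[OF p r] by (rule ideal)
    then have "T p = T r"
      using add[of "p - r" r] by simp
    then show ?thesis by (simp add: F_def cls_in p r_def)
  qed
  have "F (X \<boxplus> Y) = F X + F Y" if "X \<in> vset U" "Y \<in> vset U" for X Y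
    using that by (elim U_cases) (simp add: cls_add F FA_add add)
  moreover have "F (c \<boxdot> X) = c * F X" if "X \<in> vset U" for c X
    using that by (elim U_cases) (simp add: cls_smul F FA_mult FA_scal scal)
  moreover have "F X = 0" if "X \<notin> vset U" for X
    using that by (simp add: F_def)
  ultimately have "F \<in> \<Phi>"
    unfolding linforms_def by simp
  with F that show ?thesis by blast
qed

text \<open>A vector outside a subspace is detected by a functional that kills the subspace. This is what
  allows equations in \<open>U(L)\<close> to be proved by transposing all operators to functionals.\<close>

lemma \<Phi>_separate:
  assumes X: "X \<in> vset U" and Y: "Y \<in> vset U" and eq: "\<And>F. F \<in> \<Phi> \<Longrightarrow> F X = F Y"
  shows "X = Y"
proof -
  obtain p q where pq: "p \<in> FA" "X = cls p" "q \<in> FA" "Y = cls q"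
    using X Y by (auto elim!: U_cases)
  let ?sc = "\<lambda>c p. scal c * p :: 'a word \<Rightarrow>\<^sub>0 'k"
  have scal_one: "scal 1 = (1 :: 'a word \<Rightarrow>\<^sub>0 'k)" by (simp add: scal_def)
  interpret W: vector_space ?sc
    by unfold_locales (simp_all add: algebra_simps scal_add scal_mult[symmetric] mult.assoc scal_one)
  interpret vsp: vector_space_pair ?sc "(*) :: 'k \<Rightarrow> 'k \<Rightarrow> 'k"
    by unfold_locales (auto simp: algebra_simps)
  have zero: "0 \<in> env_ideal L"
    using I.zero_closed by (simp add: FA_simps)
  have sub: "W.subspace (env_ideal L)"
    unfolding W.subspace_def using zero I.a_closed I.I_l_closed FA_scal by (simp add: FA_simps)
  have "p - q \<in> env_ideal L"
  proof (rule ccontr)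
    assume n: "p - q \<notin> env_ideal L"
    obtain B where B: "B \<subseteq> env_ideal L" "W.independent B" "env_ideal L \<subseteq> W.span B"
      using W.maximal_independent_subset[of "env_ideal L"] by blast
    have sB: "W.span B = env_ideal L"
      using B sub by (simp add: W.span_minimal order_antisym)
    have "W.independent (insert (p - q) B)"
      using W.independent_insert[of "p - q" B] B n sB by simp
    then obtain T where T: "Vector_Spaces.linear ?sc (*) T"
        "\<And>b. b \<in> insert (p - q) B \<Longrightarrow> T b = (if b = p - q then 1 else 0)"
      using vsp.linear_independent_extend[of _ "\<lambda>b. if b = p - q then 1 else 0"] by blast
    interpret T: Vector_Spaces.linear ?sc "(*)" T by fact
    have "T b = 0" if "b \<in> B" for b
      using T(2)[of b] that n B(1) by auto
    then have I0: "T b = 0" if "b \<in> env_ideal L" for b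
      using vsp.linear_eq_0_on_span[OF T(1), of B b] sB that by blast
    obtain F where F: "F \<in> \<Phi>" "\<And>p. p \<in> FA \<Longrightarrow> F (cls p) = T p"
      using functional_descends[OF T.add T.scale I0] by blast
    have "T p = T q" using eq[OF F(1)] F(2) pq by simp
    then show False using T(2)[of "p - q"] T.diff[of p q] by simp
  qed
  then show ?thesis using pq cls_eqI by simp
qed

text \<open>The universal property of the enveloping algebra, read off on functionals: a function of words
  extends to \<open>U(L)\<close> as soon as it respects, inside any word, the relations that define \<open>U(L)\<close>.\<close>

lemma functional_from_words:
  fixes e :: "'a list \<Rightarrow> 'k"
  assumes add: "\<And>u v a b. set u \<subseteq> vset L \<Longrightarrow> set v \<subseteq> vset L \<Longrightarrow> a \<in> vset L \<Longrightarrow> b \<in> vset L \<Longrightarrow>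
      e (u @ vadd L a b # v) = e (u @ a # v) + e (u @ b # v)"
    and smul: "\<And>u v a c. set u \<subseteq> vset L \<Longrightarrow> set v \<subseteq> vset L \<Longrightarrow> a \<in> vset L \<Longrightarrow>
      e (u @ vsmul L c a # v) = c * e (u @ a # v)"
    and comm: "\<And>u v a b. set u \<subseteq> vset L \<Longrightarrow> set v \<subseteq> vset L \<Longrightarrow> a \<in> vset L \<Longrightarrow> b \<in> vset L \<Longrightarrow>
      e (u @ a # b # v) - e (u @ b # a # v) = e (u @ lbr L a b # v)"
  obtains F where "F \<in> \<Phi>" "\<And>w. set w \<subseteq> vset L \<Longrightarrow> F (env_word w) = e w"
proof -
  define T where "T p = (\<Sum>w\<in>Poly_Mapping.keys p. Poly_Mapping.lookup p w * e (letters w))"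
    for p :: "'a word \<Rightarrow>\<^sub>0 'k"
  have T_add: "T (p + q) = T p + T q" for p q
    unfolding T_def by (rule setsum_keys_plus_distrib) (simp_all add: algebra_simps)
  have T_single: "T (Poly_Mapping.single w c) = c * e (letters w)" for w c
    by (simp add: T_def)
  have T_zero: "T 0 = 0" by (simp add: T_def)
  have T_minus: "T (p - q) = T p - T q" for p q
    using T_add[of "p - q" q] by simp
  have T_scal: "T (scal c * p) = c * T p" for c p
  proof -
    have "T (scal c * (\<Sum>w\<in>K. Poly_Mapping.single w (f w))) =
        c * T (\<Sum>w\<in>K. Poly_Mapping.single w (f w))" if "finite K" for K f
      using that
      by induction (simp_all add: T_zero algebra_simps T_add scal_single T_single)
    from this[of "Poly_Mapping.keys p" "Poly_Mapping.lookup p"] show ?thesis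
      using poly_mapping_sum_singles[of p] by simp
  qed
  \<comment> \<open>the largest two-sided ideal on which \<open>T\<close> vanishes\<close>
  define J where "J = {p \<in> FA. \<forall>q\<in>FA. \<forall>r\<in>FA. T (q * p * r) = 0}"
  have J_test: "p \<in> J" if p: "p \<in> FA" and
    *: "\<And>u v. set u \<subseteq> vset L \<Longrightarrow> set v \<subseteq> vset L \<Longrightarrow>
        T (Poly_Mapping.single (Word u) 1 * p * Poly_Mapping.single (Word v) 1) = 0" for p
  proof -
    have "T (q * p * r) = 0" if "q \<in> FA" "r \<in> FA" for q r
      using that
    proof (induction q rule: FA_induct)
      case (single u c)
      note u = single(1)
      show ?case
        using single(2)
      proof (induction r rule: FA_induct)
        case (single v d)
        have "Poly_Mapping.single (Word u) c = scal c * Poly_Mapping.single (Word u) 1"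
          "Poly_Mapping.single (Word v) d = Poly_Mapping.single (Word v) 1 * scal d"
          by (simp_all add: scal_central scal_single)
        then have "Poly_Mapping.single (Word u) c * p * Poly_Mapping.single (Word v) d = scal c *
            ((Poly_Mapping.single (Word u) 1 * p * Poly_Mapping.single (Word v) 1) * scal d)"
          by (simp only: mult.assoc)
        then show ?case using *[OF u single] by (simp add: scal_central T_scal)
      qed (simp add: distrib_left T_add)
    qed (simp add: distrib_right T_add)
    with p show ?thesis by (simp add: J_def)
  qed
  have "ideal J (free_alg L)"
  proof (rule idealI[OF ring_FA])
    show "subgroup J (add_monoid (free_alg L))"
    proof (rule F.add.subgroupI)
      show "J \<subseteq> FA" by (auto simp: J_def)
      show "J \<noteq> {}" using FA_zero by (auto simp: J_def T_zero intro!: exI[of _ 0])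
      show "p \<oplus>\<^bsub>free_alg L\<^esub> q \<in> J" if "p \<in> J" "q \<in> J" for p q
        using that by (simp add: J_def FA_simps FA_add distrib_left distrib_right T_add)
      show "\<ominus>\<^bsub>free_alg L\<^esub> p \<in> J" if p: "p \<in> J" for p
      proof -
        have "\<ominus>\<^bsub>free_alg L\<^esub> p = - p"
          using p by (intro F.minus_equality) (auto simp: J_def FA_simps FA_uminus)
        moreover have "T (- x) = - T x" for x
          using T_minus[of 0 x] by (simp add: T_zero)
        ultimately show ?thesis using p by (simp add: J_def FA_uminus)
      qed
    qed
    show "x \<otimes>\<^bsub>free_alg L\<^esub> p \<in> J" if "p \<in> J" "x \<in> FA" for p x
      using that by (simp add: J_def FA_simps FA_mult mult.assoc[symmetric])
    show "p \<otimes>\<^bsub>free_alg L\<^esub> x \<in> J" if "p \<in> J" "x \<in> FA" for p x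
    proof -
      have "q * (p * x) * r = q * p * (x * r)" for q r
        by (simp only: mult.assoc)
      with that show ?thesis by (simp add: J_def FA_simps FA_mult)
    qed
  qed
  moreover have "env_rels L \<subseteq> J"
  proof
    fix r assume r: "r \<in> env_rels L"
    show "r \<in> J"
    proof (rule J_test)
      show "r \<in> FA" using r env_rels_FA by auto
      fix u v assume uv: "set u \<subseteq> vset L" "set v \<subseteq> vset L"
      note expand = gen_def scal_def mult_single plus_word_def zero_word_def left_diff_distrib
        right_diff_distrib T_minus T_single
      from r consider a b where "a \<in> vset L" "b \<in> vset L" "r = gen (vadd L a b) - gen a - gen b"
        | a c where "a \<in> vset L" "r = gen (vsmul L c a) - scal c * gen a"
        | a b where "a \<in> vset L" "b \<in> vset L" "r = gen a * gen b - gen b * gen a - gen (lbr L a b)"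
        unfolding env_rels_def by blast
      then show "T (Poly_Mapping.single (Word u) 1 * r * Poly_Mapping.single (Word v) 1) = 0"
      proof cases
        case 1
        then show ?thesis using add[OF uv 1(1,2)] by (simp add: expand)
      next
        case 2
        then show ?thesis using smul[OF uv 2(1)] by (simp add: expand)
      next
        case 3
        then show ?thesis using comm[OF uv 3(1,2)] by (simp add: expand)
      qed
    qed
  qed
  ultimately have "env_ideal L \<subseteq> J"
    unfolding env_ideal_def by (rule F.genideal_minimal)
  then have "T p = 0" if "p \<in> env_ideal L" for p
    using that bspec[OF bspec[OF _ FA_one] FA_one, of "\<lambda>q r. T (q * p * r) = 0"]
    by (auto simp: J_def)
  from functional_descends[OF T_add T_scal this] obtain F
    where F: "F \<in> \<Phi>" "\<And>p. p \<in> FA \<Longrightarrow> F (cls p) = T p" by blast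
  have "F (env_word w) = e w" if "set w \<subseteq> vset L" for w
    using that by (simp add: env_word_cls F FA_single T_single)
  with F(1) show ?thesis by (rule that)
qed

end

section \<open>A Lie algebra embeds into its enveloping algebra\<close>

fun inversions :: "nat list \<Rightarrow> nat" where
  "inversions [] = 0"
| "inversions (i # w) = length (filter (\<lambda>j. j < i) w) + inversions w"

lemma inversions_swap: "i < j \<Longrightarrow> inversions (a @ i # j # b) < inversions (a @ j # i # b)"
  by (induction a) auto

locale structure_constants =
  fixes n :: nat and c :: "nat \<Rightarrow> nat \<Rightarrow> nat \<Rightarrow> 'k::field" and x :: "nat \<Rightarrow> 'k"
  assumes alternating: "c i i k = 0"
    and antisymmetric: "c i j k = - c j i k"
    and jacobi: "(\<Sum>m<n. c i j m * c m k l + c j k m * c m i l + c k i m * c m j l) = 0"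
begin

text \<open>Words in the indices of a basis are rewritten by replacing an inverted pair of neighbours
  \<open>j i\<close> by \<open>i j\<close> plus the bracket of the two basis elements. Below, \<open>nf w\<close> is the value at the
  linear functional with coefficients \<open>x\<close> of the degree one part of the normal form of \<open>w\<close>. The pair
  to rewrite is chosen arbitrarily; that the choice is irrelevant is the content of \<open>nf_descent\<close>.\<close>

definition descent :: "nat list \<Rightarrow> nat list \<times> nat \<times> nat \<times> nat list \<Rightarrow> bool" where
  "descent w = (\<lambda>(a, j, i, b). w = a @ j # i # b \<and> i < j)"

function nf :: "nat list \<Rightarrow> 'k" where
  "nf w = (if Ex (descent w)
     then (case (SOME d. descent w d) of (a, j, i, b) \<Rightarrow>
             nf (a @ i # j # b) + (\<Sum>k<n. c j i k * nf (a @ k # b)))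
     else (case w of [i] \<Rightarrow> x i | _ \<Rightarrow> 0))"
  by pat_completeness auto
termination
proof (relation "measures [length, inversions]")
  fix w a j i b d e
  assume *: "Ex (descent w)" "(a, d) = (SOME d. descent w d)" "(j, e) = d" "(i, b) = e"
  then have "descent w (a, j, i, b)" by (metis someI_ex)
  then show "(a @ i # j # b, w) \<in> measures [length, inversions]"
    "(a @ k # b, w) \<in> measures [length, inversions]" for k
    by (auto simp: descent_def inversions_swap)
qed simp

declare nf.simps [simp del]

lemma nf_single: "nf [i] = x i"
proof -
  have "\<not> Ex (descent [i])" by (auto simp: descent_def Cons_eq_append_conv)
  then show ?thesis by (subst nf.simps) simp
qed

definition contract :: "nat list \<Rightarrow> nat \<Rightarrow> nat \<Rightarrow> nat list \<Rightarrow> 'k" where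
  "contract a j i b = (\<Sum>k<n. c j i k * nf (a @ k # b))"

lemma nf_some_descent:
  assumes "descent w d"
  obtains a j i b where "descent w (a, j, i, b)" "nf w = nf (a @ i # j # b) + contract a j i b"
proof -
  obtain a j i b where d: "(SOME d. descent w d) = (a, j, i, b)" by (metis prod_cases4)
  then have "descent w (a, j, i, b)" using assms by (metis someI)
  moreover have "nf w = nf (a @ i # j # b) + contract a j i b"
    using exI[of "descent w", OF assms] by (subst nf.simps) (simp add: d contract_def)
  ultimately show ?thesis by (rule that)
qed

lemma contract_antisym: "contract a i j b = - contract a j i b"
  unfolding contract_def sum_negf[symmetric]
  by (intro sum.cong refl) (subst antisymmetric, simp)

text \<open>The rewriting system is confluent: both ways to resolve a word with two descents lead to the
  same value. Two disjoint descents commute; for two overlapping ones the difference of the two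
  values is a sum that the Jacobi identity makes vanish.\<close>

lemma confluent_overlapping:
  assumes w: "w = a @ p # q # r # b" and "q < p" "r < q"
    and short: "\<And>a j i b. length (a @ j # i # b) < length w \<Longrightarrow>
        nf (a @ j # i # b) - nf (a @ i # j # b) = contract a j i b"
    and fewer: "\<And>a j i b. length (a @ j # i # b) = length w \<Longrightarrow>
        inversions (a @ j # i # b) < inversions w \<Longrightarrow> i < j \<Longrightarrow>
        nf (a @ j # i # b) = nf (a @ i # j # b) + contract a j i b"
  shows "nf (a @ q # p # r # b) + contract a p q (r # b) = nf (a @ p # r # q # b)
      + contract (a @ [p]) q r b"
proof -
  have inv: "inversions (a @ q # p # r # b) < inversions w"
      "inversions (a @ q # r # p # b) < inversions (a @ q # p # r # b)"
      "inversions (a @ p # r # q # b) < inversions w"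
      "inversions (a @ r # p # q # b) < inversions (a @ p # r # q # b)"
    using inversions_swap[of q p a "r # b"] inversions_swap[of r p "a @ [q]" b]
      inversions_swap[of r q "a @ [p]" b] inversions_swap[of r p a "q # b"] assms(2,3) w by simp_all
  have "nf (a @ q # p # r # b) = nf (a @ q # r # p # b) + contract (a @ [q]) p r b"
    using fewer[of "a @ [q]" p r b] inv w assms(2,3) by simp
  moreover have "nf (a @ q # r # p # b) = nf (a @ r # q # p # b) + contract a q r (p # b)"
    using fewer[of a q r "p # b"] inv w assms(2,3) by simp
  moreover have "nf (a @ p # r # q # b) = nf (a @ r # p # q # b) + contract a p r (q # b)"
    using fewer[of a p r "q # b"] inv w assms(2,3) by simp
  moreover have "nf (a @ r # p # q # b) = nf (a @ r # q # p # b) + contract (a @ [r]) p q b"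
    using fewer[of "a @ [r]" p q b] inv w assms(2,3) by simp
  moreover have "contract a q r (p # b) - contract (a @ [p]) q r b
      + (contract a r p (q # b) - contract (a @ [q]) r p b)
      + (contract a p q (r # b) - contract (a @ [r]) p q b) = 0"
  proof -
    have diff: "contract a i j (h # b) - contract (a @ [h]) i j b =
        (\<Sum>l<n. (\<Sum>m<n. c i j m * c m h l) * nf (a @ l # b))" for i j h
    proof -
      have "contract a i j (h # b) - contract (a @ [h]) i j b =
          (\<Sum>m<n. c i j m * (nf (a @ m # h # b) - nf (a @ h # m # b)))"
        by (simp add: contract_def sum_subtractf right_diff_distrib)
      also have "\<dots> = (\<Sum>m<n. \<Sum>l<n. c i j m * c m h l * nf (a @ l # b))"
        using w by (simp add: short contract_def sum_distrib_left mult.assoc)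
      also have "\<dots> = (\<Sum>l<n. \<Sum>m<n. c i j m * c m h l * nf (a @ l # b))"
        by (rule sum.swap)
      finally show ?thesis by (simp add: sum_distrib_right)
    qed
    show ?thesis
      unfolding diff sum.distrib[symmetric] distrib_right[symmetric]
      using jacobi[of q r p] by (simp add: sum.distrib)
  qed
  moreover have "contract (a @ [q]) r p b = - contract (a @ [q]) p r b"
    "contract a r p (q # b) = - contract a p r (q # b)"
    by (rule contract_antisym)+
  ultimately show ?thesis by (simp add: algebra_simps)
qed

lemma confluent_disjoint:
  assumes w: "w = a @ j # i # m @ l # k # b" and "i < j" "k < l"
    and short: "\<And>a j i b. length (a @ j # i # b) < length w \<Longrightarrow>
        nf (a @ j # i # b) - nf (a @ i # j # b) = contract a j i b"
    and fewer: "\<And>a j i b. length (a @ j # i # b) = length w \<Longrightarrow>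
        inversions (a @ j # i # b) < inversions w \<Longrightarrow> i < j \<Longrightarrow>
        nf (a @ j # i # b) = nf (a @ i # j # b) + contract a j i b"
  shows "nf (a @ i # j # m @ l # k # b) + contract a j i (m @ l # k # b)
       = nf (a @ j # i # m @ k # l # b) + contract (a @ j # i # m) l k b"
proof -
  have "inversions (a @ i # j # m @ l # k # b) < inversions w"
      "inversions (a @ j # i # m @ k # l # b) < inversions w"
    using inversions_swap[of i j a "m @ l # k # b"] inversions_swap[of k l "a @ j # i # m" b]
      assms(2,3) w by simp_all
  then have "nf (a @ i # j # m @ l # k # b) = nf (a @ i # j # m @ k # l # b)
      + contract (a @ i # j # m) l k b"
    "nf (a @ j # i # m @ k # l # b) = nf (a @ i # j # m @ k # l # b) + contract a j i (m @ k # l # b)"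
    using fewer[of "a @ i # j # m" l k b] fewer[of a j i "m @ k # l # b"] assms(2,3) w by simp_all
  moreover have "contract (a @ j # i # m) l k b - contract (a @ i # j # m) l k b
      = contract a j i (m @ l # k # b) - contract a j i (m @ k # l # b)"
  proof -
    have 1: "nf (a @ j # i # m @ t # b) - nf (a @ i # j # m @ t # b) = contract a j i (m @ t # b)" for t
      using w by (intro short) simp
    have 2: "nf (a @ t # m @ l # k # b) - nf (a @ t # m @ k # l # b) = contract (a @ t # m) l k b" for t
      using short[of "a @ t # m" l k b] w by simp
    have "contract (a @ j # i # m) l k b - contract (a @ i # j # m) l k b
        = (\<Sum>t<n. c l k t * (\<Sum>u<n. c j i u * nf (a @ u # m @ t # b)))"
      using 1 by (simp add: contract_def sum_subtractf[symmetric] right_diff_distrib[symmetric])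
    also have "\<dots> = (\<Sum>t<n. \<Sum>u<n. c j i u * (c l k t * nf (a @ u # m @ t # b)))"
      by (simp add: sum_distrib_left mult.left_commute)
    also have "\<dots> = (\<Sum>u<n. \<Sum>t<n. c j i u * (c l k t * nf (a @ u # m @ t # b)))"
      by (rule sum.swap)
    also have "\<dots> = (\<Sum>u<n. c j i u * (\<Sum>t<n. c l k t * nf (a @ u # m @ t # b)))"
      by (simp add: sum_distrib_left)
    also have "\<dots> = contract a j i (m @ l # k # b) - contract a j i (m @ k # l # b)"
      using 2 by (simp add: contract_def sum_subtractf[symmetric] right_diff_distrib[symmetric])
    finally show ?thesis .
  qed
  ultimately show ?thesis by (simp add: algebra_simps)
qed

lemma confluent:
  assumes d: "descent w (a, j, i, b)" and d': "descent w (a', j', i', b')"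
    and le: "length a \<le> length a'"
    and short: "\<And>a j i b. length (a @ j # i # b) < length w \<Longrightarrow>
        nf (a @ j # i # b) - nf (a @ i # j # b) = contract a j i b"
    and fewer: "\<And>a j i b. length (a @ j # i # b) = length w \<Longrightarrow>
        inversions (a @ j # i # b) < inversions w \<Longrightarrow> i < j \<Longrightarrow>
        nf (a @ j # i # b) = nf (a @ i # j # b) + contract a j i b"
  shows "nf (a @ i # j # b) + contract a j i b = nf (a' @ i' # j' # b') + contract a' j' i' b'"
proof -
  have w: "w = a @ j # i # b" "i < j" and w': "w = a' @ j' # i' # b'" "i' < j'"
    using d d' by (auto simp: descent_def)
  obtain e where a': "a' = a @ e"
    using w(1) w'(1) le by (auto simp: append_eq_append_conv2)
  then have eq: "j # i # b = e @ j' # i' # b'" using w w' by simp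
  consider "e = []" | "e = [j]" | m where "e = j # i # m"
    using eq by (cases e; cases "tl e") auto
  then show ?thesis
  proof cases
    case 1
    then show ?thesis using a' eq by simp
  next
    case 2
    then show ?thesis
      using confluent_overlapping[of w a j i i' b', OF _ _ _ short fewer] a' eq w w' by simp
  next
    case 3
    then show ?thesis
      using confluent_disjoint[of w a j i m j' i' b', OF _ _ _ short fewer] a' eq w w' by simp
  qed
qed

text \<open>The diamond lemma, by induction on the length and then on the number of inversions. Shorter
  words may be rewritten in both directions, words of the same length only if they have fewer
  inversions.\<close>

lemma nf_descent: "i < j \<Longrightarrow> nf (a @ j # i # b) = nf (a @ i # j # b) + contract a j i b"
proof (induction "a @ j # i # b" arbitrary: a j i b rule: wf_induct_rule[OF wf_measures[of
    "[length, inversions]"]])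
  case (1 a j i b)
  let ?w = "a @ j # i # b"
  have fewer: "nf (a' @ j' # i' # b') = nf (a' @ i' # j' # b') + contract a' j' i' b'"
    if "length (a' @ j' # i' # b') = length ?w" "inversions (a' @ j' # i' # b') < inversions ?w" "i' < j'"
    for a' j' i' b'
    using that by (intro 1(1)) auto
  have short: "nf (a' @ j' # i' # b') - nf (a' @ i' # j' # b') = contract a' j' i' b'"
    if len: "length (a' @ j' # i' # b') < length ?w" for a' j' i' b'
  proof (cases j' i' rule: linorder_cases)
    case less
    then have "nf (a' @ i' # j' # b') = nf (a' @ j' # i' # b') + contract a' i' j' b'"
      using len by (intro 1(1)) auto
    then show ?thesis using contract_antisym[of a' i' j' b'] by simp
  next
    case equal
    then show ?thesis by (simp add: contract_def alternating)
  next
    case greater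
    then have "nf (a' @ j' # i' # b') = nf (a' @ i' # j' # b') + contract a' j' i' b'"
      using len by (intro 1(1)) auto
    then show ?thesis by simp
  qed
  have d: "descent ?w (a, j, i, b)" using 1(2) by (simp add: descent_def)
  then obtain a' j' i' b' where d': "descent ?w (a', j', i', b')"
    and eq: "nf ?w = nf (a' @ i' # j' # b') + contract a' j' i' b'"
    by (rule nf_some_descent)
  show ?case
  proof (cases "length a \<le> length a'")
    case True
    then show ?thesis using confluent[OF d d' _ short fewer] eq by simp
  next
    case False
    then show ?thesis using confluent[OF d' d _ short fewer] eq by simp
  qed
qed

lemma nf_comm: "nf (a @ j # i # b) - nf (a @ i # j # b) = contract a j i b"
proof (cases j i rule: linorder_cases)
  case less
  then show ?thesis using nf_descent[of j i a b] contract_antisym[of a i j b] by simp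
next
  case equal
  then show ?thesis by (simp add: contract_def alternating)
next
  case greater
  then show ?thesis using nf_descent[of i j a b] by simp
qed

end

text \<open>The degree one part of the Poincare-Birkhoff-Witt theorem: in coordinates, every linear
  functional on \<open>L\<close> is the restriction of one on \<open>U(L)\<close>. The extension reads off the coefficients of
  degree one in the normal form of a word, as computed by \<open>nf\<close> on words in basis elements.\<close>

lemma (in enveloping) functional_extends:
  fixes n :: nat and coord :: "'a \<Rightarrow> nat \<Rightarrow> 'k" and x :: "nat \<Rightarrow> 'k"
  assumes sc: "structure_constants n c"
    and coord_add: "\<And>a b i. a \<in> vset L \<Longrightarrow> b \<in> vset L \<Longrightarrow> coord (vadd L a b) i = coord a i + coord b i"
    and coord_smul: "\<And>s a i. a \<in> vset L \<Longrightarrow> coord (vsmul L s a) i = s * coord a i"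
    and coord_br: "\<And>a b k. a \<in> vset L \<Longrightarrow> b \<in> vset L \<Longrightarrow>
        coord (lbr L a b) k = (\<Sum>i<n. \<Sum>j<n. coord a i * coord b j * c i j k)"
  obtains F where "F \<in> \<Phi>" "\<And>a. a \<in> vset L \<Longrightarrow> F (\<iota> a) = (\<Sum>i<n. coord a i * x i)"
proof -
  interpret structure_constants n c x by fact
  \<comment> \<open>the multilinear extension of \<open>nf\<close> to words in \<open>L\<close>; \<open>js\<close> collects the indices chosen so far\<close>
  define e where "e = rec_list nf (\<lambda>a _ r js. \<Sum>i<n. coord a i * r (js @ [i]))"
  have e_simps: "e [] js = nf js" "e (a # w) js = (\<Sum>i<n. coord a i * e w (js @ [i]))" for a w js
    by (simp_all add: e_def)
  have e_comm: "e v (u @ i # j # t) - e v (u @ j # i # t) = (\<Sum>k<n. c i j k * e v (u @ k # t))" for u v i j t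
  proof (induction v arbitrary: t)
    case Nil
    then show ?case using nf_comm by (simp add: e_simps contract_def)
  next
    case (Cons a v)
    have "e (a # v) (u @ i # j # t) - e (a # v) (u @ j # i # t) =
        (\<Sum>h<n. coord a h * (e v (u @ i # j # (t @ [h])) - e v (u @ j # i # (t @ [h]))))"
      by (simp add: e_simps sum_subtractf right_diff_distrib)
    also have "\<dots> = (\<Sum>h<n. \<Sum>k<n. c i j k * (coord a h * e v (u @ k # t @ [h])))"
      unfolding Cons by (simp add: sum_distrib_left mult.left_commute)
    also have "\<dots> = (\<Sum>k<n. \<Sum>h<n. c i j k * (coord a h * e v (u @ k # t @ [h])))"
      by (rule sum.swap)
    also have "\<dots> = (\<Sum>k<n. c i j k * e (a # v) (u @ k # t))"
      by (simp add: e_simps sum_distrib_left)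
    finally show ?case .
  qed
  have add: "e (u @ vadd L a b # v) js = e (u @ a # v) js + e (u @ b # v) js"
    if "a \<in> vset L" "b \<in> vset L" for u v a b js
    by (induction u arbitrary: js) (simp_all add: e_simps coord_add that algebra_simps sum.distrib)
  have smul: "e (u @ vsmul L s a # v) js = s * e (u @ a # v) js" if "a \<in> vset L" for u v a s js
    by (induction u arbitrary: js)
      (simp_all add: e_simps coord_smul that sum_distrib_left mult.assoc mult.left_commute)
  have comm: "e (u @ a # b # v) js - e (u @ b # a # v) js = e (u @ lbr L a b # v) js"
    if ab: "a \<in> vset L" "b \<in> vset L" for u v a b js
  proof (induction u arbitrary: js)
    case Nil
    have "e (a # b # v) js - e (b # a # v) js =
        (\<Sum>i<n. \<Sum>j<n. coord a i * (coord b j * e v (js @ [i, j]))) -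
        (\<Sum>j<n. \<Sum>i<n. coord a i * (coord b j * e v (js @ [j, i])))"
      by (simp add: e_simps sum_distrib_left mult.left_commute)
    also have "\<dots> = (\<Sum>i<n. \<Sum>j<n. coord a i * (coord b j * e v (js @ [i, j]))) -
        (\<Sum>i<n. \<Sum>j<n. coord a i * (coord b j * e v (js @ [j, i])))"
      by (subst (2) sum.swap) (rule refl)
    also have "\<dots> = (\<Sum>i<n. \<Sum>j<n. coord a i * coord b j * (e v (js @ i # j # []) - e v (js @ j # i # [])))"
      by (simp add: sum_subtractf algebra_simps)
    also have "\<dots> = (\<Sum>i<n. \<Sum>j<n. \<Sum>k<n. coord a i * coord b j * c i j k * e v (js @ [k]))"
      unfolding e_comm by (simp add: sum_distrib_left mult.assoc)
    also have "\<dots> = (\<Sum>i<n. \<Sum>k<n. \<Sum>j<n. coord a i * coord b j * c i j k * e v (js @ [k]))"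
      by (intro sum.cong refl sum.swap)
    also have "\<dots> = (\<Sum>k<n. \<Sum>i<n. \<Sum>j<n. coord a i * coord b j * c i j k * e v (js @ [k]))"
      by (rule sum.swap)
    also have "\<dots> = e (lbr L a b # v) js"
      by (simp add: e_simps coord_br ab sum_distrib_right)
    finally show ?case by simp
  next
    case (Cons h u)
    have "e ((h # u) @ a # b # v) js - e ((h # u) @ b # a # v) js =
        (\<Sum>i<n. coord h i * (e (u @ a # b # v) (js @ [i]) - e (u @ b # a # v) (js @ [i])))"
      by (simp add: e_simps sum_subtractf right_diff_distrib)
    then show ?case by (simp add: Cons e_simps)
  qed
  obtain F where F: "F \<in> \<Phi>" "\<And>w. set w \<subseteq> vset L \<Longrightarrow> F (env_word w) = e w []"
    using functional_from_words[of "\<lambda>w. e w []", OF add smul comm] by blast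
  have "F (\<iota> a) = (\<Sum>i<n. coord a i * x i)" if "a \<in> vset L" for a
    using F(2)[of "[a]"] that by (simp add: env_word_simps U_mul_one U_incl e_simps nf_single)
  with F(1) show ?thesis by (rule that)
qed

section \<open>The twisted forms \<open>(a, b) \<mapsto> \<theta> (a S(b\<^sub>2)) F (b\<^sub>1)\<close>\<close>

lemma tsmul_apply: "tsmul c t \<beta> = c * t \<beta>"
  by (simp add: tsmul_def)

context enveloping
begin

lemma U_tensor_cong:
  assumes "t \<in> tensor2 U" "\<And>a b. a \<in> vset U \<Longrightarrow> b \<in> vset U \<Longrightarrow> \<beta> a b = \<gamma> a b"
  shows "t \<beta> = t \<gamma>"
  using assms U_add U_smul by (rule tensor2_cong)

lemma U_form_cong:
  assumes "\<And>a b. a \<in> vset U \<Longrightarrow> b \<in> vset U \<Longrightarrow> \<beta> a b = \<gamma> a b"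
  shows "bilinear_form U \<beta> \<longleftrightarrow> bilinear_form U \<gamma>"
  using assms U_add U_smul by (rule bilinear_form_cong)

lemma U_formI:
  assumes "\<And>x y z. x \<in> vset U \<Longrightarrow> y \<in> vset U \<Longrightarrow> z \<in> vset U \<Longrightarrow> \<beta> (x \<boxplus> y) z = \<beta> x z + \<beta> y z"
    "\<And>x y z. x \<in> vset U \<Longrightarrow> y \<in> vset U \<Longrightarrow> z \<in> vset U \<Longrightarrow> \<beta> z (x \<boxplus> y) = \<beta> z x + \<beta> z y"
    "\<And>c x z. x \<in> vset U \<Longrightarrow> z \<in> vset U \<Longrightarrow> \<beta> (c \<boxdot> x) z = c * \<beta> x z"
    "\<And>c x z. x \<in> vset U \<Longrightarrow> z \<in> vset U \<Longrightarrow> \<beta> z (c \<boxdot> x) = c * \<beta> z x"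
  shows "bilinear_form U \<beta>"
  using assms by (simp add: bilinear_form_def)

lemma U_formD:
  assumes "bilinear_form U \<beta>" "x \<in> vset U" "y \<in> vset U" "z \<in> vset U"
  shows "\<beta> (x \<boxplus> y) z = \<beta> x z + \<beta> y z" "\<beta> z (x \<boxplus> y) = \<beta> z x + \<beta> z y"
    "\<beta> (c \<boxdot> x) z = c * \<beta> x z" "\<beta> z (c \<boxdot> x) = c * \<beta> z x"
  using assms by (simp_all add: bilinear_form_def)

lemma U_form_mult_right:
  "bilinear_form U \<beta> \<Longrightarrow> c \<in> vset U \<Longrightarrow> d \<in> vset U \<Longrightarrow> bilinear_form U (\<lambda>a b. \<beta> (a \<odot> c) (b \<odot> d))"
  by (rule U_formI) (simp_all add: U_distl U_smul_mul U_mul U_formD)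

lemma U_form_mult_left:
  "bilinear_form U \<beta> \<Longrightarrow> c \<in> vset U \<Longrightarrow> d \<in> vset U \<Longrightarrow> bilinear_form U (\<lambda>a b. \<beta> (c \<odot> a) (d \<odot> b))"
  by (rule U_formI) (simp_all add: U_distr U_mul_smul U_mul U_formD)

lemma U_form_mult_fst:
  "bilinear_form U \<beta> \<Longrightarrow> c \<in> vset U \<Longrightarrow> bilinear_form U (\<lambda>a b. \<beta> (c \<odot> a) b)"
  by (rule U_formI) (simp_all add: U_distr U_mul_smul U_mul U_formD)

lemma U_form_mult_snd:
  "bilinear_form U \<beta> \<Longrightarrow> c \<in> vset U \<Longrightarrow> bilinear_form U (\<lambda>a b. \<beta> a (c \<odot> b))"
  by (rule U_formI) (simp_all add: U_distr U_mul_smul U_mul U_formD)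

definition lmul :: "('a, 'k) env \<Rightarrow> (('a, 'k) env \<Rightarrow> 'k) \<Rightarrow> ('a, 'k) env \<Rightarrow> 'k" where
  "lmul Z F = (\<lambda>X. if X \<in> vset U then F (Z \<odot> X) else 0)"

definition rmul :: "('a, 'k) env \<Rightarrow> (('a, 'k) env \<Rightarrow> 'k) \<Rightarrow> ('a, 'k) env \<Rightarrow> 'k" where
  "rmul Z F = (\<lambda>X. if X \<in> vset U then F (X \<odot> Z) else 0)"

lemma \<Phi>I:
  assumes "\<And>X Y. X \<in> vset U \<Longrightarrow> Y \<in> vset U \<Longrightarrow> F (X \<boxplus> Y) = F X + F Y"
    "\<And>c X. X \<in> vset U \<Longrightarrow> F (c \<boxdot> X) = c * F X" "\<And>X. X \<notin> vset U \<Longrightarrow> F X = 0"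
  shows "F \<in> \<Phi>"
  using assms by (simp add: linforms_def)

lemma \<Phi>_plus: "F \<in> \<Phi> \<Longrightarrow> G \<in> \<Phi> \<Longrightarrow> F + G \<in> \<Phi>"
  by (simp add: linforms_def algebra_simps)

lemma \<Phi>_minus: "F \<in> \<Phi> \<Longrightarrow> G \<in> \<Phi> \<Longrightarrow> F - G \<in> \<Phi>"
  by (simp add: linforms_def algebra_simps)

lemma \<Phi>_tsmul: "F \<in> \<Phi> \<Longrightarrow> tsmul c F \<in> \<Phi>"
  by (simp add: linforms_def algebra_simps tsmul_apply)

lemma lmul_apply: "X \<in> vset U \<Longrightarrow> lmul Z F X = F (Z \<odot> X)"
  and rmul_apply: "X \<in> vset U \<Longrightarrow> rmul Z F X = F (X \<odot> Z)"
  by (simp_all add: lmul_def rmul_def)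

lemma lmul_\<Phi>: "F \<in> \<Phi> \<Longrightarrow> Z \<in> vset U \<Longrightarrow> lmul Z F \<in> \<Phi>"
  by (rule \<Phi>I) (simp_all add: lmul_def U_add U_smul U_distr U_mul_smul U_mul \<Phi>_add \<Phi>_smul)

lemma rmul_\<Phi>: "F \<in> \<Phi> \<Longrightarrow> Z \<in> vset U \<Longrightarrow> rmul Z F \<in> \<Phi>"
  by (rule \<Phi>I) (simp_all add: rmul_def U_add U_smul U_distl U_smul_mul U_mul \<Phi>_add \<Phi>_smul)

lemma lmul_linear: "lmul Z (F + G) = lmul Z F + lmul Z G" "lmul Z (F - G) = lmul Z F - lmul Z G"
    "lmul Z (tsmul c F) = tsmul c (lmul Z F)"
  and rmul_linear: "rmul Z (F + G) = rmul Z F + rmul Z G" "rmul Z (F - G) = rmul Z F - rmul Z G"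
    "rmul Z (tsmul c F) = tsmul c (rmul Z F)"
  by (auto simp: lmul_def rmul_def tsmul_def)

lemma lmul_add: "F \<in> \<Phi> \<Longrightarrow> Y \<in> vset U \<Longrightarrow> Z \<in> vset U \<Longrightarrow> lmul (Y \<boxplus> Z) F = lmul Y F + lmul Z F"
  and rmul_add: "F \<in> \<Phi> \<Longrightarrow> Y \<in> vset U \<Longrightarrow> Z \<in> vset U \<Longrightarrow> rmul (Y \<boxplus> Z) F = rmul Y F + rmul Z F"
  and lmul_smul: "F \<in> \<Phi> \<Longrightarrow> Z \<in> vset U \<Longrightarrow> lmul (c \<boxdot> Z) F = tsmul c (lmul Z F)"
  and rmul_smul: "F \<in> \<Phi> \<Longrightarrow> Z \<in> vset U \<Longrightarrow> rmul (c \<boxdot> Z) F = tsmul c (rmul Z F)"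
  by (auto simp: lmul_def rmul_def fun_eq_iff U_distl U_distr U_smul_mul U_mul_smul U_mul
      \<Phi>_add \<Phi>_smul tsmul_def)

lemma lmul_lmul: "Y \<in> vset U \<Longrightarrow> Z \<in> vset U \<Longrightarrow> lmul Y (lmul Z F) = lmul (Z \<odot> Y) F"
  and rmul_rmul: "Y \<in> vset U \<Longrightarrow> Z \<in> vset U \<Longrightarrow> rmul Y (rmul Z F) = rmul (Y \<odot> Z) F"
  and lmul_rmul: "Y \<in> vset U \<Longrightarrow> Z \<in> vset U \<Longrightarrow> lmul Y (rmul Z F) = rmul Z (lmul Y F)"
  by (auto simp: lmul_def rmul_def fun_eq_iff U_mul U_assoc)

text \<open>The map \<open>b \<mapsto> S(b\<^sub>2) \<otimes> b\<^sub>1\<close> is the algebra homomorphism \<open>U \<rightarrow> U\<^sup>o\<^sup>p \<otimes> U\<close> with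
  \<open>\<xi> \<mapsto> 1 \<otimes> \<xi> - \<xi> \<otimes> 1\<close> for \<open>\<xi> \<in> L\<close>. Hence the form \<open>(a, b) \<mapsto> \<theta> (a S(b\<^sub>2)) F (b\<^sub>1)\<close> can be computed
  along the letters of \<open>b\<close>, which avoids the antipode altogether.\<close>

fun twist_word :: "'a list \<Rightarrow> (('a, 'k) env \<Rightarrow> 'k) \<Rightarrow> (('a, 'k) env \<Rightarrow> 'k) \<Rightarrow>
    ('a, 'k) env \<Rightarrow> 'k" where
  "twist_word [] \<theta> F a = \<theta> a * F (aone U)"
| "twist_word (\<xi> # w) \<theta> F a = twist_word w \<theta> (lmul (\<iota> \<xi>) F) a - twist_word w (rmul (\<iota> \<xi>) \<theta>) F a"

lemma twist_word_fst: "twist_word w (\<theta> + \<theta>') F a = twist_word w \<theta> F a + twist_word w \<theta>' F a"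
    "twist_word w (tsmul c \<theta>) F a = c * twist_word w \<theta> F a"
  by (induction w arbitrary: \<theta> \<theta>' F) (simp_all add: rmul_linear algebra_simps tsmul_apply)

lemma twist_word_snd: "twist_word w \<theta> (F + G) a = twist_word w \<theta> F a + twist_word w \<theta> G a"
    "twist_word w \<theta> (tsmul c F) a = c * twist_word w \<theta> F a"
  by (induction w arbitrary: \<theta> F G) (simp_all add: lmul_linear algebra_simps tsmul_apply)

lemma twist_word_add:
  "set w \<subseteq> vset L \<Longrightarrow> \<theta> \<in> \<Phi> \<Longrightarrow> a \<in> vset U \<Longrightarrow> b \<in> vset U \<Longrightarrow>
    twist_word w \<theta> F (a \<boxplus> b) = twist_word w \<theta> F a + twist_word w \<theta> F b"
  by (induction w arbitrary: \<theta> F) (simp_all add: \<Phi>_add rmul_\<Phi> U_incl algebra_simps)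

lemma twist_word_smul:
  "set w \<subseteq> vset L \<Longrightarrow> \<theta> \<in> \<Phi> \<Longrightarrow> a \<in> vset U \<Longrightarrow>
    twist_word w \<theta> F (c \<boxdot> a) = c * twist_word w \<theta> F a"
  by (induction w arbitrary: \<theta> F) (simp_all add: \<Phi>_smul rmul_\<Phi> U_incl algebra_simps)

lemma twist_word_left:
  "set w \<subseteq> vset L \<Longrightarrow> a \<in> vset U \<Longrightarrow> Z \<in> vset U \<Longrightarrow>
    twist_word w \<theta> F (Z \<odot> a) = twist_word w (lmul Z \<theta>) F a"
  by (induction w arbitrary: \<theta> F) (simp_all add: U_incl lmul_rmul lmul_apply)

text \<open>The recursion respects the relations of \<open>U(L)\<close> because \<open>\<xi> \<mapsto> 1 \<otimes> \<xi> - \<xi> \<otimes> 1\<close> respects brackets.\<close>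

lemma twist_word_functional:
  assumes "\<theta> \<in> \<Phi>" "F \<in> \<Phi>"
  obtains G where "G \<in> \<Phi>" "\<And>w. set w \<subseteq> vset L \<Longrightarrow> G (env_word w) = twist_word w \<theta> F a"
proof -
  have add: "twist_word (u @ vadd L \<xi> \<eta> # v) \<theta> F a =
      twist_word (u @ \<xi> # v) \<theta> F a + twist_word (u @ \<eta> # v) \<theta> F a"
    if "set u \<subseteq> vset L" "\<theta> \<in> \<Phi>" "F \<in> \<Phi>" "\<xi> \<in> vset L" "\<eta> \<in> vset L" for u v \<xi> \<eta> \<theta> F
    using that
    by (induction u arbitrary: \<theta> F) (simp_all add: incl_add lmul_add rmul_add U_incl twist_word_fst
        twist_word_snd lmul_\<Phi> rmul_\<Phi>)
  have smul: "twist_word (u @ vsmul L c \<xi> # v) \<theta> F a = c * twist_word (u @ \<xi> # v) \<theta> F a"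
    if "set u \<subseteq> vset L" "\<theta> \<in> \<Phi>" "F \<in> \<Phi>" "\<xi> \<in> vset L" for u v \<xi> c \<theta> F
    using that
    by (induction u arbitrary: \<theta> F) (simp_all add: incl_smul lmul_smul rmul_smul U_incl twist_word_fst
        twist_word_snd lmul_\<Phi> rmul_\<Phi> right_diff_distrib)
  have comm: "twist_word (u @ \<xi> # \<eta> # v) \<theta> F a - twist_word (u @ \<eta> # \<xi> # v) \<theta> F a =
      twist_word (u @ lbr L \<xi> \<eta> # v) \<theta> F a"
    if "set u \<subseteq> vset L" "\<theta> \<in> \<Phi>" "F \<in> \<Phi>" "\<xi> \<in> vset L" "\<eta> \<in> vset L" for u v \<xi> \<eta> \<theta> F
    using that
  proof (induction u arbitrary: \<theta> F)
    case Nil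
    then have "lmul (\<iota> \<eta>) (lmul (\<iota> \<xi>) F) = lmul (\<iota> \<xi>) (lmul (\<iota> \<eta>) F) + lmul (\<iota> (lbr L \<xi> \<eta>)) F"
      "rmul (\<iota> \<xi>) (rmul (\<iota> \<eta>) \<theta>) = rmul (\<iota> \<eta>) (rmul (\<iota> \<xi>) \<theta>) + rmul (\<iota> (lbr L \<xi> \<eta>)) \<theta>"
      by (simp_all add: lmul_lmul rmul_rmul U_incl incl_comm[of \<xi> \<eta>] lmul_add rmul_add U_mul L_br)
    then show ?case by (simp add: twist_word_fst twist_word_snd)
  next
    case (Cons h u)
    then show ?case
      using Cons.IH[of \<theta> "lmul (\<iota> h) F"] Cons.IH[of "rmul (\<iota> h) \<theta>" F]
      by (simp add: lmul_\<Phi> rmul_\<Phi> U_incl algebra_simps)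
  qed
  show ?thesis
    using functional_from_words[of "\<lambda>w. twist_word w \<theta> F a", OF add[OF _ assms] smul[OF _ assms]
      comm[OF _ assms]] that by blast
qed

definition twist :: "(('a, 'k) env \<Rightarrow> 'k) \<Rightarrow> (('a, 'k) env \<Rightarrow> 'k) \<Rightarrow>
    ('a, 'k) env \<Rightarrow> ('a, 'k) env \<Rightarrow> 'k" where
  "twist \<theta> F a = (SOME G. G \<in> \<Phi> \<and> (\<forall>w. set w \<subseteq> vset L \<longrightarrow> G (env_word w) = twist_word w \<theta> F a))"

lemma twist_props:
  assumes "\<theta> \<in> \<Phi>" "F \<in> \<Phi>"
  shows twist_\<Phi>: "twist \<theta> F a \<in> \<Phi>"
    and twist_env_word: "set w \<subseteq> vset L \<Longrightarrow> twist \<theta> F a (env_word w) = twist_word w \<theta> F a"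
proof -
  obtain G where "G \<in> \<Phi>" "\<And>w. set w \<subseteq> vset L \<Longrightarrow> G (env_word w) = twist_word w \<theta> F a"
    using twist_word_functional[OF assms] by blast
  then have "\<exists>G. G \<in> \<Phi> \<and> (\<forall>w. set w \<subseteq> vset L \<longrightarrow> G (env_word w) = twist_word w \<theta> F a)" by blast
  from someI_ex[OF this] show "twist \<theta> F a \<in> \<Phi>"
    "set w \<subseteq> vset L \<Longrightarrow> twist \<theta> F a (env_word w) = twist_word w \<theta> F a"
    by (simp_all add: twist_def)
qed

lemma twist_one: "\<theta> \<in> \<Phi> \<Longrightarrow> F \<in> \<Phi> \<Longrightarrow> twist \<theta> F a (aone U) = \<theta> a * F (aone U)"
  using twist_env_word[of \<theta> F "[]" a] by (simp add: env_word_simps)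

lemma twist_snd_mul:
  assumes "\<theta> \<in> \<Phi>" "F \<in> \<Phi>" "\<xi> \<in> vset L" "b \<in> vset U"
  shows "twist \<theta> F a (\<iota> \<xi> \<odot> b) = twist \<theta> (lmul (\<iota> \<xi>) F) a b - twist (rmul (\<iota> \<xi>) \<theta>) F a b"
proof -
  have "lmul (\<iota> \<xi>) (twist \<theta> F a) = twist \<theta> (lmul (\<iota> \<xi>) F) a - twist (rmul (\<iota> \<xi>) \<theta>) F a"
  proof (rule \<Phi>_eqI)
    fix w assume "set w \<subseteq> vset L"
    with twist_env_word[of \<theta> F "\<xi> # w" a] assms
    show "lmul (\<iota> \<xi>) (twist \<theta> F a) (env_word w) =
        (twist \<theta> (lmul (\<iota> \<xi>) F) a - twist (rmul (\<iota> \<xi>) \<theta>) F a) (env_word w)"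
      by (simp add: lmul_apply env_word_in twist_env_word lmul_\<Phi> rmul_\<Phi> U_incl env_word_simps)
  qed (simp_all add: assms lmul_\<Phi> rmul_\<Phi> twist_\<Phi> U_incl \<Phi>_minus)
  then have "lmul (\<iota> \<xi>) (twist \<theta> F a) b = (twist \<theta> (lmul (\<iota> \<xi>) F) a - twist (rmul (\<iota> \<xi>) \<theta>) F a) b"
    by simp
  then show ?thesis using assms by (simp add: lmul_apply)
qed

lemma twist_fst_mul:
  assumes "\<theta> \<in> \<Phi>" "F \<in> \<Phi>" "Z \<in> vset U" "a \<in> vset U"
  shows "twist \<theta> F (Z \<odot> a) = twist (lmul Z \<theta>) F a"
  by (rule \<Phi>_eqI) (simp_all add: assms twist_\<Phi> lmul_\<Phi> twist_env_word twist_word_left)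

lemma twist_fst_add:
  assumes "\<theta> \<in> \<Phi>" "F \<in> \<Phi>" "a \<in> vset U" "b \<in> vset U"
  shows "twist \<theta> F (a \<boxplus> b) = twist \<theta> F a + twist \<theta> F b"
  by (rule \<Phi>_eqI) (simp_all add: assms twist_\<Phi> \<Phi>_plus twist_env_word twist_word_add)

lemma twist_fst_smul:
  assumes "\<theta> \<in> \<Phi>" "F \<in> \<Phi>" "a \<in> vset U"
  shows "twist \<theta> F (c \<boxdot> a) = tsmul c (twist \<theta> F a)"
  by (rule \<Phi>_eqI) (simp_all add: assms twist_\<Phi> \<Phi>_tsmul twist_env_word twist_word_smul tsmul_apply)

lemma twist_plus_left:
  assumes "\<theta> \<in> \<Phi>" "\<theta>' \<in> \<Phi>" "F \<in> \<Phi>"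
  shows "twist (\<theta> + \<theta>') F a = twist \<theta> F a + twist \<theta>' F a"
  by (rule \<Phi>_eqI) (simp_all add: assms twist_\<Phi> \<Phi>_plus twist_env_word twist_word_fst)

lemma twist_tsmul_left:
  assumes "\<theta> \<in> \<Phi>" "F \<in> \<Phi>"
  shows "twist (tsmul c \<theta>) F a = tsmul c (twist \<theta> F a)"
  by (rule \<Phi>_eqI) (simp_all add: assms twist_\<Phi> \<Phi>_tsmul twist_env_word twist_word_fst tsmul_apply)

lemma twist_plus_right:
  assumes "\<theta> \<in> \<Phi>" "F \<in> \<Phi>" "G \<in> \<Phi>"
  shows "twist \<theta> (F + G) a = twist \<theta> F a + twist \<theta> G a"
  by (rule \<Phi>_eqI) (simp_all add: assms twist_\<Phi> \<Phi>_plus twist_env_word twist_word_snd)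

lemma twist_tsmul_right:
  assumes "\<theta> \<in> \<Phi>" "F \<in> \<Phi>"
  shows "twist \<theta> (tsmul c F) a = tsmul c (twist \<theta> F a)"
  by (rule \<Phi>_eqI) (simp_all add: assms twist_\<Phi> \<Phi>_tsmul twist_env_word twist_word_snd tsmul_apply)

lemma twist_form: "\<theta> \<in> \<Phi> \<Longrightarrow> F \<in> \<Phi> \<Longrightarrow> bilinear_form U (twist \<theta> F)"
  by (rule U_formI) (simp_all add: twist_fst_add twist_fst_smul \<Phi>_add \<Phi>_smul twist_\<Phi> tsmul_apply)

end

section \<open>Dressing fields from the co-Poisson map\<close>

text \<open>Here \<open>d\<close> plays the role of the cobracket of \<open>L\<close>, and \<open>d0\<close> that of the bracket composed with
  the cobracket; the last assumption states this composition after applying a functional on \<open>U(L)\<close>.\<close>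

locale co_poisson_env = enveloping L
  for L :: "('k::field_char_0, 'a, 'm) liealg_scheme" +
  fixes d :: "'a \<Rightarrow> ('a \<Rightarrow> 'a \<Rightarrow> 'k) \<Rightarrow> 'k" and d0 :: "'a \<Rightarrow> 'a"
    and \<Delta> \<delta> :: "('a, 'k) env \<Rightarrow> (('a, 'k) env \<Rightarrow> ('a, 'k) env \<Rightarrow> 'k) \<Rightarrow> 'k"
    and D :: "('a, 'k) env \<Rightarrow> ('a, 'k) env" and s :: 'k
  assumes coproduct: "cocommutative_coproduct L \<Delta>"
    and co_Poisson: "co_Poisson L d \<Delta> \<delta>"
    and derivation: "induced_derivation L d0 D"
    and d_tensor: "\<xi> \<in> vset L \<Longrightarrow> d \<xi> \<in> tensor2 L"
    and d_skew: "\<xi> \<in> vset L \<Longrightarrow> tflip (d \<xi>) = - d \<xi>"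
    and d0_L: "\<xi> \<in> vset L \<Longrightarrow> d0 \<xi> \<in> vset L"
    and bracket_d: "\<xi> \<in> vset L \<Longrightarrow> F \<in> \<Phi> \<Longrightarrow> d \<xi> (\<lambda>\<alpha> \<beta>. F (\<iota> (lbr L \<alpha> \<beta>))) = F (\<iota> (d0 \<xi>))"
begin

lemma \<Delta>_tensor: "X \<in> vset U \<Longrightarrow> \<Delta> X \<in> tensor2 U"
  and \<Delta>_add: "X \<in> vset U \<Longrightarrow> Y \<in> vset U \<Longrightarrow> \<Delta> (X \<boxplus> Y) = \<Delta> X + \<Delta> Y"
  and \<Delta>_smul: "X \<in> vset U \<Longrightarrow> \<Delta> (c \<boxdot> X) = tsmul c (\<Delta> X)"
  and \<Delta>_one: "\<Delta> (aone U) = pure U (aone U) (aone U)"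
  and \<Delta>_mult: "X \<in> vset U \<Longrightarrow> Y \<in> vset U \<Longrightarrow> \<Delta> (X \<odot> Y) = tmul U (\<Delta> X) (\<Delta> Y)"
  and \<Delta>_incl: "\<xi> \<in> vset L \<Longrightarrow> \<Delta> (\<iota> \<xi>) = pure U (\<iota> \<xi>) (aone U) + pure U (aone U) (\<iota> \<xi>)"
  using coproduct unfolding cocommutative_coproduct_def Let_def linear_to_tensor2_def by simp_all

lemma \<delta>_tensor: "X \<in> vset U \<Longrightarrow> \<delta> X \<in> tensor2 U"
  and \<delta>_add: "X \<in> vset U \<Longrightarrow> Y \<in> vset U \<Longrightarrow> \<delta> (X \<boxplus> Y) = \<delta> X + \<delta> Y"
  and \<delta>_smul: "X \<in> vset U \<Longrightarrow> \<delta> (c \<boxdot> X) = tsmul c (\<delta> X)"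
  and \<delta>_incl: "\<xi> \<in> vset L \<Longrightarrow> \<delta> (\<iota> \<xi>) = tmap U \<iota> \<iota> (d \<xi>)"
  and \<delta>_mult: "X \<in> vset U \<Longrightarrow> Y \<in> vset U \<Longrightarrow>
    \<delta> (X \<odot> Y) = tmul U (\<delta> X) (\<Delta> Y) + tmul U (\<Delta> X) (\<delta> Y)"
  using co_Poisson unfolding co_Poisson_def Let_def linear_to_tensor2_def by simp_all

lemma D_in: "X \<in> vset U \<Longrightarrow> D X \<in> vset U"
  and D_add: "X \<in> vset U \<Longrightarrow> Y \<in> vset U \<Longrightarrow> D (X \<boxplus> Y) = D X \<boxplus> D Y"
  and D_smul: "X \<in> vset U \<Longrightarrow> D (c \<boxdot> X) = c \<boxdot> D X"
  and D_incl: "\<xi> \<in> vset L \<Longrightarrow> D (\<iota> \<xi>) = \<iota> (d0 \<xi>)"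
  and D_mult: "X \<in> vset U \<Longrightarrow> Y \<in> vset U \<Longrightarrow> D (X \<odot> Y) = D X \<odot> Y \<boxplus> X \<odot> D Y"
  using derivation unfolding induced_derivation_def Let_def by simp_all

definition \<delta>\<^sub>s :: "('a, 'k) env \<Rightarrow> (('a, 'k) env \<Rightarrow> ('a, 'k) env \<Rightarrow> 'k) \<Rightarrow> 'k" where
  "\<delta>\<^sub>s X = \<delta> X - tsmul s (tmap U D id (\<Delta> X))"

lemma D_form: "bilinear_form U \<beta> \<Longrightarrow> bilinear_form U (\<lambda>a b. \<beta> (D a) b)"
  by (rule U_formI) (simp_all add: D_add D_smul D_in U_formD)

lemma \<delta>\<^sub>s_apply: "bilinear_form U \<beta> \<Longrightarrow> \<delta>\<^sub>s X \<beta> = \<delta> X \<beta> - s * \<Delta> X (\<lambda>a b. \<beta> (D a) b)"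
  by (simp add: \<delta>\<^sub>s_def tsmul_apply tmap_def on_forms_def)

lemma \<delta>\<^sub>s_not_form: "X \<in> vset U \<Longrightarrow> \<not> bilinear_form U \<beta> \<Longrightarrow> \<delta>\<^sub>s X \<beta> = 0"
  by (simp add: \<delta>\<^sub>s_def tsmul_apply tmap_def on_forms_def tensor2_not_form[OF \<delta>_tensor])

lemma \<delta>\<^sub>s_plus:
  "X \<in> vset U \<Longrightarrow> bilinear_form U \<beta> \<Longrightarrow> bilinear_form U \<gamma> \<Longrightarrow>
    \<delta>\<^sub>s X (\<lambda>a b. \<beta> a b + \<gamma> a b) = \<delta>\<^sub>s X \<beta> + \<delta>\<^sub>s X \<gamma>"
  using tensor2_plus[OF \<Delta>_tensor D_form D_form]
  by (simp add: \<delta>\<^sub>s_apply bilinear_form_plus tensor2_plus[OF \<delta>_tensor] algebra_simps)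

lemma \<delta>\<^sub>s_times:
  "X \<in> vset U \<Longrightarrow> bilinear_form U \<beta> \<Longrightarrow> \<delta>\<^sub>s X (\<lambda>a b. c * \<beta> a b) = c * \<delta>\<^sub>s X \<beta>"
  using tensor2_times[OF \<Delta>_tensor D_form]
  by (simp add: \<delta>\<^sub>s_apply bilinear_form_times tensor2_times[OF \<delta>_tensor] algebra_simps)

lemma \<delta>\<^sub>s_cong:
  assumes "X \<in> vset U" "bilinear_form U \<gamma>"
    and eq: "\<And>a b. a \<in> vset U \<Longrightarrow> b \<in> vset U \<Longrightarrow> \<beta> a b = \<gamma> a b"
  shows "\<delta>\<^sub>s X \<beta> = \<delta>\<^sub>s X \<gamma>"
proof -
  have "bilinear_form U \<beta>" using U_form_cong[of \<beta> \<gamma>] assms by simp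
  then show ?thesis
    using assms U_tensor_cong[OF \<delta>_tensor[OF assms(1)], of \<beta> \<gamma>]
      U_tensor_cong[OF \<Delta>_tensor[OF assms(1)], of "\<lambda>a b. \<beta> (D a) b" "\<lambda>a b. \<gamma> (D a) b"]
    by (simp add: \<delta>\<^sub>s_apply D_in)
qed

lemma \<delta>\<^sub>s_add: "X \<in> vset U \<Longrightarrow> Y \<in> vset U \<Longrightarrow> \<delta>\<^sub>s (X \<boxplus> Y) = \<delta>\<^sub>s X + \<delta>\<^sub>s Y"
  by (simp add: \<delta>\<^sub>s_def \<delta>_add \<Delta>_add fun_eq_iff tsmul_apply tmap_def on_forms_def algebra_simps)

lemma \<delta>\<^sub>s_smul: "X \<in> vset U \<Longrightarrow> \<delta>\<^sub>s (c \<boxdot> X) = tsmul c (\<delta>\<^sub>s X)"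
  by (simp add: \<delta>\<^sub>s_def \<delta>_smul \<Delta>_smul fun_eq_iff tsmul_apply tmap_def on_forms_def algebra_simps)

lemma U_form_contract:
  assumes "t \<in> tensor2 U"
    and "\<And>a b. a \<in> vset U \<Longrightarrow> b \<in> vset U \<Longrightarrow> bilinear_form U (f a b)"
    and "\<And>c d. c \<in> vset U \<Longrightarrow> d \<in> vset U \<Longrightarrow> bilinear_form U (\<lambda>a b. f a b c d)"
  shows "bilinear_form U (\<lambda>a b. t (f a b))"
  using assms U_add U_smul by (rule bilinear_form_contract)

lemma \<Delta>_mult_apply:
  "X \<in> vset U \<Longrightarrow> Y \<in> vset U \<Longrightarrow> bilinear_form U \<beta> \<Longrightarrow>
    \<Delta> (X \<odot> Y) \<beta> = \<Delta> X (\<lambda>a b. \<Delta> Y (\<lambda>c d. \<beta> (a \<odot> c) (b \<odot> d)))"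
  by (simp add: \<Delta>_mult tmul_def on_forms_def)

text \<open>\<open>\<delta>\<^sub>s\<close> is a derivation along \<open>\<Delta>\<close>, as \<open>\<delta>\<close> and \<open>(D \<otimes> id) \<circ> \<Delta>\<close> are.\<close>

lemma \<delta>\<^sub>s_mult:
  assumes X: "X \<in> vset U" and Y: "Y \<in> vset U" and \<beta>: "bilinear_form U \<beta>"
  shows "\<delta>\<^sub>s (X \<odot> Y) \<beta> = \<delta>\<^sub>s X (\<lambda>a b. \<Delta> Y (\<lambda>c d. \<beta> (a \<odot> c) (b \<odot> d)))
      + \<Delta> X (\<lambda>a b. \<delta>\<^sub>s Y (\<lambda>c d. \<beta> (a \<odot> c) (b \<odot> d)))"
proof -
  let ?\<beta> = "\<lambda>a b c d. \<beta> (a \<odot> c) (b \<odot> d)"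
  have form1: "bilinear_form U (\<lambda>a b. ?\<beta> a b c d)" if "c \<in> vset U" "d \<in> vset U" for c d
    using U_form_mult_right[OF \<beta> that] .
  have form2: "bilinear_form U (?\<beta> a b)" if "a \<in> vset U" "b \<in> vset U" for a b
    using U_form_mult_left[OF \<beta> that] .
  have formY: "bilinear_form U (\<lambda>a b. t (?\<beta> a b))" if "t \<in> tensor2 U" for t
    by (rule U_form_contract[OF that form2 form1])
  have formYD: "bilinear_form U (\<lambda>a b. \<Delta> Y (\<lambda>c d. ?\<beta> a b (D c) d))"
  proof (rule U_form_contract[OF \<Delta>_tensor[OF Y]])
    show "bilinear_form U (\<lambda>c d. ?\<beta> a b (D c) d)" if "a \<in> vset U" "b \<in> vset U" for a b
      by (rule D_form[OF form2[OF that]])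
    show "bilinear_form U (\<lambda>a b. ?\<beta> a b (D c) d)" if "c \<in> vset U" "d \<in> vset U" for c d
      by (rule form1[OF D_in[OF that(1)] that(2)])
  qed
  have "\<Delta> Y (\<lambda>c d. \<beta> (D (a \<odot> c)) (b \<odot> d)) = \<Delta> Y (?\<beta> (D a) b) + \<Delta> Y (\<lambda>c d. ?\<beta> a b (D c) d)"
    if ab: "a \<in> vset U" "b \<in> vset U" for a b
  proof -
    have "\<Delta> Y (\<lambda>c d. \<beta> (D (a \<odot> c)) (b \<odot> d)) = \<Delta> Y (\<lambda>c d. ?\<beta> (D a) b c d + ?\<beta> a b (D c) d)"
      by (rule U_tensor_cong) (simp_all add: \<Delta>_tensor Y D_mult ab D_in U_mul U_formD[OF \<beta>])
    then show ?thesis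
      using tensor2_plus[OF \<Delta>_tensor[OF Y] form2[OF D_in[OF ab(1)] ab(2)] D_form[OF form2[OF ab]]] by simp
  qed
  then have "\<Delta> X (\<lambda>a b. \<Delta> Y (\<lambda>c d. \<beta> (D (a \<odot> c)) (b \<odot> d))) =
      \<Delta> X (\<lambda>a b. \<Delta> Y (?\<beta> (D a) b) + \<Delta> Y (\<lambda>c d. ?\<beta> a b (D c) d))"
    by (intro U_tensor_cong[OF \<Delta>_tensor[OF X]])
  also have "\<dots> = \<Delta> X (\<lambda>a b. \<Delta> Y (?\<beta> (D a) b)) + \<Delta> X (\<lambda>a b. \<Delta> Y (\<lambda>c d. ?\<beta> a b (D c) d))"
    by (rule tensor2_plus[OF \<Delta>_tensor[OF X] D_form[OF formY[OF \<Delta>_tensor[OF Y]]] formYD])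
  finally have D: "\<Delta> (X \<odot> Y) (\<lambda>a b. \<beta> (D a) b) =
      \<Delta> X (\<lambda>a b. \<Delta> Y (?\<beta> (D a) b)) + \<Delta> X (\<lambda>a b. \<Delta> Y (\<lambda>c d. ?\<beta> a b (D c) d))"
    using \<Delta>_mult_apply[OF X Y D_form[OF \<beta>]] by simp
  have "\<Delta> X (\<lambda>a b. \<delta>\<^sub>s Y (?\<beta> a b)) = \<Delta> X (\<lambda>a b. \<delta> Y (?\<beta> a b) - s * \<Delta> Y (\<lambda>c d. ?\<beta> a b (D c) d))"
    by (intro U_tensor_cong[OF \<Delta>_tensor[OF X]] \<delta>\<^sub>s_apply form2)
  also have "\<dots> = \<Delta> X (\<lambda>a b. \<delta> Y (?\<beta> a b)) - s * \<Delta> X (\<lambda>a b. \<Delta> Y (\<lambda>c d. ?\<beta> a b (D c) d))"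
    using tensor2_minus[OF \<Delta>_tensor[OF X] formY[OF \<delta>_tensor[OF Y]] bilinear_form_times[OF formYD]]
      tensor2_times[OF \<Delta>_tensor[OF X] formYD] by simp
  finally show ?thesis
    using D \<delta>\<^sub>s_apply[OF formY[OF \<Delta>_tensor[OF Y]], of X]
    by (simp add: \<delta>\<^sub>s_apply[OF \<beta>] \<beta> Y X \<delta>_mult tmul_def on_forms_def right_diff_distrib distrib_left)
qed

lemma D_one_form: "bilinear_form U \<beta> \<Longrightarrow> b \<in> vset U \<Longrightarrow> \<beta> (D (aone U)) b = 0"
  using U_formD(1)[of \<beta> "D (aone U)" "D (aone U)" b] D_mult[OF U_one U_one]
  by (simp add: U_one_mul U_mul_one D_in U_one)

lemma \<delta>_one: "\<delta> (aone U) = 0"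
proof
  fix \<beta>
  show "\<delta> (aone U) \<beta> = 0 \<beta>"
  proof (cases "bilinear_form U \<beta>")
    case True
    have "(\<delta> (aone U) \<beta> :: 'k) = \<delta> (aone U \<odot> aone U) \<beta>" by (simp add: U_one_mul U_one)
    also have "\<dots> = \<delta> (aone U) (\<lambda>a b. \<Delta> (aone U) (\<lambda>c d. \<beta> (a \<odot> c) (b \<odot> d)))
        + \<Delta> (aone U) (\<lambda>a b. \<delta> (aone U) (\<lambda>c d. \<beta> (a \<odot> c) (b \<odot> d)))"
      using True by (subst \<delta>_mult) (simp_all add: U_one tmul_def on_forms_def)
    also have "\<delta> (aone U) (\<lambda>a b. \<Delta> (aone U) (\<lambda>c d. \<beta> (a \<odot> c) (b \<odot> d))) = \<delta> (aone U) \<beta>"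
      by (rule U_tensor_cong) (simp_all add: \<delta>_tensor U_one \<Delta>_one pure_def on_forms_def
          U_form_mult_left True U_mul_one)
    also have "\<Delta> (aone U) (\<lambda>a b. \<delta> (aone U) (\<lambda>c d. \<beta> (a \<odot> c) (b \<odot> d))) = \<delta> (aone U) \<beta>"
    proof -
      have "bilinear_form U (\<lambda>a b. \<delta> (aone U) (\<lambda>c d. \<beta> (a \<odot> c) (b \<odot> d)))"
        by (rule U_form_contract[OF \<delta>_tensor[OF U_one] U_form_mult_left[OF True] U_form_mult_right[OF
            True]])
      moreover have "\<delta> (aone U) (\<lambda>c d. \<beta> (aone U \<odot> c) (aone U \<odot> d)) = \<delta> (aone U) \<beta>"
        by (rule U_tensor_cong) (simp_all add: \<delta>_tensor U_one U_one_mul)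
      ultimately show ?thesis by (simp add: \<Delta>_one pure_def on_forms_def)
    qed
    finally show ?thesis by simp
  qed (simp add: tensor2_not_form[OF \<delta>_tensor] U_one)
qed

lemma \<delta>\<^sub>s_one: "\<delta>\<^sub>s (aone U) = 0"
proof
  fix \<beta>
  show "\<delta>\<^sub>s (aone U) \<beta> = 0 \<beta>"
    by (cases "bilinear_form U \<beta>")
      (simp_all add: \<delta>\<^sub>s_apply \<delta>\<^sub>s_not_form U_one \<delta>_one \<Delta>_one pure_def on_forms_def D_form D_one_form)
qed

text \<open>The kernel of a derivation along an algebra homomorphism is a subalgebra.\<close>

lemma C_ker_subalgebra: "subalgebra_of U (C_ker U \<Delta> \<delta> D s)"
proof -
  have C: "C_ker U \<Delta> \<delta> D s = {X \<in> vset U. \<delta>\<^sub>s X = 0}"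
    by (simp add: C_ker_def \<delta>\<^sub>s_def)
  have "\<delta>\<^sub>s (X \<odot> Y) = 0" if "X \<in> vset U" "Y \<in> vset U" "\<delta>\<^sub>s X = 0" "\<delta>\<^sub>s Y = 0" for X Y
  proof
    fix \<beta>
    show "\<delta>\<^sub>s (X \<odot> Y) \<beta> = 0 \<beta>"
      using that by (cases "bilinear_form U \<beta>")
        (simp_all add: \<delta>\<^sub>s_mult \<delta>\<^sub>s_not_form U_mul tensor2_form_zero[OF \<Delta>_tensor])
  qed
  then show ?thesis
    unfolding subalgebra_of_def C
    by (auto simp: U_one U_add U_mul U_smul \<delta>\<^sub>s_one \<delta>\<^sub>s_add \<delta>\<^sub>s_smul tsmul_def)
qed

lemma \<Delta>_incl_mult:
  assumes "\<xi> \<in> vset L" "X \<in> vset U" "bilinear_form U \<beta>"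
  shows "\<Delta> (\<iota> \<xi> \<odot> X) \<beta> = \<Delta> X (\<lambda>c d. \<beta> (\<iota> \<xi> \<odot> c) d) + \<Delta> X (\<lambda>c d. \<beta> c (\<iota> \<xi> \<odot> d))"
    and "\<delta>\<^sub>s (\<iota> \<xi> \<odot> X) \<beta> = \<delta>\<^sub>s (\<iota> \<xi>) (\<lambda>a b. \<Delta> X (\<lambda>c d. \<beta> (a \<odot> c) (b \<odot> d)))
      + (\<delta>\<^sub>s X (\<lambda>c d. \<beta> (\<iota> \<xi> \<odot> c) d) + \<delta>\<^sub>s X (\<lambda>c d. \<beta> c (\<iota> \<xi> \<odot> d)))"
proof -
  note U = assms(2) U_one U_incl[OF assms(1)]
  have ev: "\<Delta> (\<iota> \<xi>) \<gamma> = \<gamma> (\<iota> \<xi>) (aone U) + \<gamma> (aone U) (\<iota> \<xi>)" if "bilinear_form U \<gamma>" for \<gamma>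
    using that by (simp add: \<Delta>_incl assms(1) pure_def on_forms_def)
  have form: "bilinear_form U (\<lambda>a b. t (\<lambda>c d. \<beta> (a \<odot> c) (b \<odot> d)))" if "t \<in> tensor2 U" for t
    by (rule U_form_contract[OF that U_form_mult_left[OF assms(3)] U_form_mult_right[OF assms(3)]])
  have "\<Delta> X (\<lambda>c d. \<beta> (\<iota> \<xi> \<odot> c) (aone U \<odot> d)) = \<Delta> X (\<lambda>c d. \<beta> (\<iota> \<xi> \<odot> c) d)"
    "\<Delta> X (\<lambda>c d. \<beta> (aone U \<odot> c) (\<iota> \<xi> \<odot> d)) = \<Delta> X (\<lambda>c d. \<beta> c (\<iota> \<xi> \<odot> d))"
    by (rule U_tensor_cong[OF \<Delta>_tensor[OF assms(2)]], simp add: U_one_mul)+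
  then show "\<Delta> (\<iota> \<xi> \<odot> X) \<beta> = \<Delta> X (\<lambda>c d. \<beta> (\<iota> \<xi> \<odot> c) d) + \<Delta> X (\<lambda>c d. \<beta> c (\<iota> \<xi> \<odot> d))"
    using ev[OF form[OF \<Delta>_tensor[OF assms(2)]]] by (simp add: \<Delta>_mult_apply U assms(3))
  have form': "bilinear_form U (\<lambda>a b. \<delta>\<^sub>s X (\<lambda>c d. \<beta> (a \<odot> c) (b \<odot> d)))"
  proof -
    have "bilinear_form U (\<lambda>a b. \<Delta> X (\<lambda>c d. \<beta> (a \<odot> D c) (b \<odot> d)))"
    proof (rule U_form_contract[OF \<Delta>_tensor[OF assms(2)]])
      show "bilinear_form U (\<lambda>c d. \<beta> (a \<odot> D c) (b \<odot> d))" if "a \<in> vset U" "b \<in> vset U" for a b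
        by (rule D_form[OF U_form_mult_left[OF assms(3) that]])
      show "bilinear_form U (\<lambda>a b. \<beta> (a \<odot> D c) (b \<odot> d))" if "c \<in> vset U" "d \<in> vset U" for c d
        by (rule U_form_mult_right[OF assms(3) D_in[OF that(1)] that(2)])
    qed
    from bilinear_form_minus[OF form[OF \<delta>_tensor[OF assms(2)]] bilinear_form_times[OF this]]
    show ?thesis
      by (rule iffD2[OF U_form_cong, rotated]) (rule \<delta>\<^sub>s_apply[OF U_form_mult_left[OF assms(3)]])
  qed
  have "\<delta>\<^sub>s X (\<lambda>c d. \<beta> (\<iota> \<xi> \<odot> c) (aone U \<odot> d)) = \<delta>\<^sub>s X (\<lambda>c d. \<beta> (\<iota> \<xi> \<odot> c) d)"
    "\<delta>\<^sub>s X (\<lambda>c d. \<beta> (aone U \<odot> c) (\<iota> \<xi> \<odot> d)) = \<delta>\<^sub>s X (\<lambda>c d. \<beta> c (\<iota> \<xi> \<odot> d))"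
    by (rule \<delta>\<^sub>s_cong[OF assms(2) U_form_mult_fst[OF assms(3) U(3)]], simp add: U_one_mul)
      (rule \<delta>\<^sub>s_cong[OF assms(2) U_form_mult_snd[OF assms(3) U(3)]], simp add: U_one_mul)
  then show "\<delta>\<^sub>s (\<iota> \<xi> \<odot> X) \<beta> = \<delta>\<^sub>s (\<iota> \<xi>) (\<lambda>a b. \<Delta> X (\<lambda>c d. \<beta> (a \<odot> c) (b \<odot> d)))
      + (\<delta>\<^sub>s X (\<lambda>c d. \<beta> (\<iota> \<xi> \<odot> c) d) + \<delta>\<^sub>s X (\<lambda>c d. \<beta> c (\<iota> \<xi> \<odot> d)))"
    using ev[OF form'] by (simp add: \<delta>\<^sub>s_mult U assms(3))
qed

text \<open>In Sweedler notation \<open>x\<^sub>1 S(x\<^sub>3) \<otimes> x\<^sub>2 = 1 \<otimes> x\<close>, by cocommutativity.\<close>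

lemma \<Delta>_twist: "X \<in> vset U \<Longrightarrow> \<theta> \<in> \<Phi> \<Longrightarrow> F \<in> \<Phi> \<Longrightarrow> \<Delta> X (twist \<theta> F) = \<theta> (aone U) * F X"
proof (induction X arbitrary: \<theta> F rule: U_induct)
  case one
  then show ?case by (simp add: \<Delta>_one pure_def on_forms_def twist_form twist_one)
next
  case (mul \<xi> X)
  note \<xi> = U_incl[OF mul(1)]
  have "\<Delta> X (\<lambda>c d. twist \<theta> F (\<iota> \<xi> \<odot> c) d) = \<Delta> X (twist (lmul (\<iota> \<xi>) \<theta>) F)"
    by (rule U_tensor_cong[OF \<Delta>_tensor[OF mul(2)]]) (simp add: twist_fst_mul mul.prems \<xi>)
  also have "\<dots> = \<theta> (\<iota> \<xi>) * F X"
    by (simp add: mul.IH mul.prems lmul_\<Phi> \<xi> lmul_apply U_one U_mul_one)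
  finally have fst: "\<Delta> X (\<lambda>c d. twist \<theta> F (\<iota> \<xi> \<odot> c) d) = \<theta> (\<iota> \<xi>) * F X" .
  have "\<Delta> X (\<lambda>c d. twist \<theta> F c (\<iota> \<xi> \<odot> d)) =
      \<Delta> X (\<lambda>c d. twist \<theta> (lmul (\<iota> \<xi>) F) c d - twist (rmul (\<iota> \<xi>) \<theta>) F c d)"
    by (rule U_tensor_cong[OF \<Delta>_tensor[OF mul(2)]]) (simp add: twist_snd_mul mul.prems mul(1))
  also have "\<dots> = \<Delta> X (twist \<theta> (lmul (\<iota> \<xi>) F)) - \<Delta> X (twist (rmul (\<iota> \<xi>) \<theta>) F)"
    by (rule tensor2_minus[OF \<Delta>_tensor[OF mul(2)]]) (simp_all add: twist_form mul.prems lmul_\<Phi> rmul_\<Phi> \<xi>)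
  also have "\<dots> = \<theta> (aone U) * F (\<iota> \<xi> \<odot> X) - \<theta> (\<iota> \<xi>) * F X"
    by (simp add: mul.IH mul.prems lmul_\<Phi> rmul_\<Phi> \<xi> lmul_apply rmul_apply U_one U_one_mul mul(2))
  finally show ?case
    using fst \<Delta>_incl_mult(1)[OF mul(1,2) twist_form[OF mul.prems]] by simp
next
  case (smul c X)
  then show ?case by (simp add: \<Delta>_smul tsmul_apply \<Phi>_smul)
next
  case (add X Y)
  then show ?case by (simp add: \<Delta>_add \<Phi>_add algebra_simps)
qed

text \<open>The transpose of \<open>X \<mapsto> \<Sum> \<theta> (X' S(X''\<^sub>2)) X''\<^sub>1\<close>, where \<open>\<delta>\<^sub>s X = \<Sum> X' \<otimes> X''\<close>. Geometrically,
  \<open>dress \<theta>\<close> is a dressing vector field on the formal dual group, up to a multiple of a modular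
  function.\<close>

definition dress :: "(('a, 'k) env \<Rightarrow> 'k) \<Rightarrow> (('a, 'k) env \<Rightarrow> 'k) \<Rightarrow>
    ('a, 'k) env \<Rightarrow> 'k" where
  "dress \<theta> F = (\<lambda>X. if X \<in> vset U then \<delta>\<^sub>s X (twist \<theta> F) else 0)"

lemma dress_\<Phi>: "\<theta> \<in> \<Phi> \<Longrightarrow> F \<in> \<Phi> \<Longrightarrow> dress \<theta> F \<in> \<Phi>"
  by (rule \<Phi>I) (simp_all add: dress_def U_add U_smul \<delta>\<^sub>s_add \<delta>\<^sub>s_smul tsmul_apply)

lemma dress_one: "dress \<theta> F (aone U) = 0"
  by (simp add: dress_def \<delta>\<^sub>s_one)

lemma dress_C_ker: "X \<in> C_ker U \<Delta> \<delta> D s \<Longrightarrow> dress \<theta> F X = 0"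
  by (simp add: dress_def C_ker_def \<delta>\<^sub>s_def)

lemma twist_fun_eq:
  assumes "\<theta> \<in> \<Phi>" "\<theta>' \<in> \<Phi>" "F \<in> \<Phi>" "G \<in> \<Phi>"
  shows "twist (\<theta> + \<theta>') F = (\<lambda>a b. twist \<theta> F a b + twist \<theta>' F a b)"
    "twist (tsmul c \<theta>) F = (\<lambda>a b. c * twist \<theta> F a b)"
    "twist \<theta> (F + G) = (\<lambda>a b. twist \<theta> F a b + twist \<theta> G a b)"
    "twist \<theta> (tsmul c F) = (\<lambda>a b. c * twist \<theta> F a b)"
  by (simp_all add: fun_eq_iff twist_plus_left twist_plus_right twist_tsmul_left twist_tsmul_right
      tsmul_apply assms)

lemma dress_linear:
  assumes "\<theta> \<in> \<Phi>" "\<theta>' \<in> \<Phi>" "F \<in> \<Phi>" "G \<in> \<Phi>"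
  shows "dress (\<theta> + \<theta>') F = dress \<theta> F + dress \<theta>' F" "dress (tsmul c \<theta>) F = tsmul c (dress \<theta> F)"
    "dress \<theta> (F + G) = dress \<theta> F + dress \<theta> G" "dress \<theta> (tsmul c F) = tsmul c (dress \<theta> F)"
  by (auto simp: dress_def fun_eq_iff twist_fun_eq[OF assms] \<delta>\<^sub>s_plus \<delta>\<^sub>s_times twist_form assms
      tsmul_apply)

lemma minus_tsmul: "(F :: 'b \<Rightarrow> 'k) - G = F + tsmul (-1) G"
  by (simp add: fun_eq_iff tsmul_apply)

lemma dress_minus_left:
  "\<theta> \<in> \<Phi> \<Longrightarrow> \<theta>' \<in> \<Phi> \<Longrightarrow> F \<in> \<Phi> \<Longrightarrow> dress (\<theta> - \<theta>') F = dress \<theta> F - dress \<theta>' F"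
  unfolding minus_tsmul using dress_linear[of \<theta> "tsmul (-1) \<theta>'" F F] dress_linear(2)[of \<theta>' \<theta> F F]
  by (simp add: \<Phi>_tsmul)

lemma L_form_mult: "F \<in> \<Phi> \<Longrightarrow> bilinear_form L (\<lambda>\<alpha> \<beta>. F (\<iota> \<alpha> \<odot> \<iota> \<beta>))"
  unfolding bilinear_form_def
  by (simp add: incl_add incl_smul U_incl U_distl U_distr U_smul_mul U_mul_smul \<Phi>_add \<Phi>_smul U_mul U_smul)

lemma L_form_prod:
  "F \<in> \<Phi> \<Longrightarrow> G \<in> \<Phi> \<Longrightarrow> X \<in> vset U \<Longrightarrow> bilinear_form L (\<lambda>\<alpha> \<beta>. F (\<iota> \<alpha>) * G (\<iota> \<beta> \<odot> X))"
  unfolding bilinear_form_def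
  by (simp add: incl_add incl_smul U_incl U_distl U_smul_mul \<Phi>_add \<Phi>_smul U_mul U_smul algebra_simps)

text \<open>The cobracket is antisymmetric, so multiplying its two factors in \<open>U(L)\<close> gives half of their
  bracket.\<close>

lemma d_mult:
  assumes "\<xi> \<in> vset L" "F \<in> \<Phi>"
  shows "d \<xi> (\<lambda>\<alpha> \<beta>. F (\<iota> \<alpha> \<odot> \<iota> \<beta>)) = F (\<iota> (d0 \<xi>)) / 2"
proof -
  let ?f = "\<lambda>\<alpha> \<beta>. F (\<iota> \<alpha> \<odot> \<iota> \<beta>)"
  have form: "bilinear_form L ?f" "bilinear_form L (\<lambda>\<alpha> \<beta>. ?f \<beta> \<alpha>)"
    using L_form_mult[OF assms(2)] unfolding bilinear_form_def by simp_all
  have "d \<xi> (\<lambda>\<alpha> \<beta>. ?f \<beta> \<alpha>) = tflip (d \<xi>) ?f" by (simp add: tflip_def)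
  also have "\<dots> = - d \<xi> ?f" by (simp add: d_skew assms)
  finally have "2 * d \<xi> ?f = d \<xi> (\<lambda>\<alpha> \<beta>. ?f \<alpha> \<beta> - ?f \<beta> \<alpha>)"
    using tensor2_minus[OF d_tensor[OF assms(1)] form] by simp
  also have "\<dots> = d \<xi> (\<lambda>\<alpha> \<beta>. F (\<iota> (lbr L \<alpha> \<beta>)))"
  proof (rule tensor2_cong[OF d_tensor[OF assms(1)] _ L_add L_smul])
    fix \<alpha> \<beta> assume "\<alpha> \<in> vset L" "\<beta> \<in> vset L"
    then show "?f \<alpha> \<beta> - ?f \<beta> \<alpha> = F (\<iota> (lbr L \<alpha> \<beta>))"
      by (simp add: incl_comm[of \<alpha> \<beta>] \<Phi>_add assms U_mul U_incl L_br)
  qed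
  finally show ?thesis using bracket_d[OF assms] by (simp add: field_simps)
qed

text \<open>As \<open>\<delta>\<^sub>s\<close> is a derivation, the new term is \<open>\<delta>\<^sub>s (\<iota> \<xi>) \<Delta> X\<close>, and \<open>\<Delta>_twist\<close> evaluates it. For
  \<open>d \<xi> = \<Sum> \<alpha> \<otimes> \<beta>\<close> the part with \<open>\<delta>\<close> is \<open>\<Sum> \<theta> (\<alpha>) F (\<beta> X) - \<Sum> \<theta> (\<alpha> \<beta>) F (X)\<close>, where the second sum is
  half of \<open>\<theta> (d0 \<xi>) F (X)\<close> by \<open>d_mult\<close>. The part with \<open>(D \<otimes> id) \<circ> \<Delta>\<close> subtracts \<open>s\<close> times the same.\<close>

lemma dress_mult:
  assumes "\<theta> \<in> \<Phi>" "F \<in> \<Phi>" "\<xi> \<in> vset L" "X \<in> vset U"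
  shows "dress \<theta> F (\<iota> \<xi> \<odot> X) = dress \<theta> (lmul (\<iota> \<xi>) F) X + dress (lmul (\<iota> \<xi>) \<theta> - rmul (\<iota> \<xi>) \<theta>) F X
     + d \<xi> (\<lambda>\<alpha> \<beta>. \<theta> (\<iota> \<alpha>) * F (\<iota> \<beta> \<odot> X)) - (s + 1/2) * \<theta> (\<iota> (d0 \<xi>)) * F X"
proof -
  note U = assms(3,4) U_incl[OF assms(3)] U_one
  let ?L = "lmul (\<iota> \<xi>)" let ?R = "rmul (\<iota> \<xi>)"
  let ?\<gamma> = "\<lambda>a b. \<Delta> X (\<lambda>c d. twist \<theta> F (a \<odot> c) (b \<odot> d))"
  have in\<Phi>: "lmul Z G \<in> \<Phi>" "rmul Z G \<in> \<Phi>" if "G \<in> \<Phi>" "Z \<in> vset U" for G Z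
    using that lmul_\<Phi> rmul_\<Phi> by auto
  have \<gamma>: "bilinear_form U ?\<gamma>"
    by (rule U_form_contract[OF \<Delta>_tensor[OF assms(4)] U_form_mult_left U_form_mult_right])
      (simp_all add: twist_form assms)
  have \<gamma>_L: "?\<gamma> (\<iota> \<alpha>) (\<iota> \<beta>) = \<theta> (\<iota> \<alpha>) * F (\<iota> \<beta> \<odot> X) - F X * \<theta> (\<iota> \<alpha> \<odot> \<iota> \<beta>)"
    if ab: "\<alpha> \<in> vset L" "\<beta> \<in> vset L" for \<alpha> \<beta>
  proof -
    have "?\<gamma> (\<iota> \<alpha>) (\<iota> \<beta>) = \<Delta> X (\<lambda>c d. twist (lmul (\<iota> \<alpha>) \<theta>) (lmul (\<iota> \<beta>) F) c d
        - twist (lmul (\<iota> \<alpha>) (rmul (\<iota> \<beta>) \<theta>)) F c d)"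
      by (rule U_tensor_cong[OF \<Delta>_tensor[OF assms(4)]])
        (simp add: ab U_incl twist_fst_mul twist_snd_mul in\<Phi> assms(1,2) lmul_rmul)
    also have "\<dots> = \<Delta> X (twist (lmul (\<iota> \<alpha>) \<theta>) (lmul (\<iota> \<beta>) F))
        - \<Delta> X (twist (lmul (\<iota> \<alpha>) (rmul (\<iota> \<beta>) \<theta>)) F)"
      by (rule tensor2_minus[OF \<Delta>_tensor[OF assms(4)]])
        (simp_all add: twist_form in\<Phi> assms(1,2) ab U_incl)
    also have "\<dots> = \<theta> (\<iota> \<alpha>) * F (\<iota> \<beta> \<odot> X) - F X * \<theta> (\<iota> \<alpha> \<odot> \<iota> \<beta>)"
      by (simp add: ab in\<Phi> assms U \<Delta>_twist U_incl lmul_apply rmul_apply U_mul_one U_mul)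
    finally show ?thesis .
  qed
  have \<gamma>_1: "?\<gamma> a (aone U) = \<theta> a * F X" if a: "a \<in> vset U" for a
  proof -
    have "?\<gamma> a (aone U) = \<Delta> X (twist (lmul a \<theta>) F)"
      by (rule U_tensor_cong[OF \<Delta>_tensor[OF assms(4)]]) (simp add: U a twist_fst_mul assms(1,2) U_one_mul)
    then show ?thesis by (simp add: \<Delta>_twist U in\<Phi> a assms(1,2) lmul_apply U_mul_one)
  qed
  have "\<delta>\<^sub>s (\<iota> \<xi>) ?\<gamma> = \<delta> (\<iota> \<xi>) ?\<gamma> - s * (?\<gamma> (D (\<iota> \<xi>)) (aone U) + ?\<gamma> (D (aone U)) (\<iota> \<xi>))"
    using \<gamma> D_form[OF \<gamma>] by (simp add: \<delta>\<^sub>s_apply \<Delta>_incl assms(3) pure_def on_forms_def)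
  also have "\<delta> (\<iota> \<xi>) ?\<gamma> = d \<xi> (\<lambda>\<alpha> \<beta>. ?\<gamma> (\<iota> \<alpha>) (\<iota> \<beta>))"
    using \<gamma> by (simp add: \<delta>_incl assms(3) tmap_def on_forms_def)
  also have "\<dots> = d \<xi> (\<lambda>\<alpha> \<beta>. \<theta> (\<iota> \<alpha>) * F (\<iota> \<beta> \<odot> X) - F X * \<theta> (\<iota> \<alpha> \<odot> \<iota> \<beta>))"
    by (rule tensor2_cong[OF d_tensor[OF assms(3)] \<gamma>_L L_add L_smul])
  also have "\<dots> = d \<xi> (\<lambda>\<alpha> \<beta>. \<theta> (\<iota> \<alpha>) * F (\<iota> \<beta> \<odot> X)) - F X * (\<theta> (\<iota> (d0 \<xi>)) / 2)"
    using tensor2_minus[OF d_tensor[OF assms(3)] L_form_prod[OF assms(1,2,4)]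
        bilinear_form_times[OF L_form_mult[OF assms(1)]]]
      tensor2_times[OF d_tensor[OF assms(3)] L_form_mult[OF assms(1)]]
    by (simp add: d_mult assms)
  finally have first: "\<delta>\<^sub>s (\<iota> \<xi>) ?\<gamma> = d \<xi> (\<lambda>\<alpha> \<beta>. \<theta> (\<iota> \<alpha>) * F (\<iota> \<beta> \<odot> X)) - (s + 1/2) * \<theta> (\<iota> (d0 \<xi>)) * F X"
    by (simp add: D_one_form[OF \<gamma>] U \<gamma>_1 D_in D_incl d0_L U_incl algebra_simps)
  have "\<delta>\<^sub>s X (\<lambda>c d. twist \<theta> F (\<iota> \<xi> \<odot> c) d) = \<delta>\<^sub>s X (twist (?L \<theta>) F)"
    by (rule \<delta>\<^sub>s_cong[OF assms(4)]) (simp_all add: U twist_fst_mul assms(1,2) twist_form in\<Phi>)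
  moreover have "\<delta>\<^sub>s X (\<lambda>c d. twist \<theta> F c (\<iota> \<xi> \<odot> d)) = \<delta>\<^sub>s X (twist \<theta> (?L F)) - \<delta>\<^sub>s X (twist (?R \<theta>) F)"
  proof -
    have F1: "bilinear_form U (twist \<theta> (?L F))" and F2: "bilinear_form U (twist (?R \<theta>) F)"
      by (simp_all add: twist_form assms(1,2) in\<Phi> U)
    have "\<delta>\<^sub>s X (\<lambda>c d. twist \<theta> F c (\<iota> \<xi> \<odot> d)) =
        \<delta>\<^sub>s X (\<lambda>c d. twist \<theta> (?L F) c d + (-1) * twist (?R \<theta>) F c d)"
      by (rule \<delta>\<^sub>s_cong[OF assms(4) bilinear_form_plus[OF F1 bilinear_form_times[OF F2]]])
        (simp add: twist_snd_mul assms(1,2,3))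
    also have "\<dots> = \<delta>\<^sub>s X (twist \<theta> (?L F)) + (-1) * \<delta>\<^sub>s X (twist (?R \<theta>) F)"
      by (simp only: \<delta>\<^sub>s_plus[OF assms(4) F1 bilinear_form_times[OF F2]] \<delta>\<^sub>s_times[OF assms(4) F2])
    finally show ?thesis by simp
  qed
  ultimately have "dress \<theta> F (\<iota> \<xi> \<odot> X) = \<delta>\<^sub>s (\<iota> \<xi>) ?\<gamma>
      + (\<delta>\<^sub>s X (twist (?L \<theta>) F) + (\<delta>\<^sub>s X (twist \<theta> (?L F)) - \<delta>\<^sub>s X (twist (?R \<theta>) F)))"
    using \<Delta>_incl_mult(2)[OF assms(3,4) twist_form[OF assms(1,2)]] by (simp add: dress_def U U_mul)
  then show ?thesis
    unfolding first dress_minus_left[OF in\<Phi>(1)[OF assms(1) U(3)] in\<Phi>(2)[OF assms(1) U(3)] assms(2)]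
    by (simp add: dress_def U)
qed

text \<open>The recursion replaces \<open>\<theta>\<close> by \<open>\<theta> \<circ> ad \<xi>\<close>, and \<open>ad \<xi>\<close> maps \<open>L\<close> to itself. Hence only the
  restriction of \<open>\<theta>\<close> to \<open>L\<close> matters: the first leg of \<open>W(X)\<close> lies in \<open>L\<close>.\<close>

lemma dress_vanish:
  assumes "X \<in> vset U" "\<theta> \<in> \<Phi>" "F \<in> \<Phi>" "\<And>\<xi>. \<xi> \<in> vset L \<Longrightarrow> \<theta> (\<iota> \<xi>) = 0"
  shows "dress \<theta> F X = 0"
  using assms
proof (induction X arbitrary: \<theta> F rule: U_induct)
  case (mul \<xi> X)
  have "lmul (\<iota> \<xi>) \<theta> (\<iota> \<eta>) = rmul (\<iota> \<xi>) \<theta> (\<iota> \<eta>)" if "\<eta> \<in> vset L" for \<eta>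
    using that mul by (simp add: lmul_apply rmul_apply U_incl incl_comm[of \<xi> \<eta>] \<Phi>_add U_mul L_br)
  then have "dress (lmul (\<iota> \<xi>) \<theta> - rmul (\<iota> \<xi>) \<theta>) F X = 0"
    using mul by (intro mul.IH \<Phi>_minus lmul_\<Phi> rmul_\<Phi> U_incl) simp_all
  moreover have "d \<xi> (\<lambda>\<alpha> \<beta>. \<theta> (\<iota> \<alpha>) * F (\<iota> \<beta> \<odot> X)) = d \<xi> (\<lambda>\<alpha> \<beta>. 0)"
    by (rule tensor2_cong[OF d_tensor[OF mul(1)] _ L_add L_smul]) (simp_all add: mul.prems)
  ultimately show ?case
    using mul by (simp add: dress_mult lmul_\<Phi> U_incl tensor2_form_zero[OF d_tensor] d0_L)
qed (simp_all add: dress_one \<Phi>_add[OF dress_\<Phi>] \<Phi>_smul[OF dress_\<Phi>])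

lemma dress_cong:
  assumes "\<theta> \<in> \<Phi>" "\<theta>' \<in> \<Phi>" "F \<in> \<Phi>" "\<And>\<xi>. \<xi> \<in> vset L \<Longrightarrow> \<theta> (\<iota> \<xi>) = \<theta>' (\<iota> \<xi>)"
  shows "dress \<theta> F = dress \<theta>' F"
proof
  fix X
  show "dress \<theta> F X = dress \<theta>' F X"
  proof (cases "X \<in> vset U")
    case True
    then have "dress (\<theta> - \<theta>') F X = 0" by (rule dress_vanish) (simp_all add: assms \<Phi>_minus)
    then show ?thesis by (simp add: dress_minus_left assms)
  qed (simp add: dress_def)
qed

end

section \<open>The dual of a quasitriangular Lie bialgebra\<close>

lemma tensor2_sum_list:
  assumes "t \<in> tensor2 V" "\<And>p. p \<in> set ps \<Longrightarrow> bilinear_form V (f p)"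
  shows "t (\<lambda>a b. \<Sum>p\<leftarrow>ps. f p a b) = (\<Sum>p\<leftarrow>ps. t (f p))"
    and "bilinear_form V (\<lambda>a b. \<Sum>p\<leftarrow>ps. f p a b)"
  using assms(2)
proof (induction ps)
  case (Cons p ps)
  {
    case 1
    then show ?case using Cons tensor2_plus[OF assms(1), of "f p" "\<lambda>a b. \<Sum>p\<leftarrow>ps. f p a b"] by simp
  next
    case 2
    then show ?case using Cons bilinear_form_plus[of V "f p" "\<lambda>a b. \<Sum>p\<leftarrow>ps. f p a b"] by simp
  }
qed (simp_all add: tensor2_form_zero[OF assms(1)] bilinear_form_zero)

locale qtlba = finite_dimensional_vector_space sc Basis
  for sc :: "'k::field_char_0 \<Rightarrow> 'g::ab_group_add \<Rightarrow> 'g" and Basis +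
  fixes br :: "'g \<Rightarrow> 'g \<Rightarrow> 'g" and r' :: "('g \<Rightarrow> 'g \<Rightarrow> 'k) \<Rightarrow> 'k"
  assumes QTLBA: "QTLBA sc br r'"
begin

abbreviation "L \<equiv> dual_lie sc br r'"
abbreviation "L\<^sub>0 \<equiv> vset L"
abbreviation "dcob \<equiv> dual_cobracket sc br r'"
abbreviation "DL \<equiv> dual_D sc br r'"

lemma br_add: "br (x + y) z = br x z + br y z" "br z (x + y) = br z x + br z y"
  and br_scale: "br (sc c x) y = sc c (br x y)" "br x (sc c y) = sc c (br x y)"
  and br_self: "br x x = 0"
  and jacobi: "br x (br y z) + br y (br z x) + br z (br x y) = 0"
  using QTLBA by (auto simp: QTLBA_def lie_algebra_def)

lemma br_zero: "br 0 x = 0" "br x 0 = 0"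
  using br_add(1)[of 0 0 x] br_add(2)[of x 0 0] by simp_all

lemma br_minus: "br (- x) y = - br x y" "br x (- y) = - br x y"
  using br_add(1)[of x "- x" y] br_add(2)[of x y "- y"]
      by (simp_all add: br_zero eq_neg_iff_add_eq_0 add.commute)

lemma br_diff: "br (x - y) z = br x z - br y z" "br z (x - y) = br z x - br z y"
  using br_add(1)[of x "- y" z] br_add(2)[of z x "- y"] by (simp_all add: br_minus)

lemma br_anti: "br x y = - br y x"
proof -
  have "br (x + y) (x + y) = br x y + br y x"
    by (simp only: br_add) (simp add: br_self add.commute)
  from trans[OF this[symmetric] br_self] show ?thesis
    by (simp only: eq_neg_iff_add_eq_0)
qed

lemma br_jacobi_left: "br (br x y) z = br x (br y z) - br y (br x z)"
  using jacobi[of x y z] br_anti[of z "br x y"] br_anti[of z x] by (simp add: br_minus algebra_simps)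

lemma L\<^sub>0_iff: "\<xi> \<in> L\<^sub>0 \<longleftrightarrow> Vector_Spaces.linear sc (*) \<xi>"
  by (simp add: dual_lie_def)

lemma L\<^sub>0I:
  assumes "\<And>x y. \<xi> (x + y) = \<xi> x + \<xi> y" "\<And>c x. \<xi> (sc c x) = c * \<xi> x"
  shows "\<xi> \<in> L\<^sub>0"
  unfolding L\<^sub>0_iff by unfold_locales (simp_all add: assms algebra_simps)

lemma lin:
  assumes "\<xi> \<in> L\<^sub>0"
  shows "\<xi> (x + y) = \<xi> x + \<xi> y" "\<xi> (sc c x) = c * \<xi> x" "\<xi> 0 = 0" "\<xi> (- x) = - \<xi> x" "\<xi> (x - y) = \<xi> x - \<xi> y"
proof -
  interpret Vector_Spaces.linear sc "(*)" \<xi> using assms by (simp add: L\<^sub>0_iff)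
  show "\<xi> (x + y) = \<xi> x + \<xi> y" "\<xi> (sc c x) = c * \<xi> x" "\<xi> 0 = 0" "\<xi> (- x) = - \<xi> x" "\<xi> (x - y) = \<xi> x - \<xi> y"
    by (simp_all add: add scale zero neg diff)
qed

lemma lin_sum_list: "\<xi> \<in> L\<^sub>0 \<Longrightarrow> \<xi> (\<Sum>p\<leftarrow>ps. f p) = (\<Sum>p\<leftarrow>ps. \<xi> (f p))"
  by (induction ps) (simp_all add: lin)

lemma separate: "(\<And>\<xi>. \<xi> \<in> L\<^sub>0 \<Longrightarrow> \<xi> x = \<xi> y) \<Longrightarrow> x = y"
  using functional_separates[of "x - y"] lin(5) unfolding L\<^sub>0_iff by fastforce

lemma L_ops: "vadd L = (+)" "vsmul L = tsmul"
  by (simp_all add: dual_lie_def tsmul_def fun_eq_iff)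

lemma L\<^sub>0_add: "\<xi> \<in> L\<^sub>0 \<Longrightarrow> \<eta> \<in> L\<^sub>0 \<Longrightarrow> \<xi> + \<eta> \<in> L\<^sub>0"
  and L\<^sub>0_tsmul: "\<xi> \<in> L\<^sub>0 \<Longrightarrow> tsmul c \<xi> \<in> L\<^sub>0"
  and L\<^sub>0_zero: "0 \<in> L\<^sub>0"
  by (rule L\<^sub>0I; simp add: lin tsmul_apply algebra_simps)+

lemma L\<^sub>0_minus: "\<xi> \<in> L\<^sub>0 \<Longrightarrow> \<eta> \<in> L\<^sub>0 \<Longrightarrow> \<xi> - \<eta> \<in> L\<^sub>0"
  by (rule L\<^sub>0I) (simp_all add: lin algebra_simps)

text \<open>The coadjoint action of \<open>\<gg>\<close> on \<open>\<gg>\<^sup>*\<close>.\<close>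

definition act :: "'g \<Rightarrow> ('g \<Rightarrow> 'k) \<Rightarrow> 'g \<Rightarrow> 'k" where
  "act x \<xi> = (\<lambda>y. \<xi> (br y x))"

lemma act_L\<^sub>0: "\<xi> \<in> L\<^sub>0 \<Longrightarrow> act x \<xi> \<in> L\<^sub>0"
  by (rule L\<^sub>0I) (simp_all add: act_def br_add br_scale lin)

lemma act_linear: "act x (\<xi> + \<eta>) = act x \<xi> + act x \<eta>" "act x (\<xi> - \<eta>) = act x \<xi> - act x \<eta>"
    "act x (- \<xi>) = - act x \<xi>"
  by (simp_all add: act_def fun_eq_iff)

lemma act_fst: "\<xi> \<in> L\<^sub>0 \<Longrightarrow> act (x + y) \<xi> = act x \<xi> + act y \<xi>" "\<xi> \<in> L\<^sub>0 \<Longrightarrow> act (x - y) \<xi> = act x \<xi> - act y \<xi>"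
   "\<xi> \<in> L\<^sub>0 \<Longrightarrow> act (- x) \<xi> = - act x \<xi>"
  by (simp_all add: act_def fun_eq_iff br_add br_diff br_minus lin)

lemma act_br: "\<xi> \<in> L\<^sub>0 \<Longrightarrow> act (br x y) \<xi> = act x (act y \<xi>) - act y (act x \<xi>)"
proof
  fix z assume \<xi>: "\<xi> \<in> L\<^sub>0"
  have "br z (br x y) = br (br z x) y - br (br z y) x"
    using br_jacobi_left[of x y z] br_anti[of "br x y" z] br_anti[of x "br y z"] br_anti[of y "br x z"]
      br_anti[of y z] br_anti[of x z] by (simp add: br_minus algebra_simps)
  then show "act (br x y) \<xi> z = (act x (act y \<xi>) - act y (act x \<xi>)) z"
    using \<xi> by (simp add: act_def lin)
qed

abbreviation "T \<equiv> type_space sc"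

lemma r'_tensor: "r' \<in> tensor2 T"
  using QTLBA by (simp add: QTLBA_def)

definition terms :: "('g \<times> 'g) list" where
  "terms = (SOME xs. r' = on_forms T (\<lambda>\<beta>. \<Sum>(a, b)\<leftarrow>xs. \<beta> a b))"

definition S :: "('g \<Rightarrow> 'g \<Rightarrow> 'k) \<Rightarrow> 'k" where
  "S \<beta> = (\<Sum>(a, b)\<leftarrow>terms. \<beta> a b)"

lemma r'_S: "bilinear_form T \<beta> \<Longrightarrow> r' \<beta> = S \<beta>"
proof -
  assume \<beta>: "bilinear_form T \<beta>"
  have "\<exists>xs. r' = on_forms T (\<lambda>\<beta>. \<Sum>(a, b)\<leftarrow>xs. \<beta> a b)"
    using tensor2_rep[OF r'_tensor] by blast
  from someI_ex[OF this] have "r' = on_forms T S"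
    by (simp add: terms_def S_def[abs_def])
  then have "r' \<beta> = on_forms T S \<beta>" by (rule fun_cong)
  then show ?thesis using \<beta> by (simp add: on_forms_def)
qed

lemma S_plus: "S (\<lambda>a b. \<beta> a b + \<gamma> a b) = S \<beta> + S \<gamma>"
  and S_times: "S (\<lambda>a b. c * \<beta> a b) = c * S \<beta>"
  by (simp_all add: S_def case_prod_unfold sum_list_addf sum_list_const_mult)

text \<open>The contractions of \<open>r'\<close> in its first and in its second leg.\<close>

definition ra :: "('g \<Rightarrow> 'k) \<Rightarrow> 'g" where
  "ra \<xi> = (\<Sum>(a, b)\<leftarrow>terms. sc (\<xi> a) b)"

definition rb :: "('g \<Rightarrow> 'k) \<Rightarrow> 'g" where
  "rb \<xi> = (\<Sum>(a, b)\<leftarrow>terms. sc (\<xi> b) a)"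

definition u :: 'g where
  "u = (\<Sum>(a, b)\<leftarrow>terms. br a b)"

lemma S_ra: "\<psi> \<in> L\<^sub>0 \<Longrightarrow> S (\<lambda>a b. \<phi> a * \<psi> b) = \<psi> (ra \<phi>)"
  and S_rb: "\<phi> \<in> L\<^sub>0 \<Longrightarrow> S (\<lambda>a b. \<phi> a * \<psi> b) = \<phi> (rb \<psi>)"
  and S_u: "\<phi> \<in> L\<^sub>0 \<Longrightarrow> S (\<lambda>a b. \<phi> (br a b)) = \<phi> u"
  by (simp_all add: S_def ra_def rb_def u_def lin_sum_list case_prod_unfold lin mult.commute)

lemma ra_linear: "ra (\<xi> + \<eta>) = ra \<xi> + ra \<eta>" "ra (- \<xi>) = - ra \<xi>" "ra (\<xi> - \<eta>) = ra \<xi> - ra \<eta>"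
  and rb_linear: "rb (\<xi> + \<eta>) = rb \<xi> + rb \<eta>" "rb (- \<xi>) = - rb \<xi>" "rb (\<xi> - \<eta>) = rb \<xi> - rb \<eta>"
  by (simp_all add: ra_def rb_def case_prod_unfold scale_left_distrib scale_left_diff_distrib
      sum_list_addf sum_list_subtractf uminus_sum_list_map o_def)

lemma ra_rb: "\<xi> \<in> L\<^sub>0 \<Longrightarrow> \<eta> \<in> L\<^sub>0 \<Longrightarrow> \<xi> (rb \<eta>) = \<eta> (ra \<xi>)"
  using S_ra[of \<eta> \<xi>] S_rb[of \<xi> \<eta>] by simp

lemma T_form_iff: "bilinear_form T \<beta> \<longleftrightarrow>
    (\<forall>x y z. \<beta> (x + y) z = \<beta> x z + \<beta> y z \<and> \<beta> z (x + y) = \<beta> z x + \<beta> z y) \<and>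
    (\<forall>c x z. \<beta> (sc c x) z = c * \<beta> x z \<and> \<beta> z (sc c x) = c * \<beta> z x)"
  by (auto simp: bilinear_form_def type_space_def)

lemma CYBE_S:
  assumes tri: "\<And>x y. (\<lambda>z. \<tau> x y z) \<in> L\<^sub>0" "\<And>x z. (\<lambda>y. \<tau> x y z) \<in> L\<^sub>0" "\<And>y z. (\<lambda>x. \<tau> x y z) \<in> L\<^sub>0"
  shows "S (\<lambda>a b. S (\<lambda>c d. \<tau> (br a c) b d)) + S (\<lambda>a b. S (\<lambda>c d. \<tau> a (br b c) d))
     + S (\<lambda>a b. S (\<lambda>c d. \<tau> a c (br b d))) = 0"
proof -
  note \<tau> = lin[OF tri(1)] lin[OF tri(2)] lin[OF tri(3)]
  have forms: "bilinear_form T (\<lambda>c d. \<tau> (br a c) b d)" "bilinear_form T (\<lambda>c d. \<tau> a (br b c) d)"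
      "bilinear_form T (\<lambda>c d. \<tau> a c (br b d))" for a b
    by (simp_all add: T_form_iff \<tau> br_add br_scale)
  have sums: "bilinear_form T (\<lambda>a b. S (\<lambda>c d. \<tau> (br a c) b d))"
      "bilinear_form T (\<lambda>a b. S (\<lambda>c d. \<tau> a (br b c) d))"
      "bilinear_form T (\<lambda>a b. S (\<lambda>c d. \<tau> a c (br b d)))"
    by (simp_all add: T_form_iff \<tau> br_add br_scale S_def case_prod_unfold sum_list_addf sum_list_const_mult)
  have "trilinear_form T \<tau>"
    by (simp add: trilinear_form_def T_form_iff \<tau>)
  then have "r' (\<lambda>a b. r' (\<lambda>c d. \<tau> (br a c) b d)) + r' (\<lambda>a b. r' (\<lambda>c d. \<tau> a (br b c) d))
     + r' (\<lambda>a b. r' (\<lambda>c d. \<tau> a c (br b d))) = 0"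
    using QTLBA by (simp add: QTLBA_def CYBE_def)
  then show ?thesis by (simp only: r'_S[OF forms(1)] r'_S[OF forms(2)] r'_S[OF forms(3)] r'_S[OF sums(1)]
      r'_S[OF sums(2)] r'_S[OF sums(3)])
qed

lemma L\<^sub>0_br: "\<xi> \<in> L\<^sub>0 \<Longrightarrow> (\<lambda>y. \<xi> (br x y)) \<in> L\<^sub>0" "\<xi> \<in> L\<^sub>0 \<Longrightarrow> (\<lambda>y. \<xi> (br y x)) \<in> L\<^sub>0"
  by (rule L\<^sub>0I; simp add: br_add br_scale lin)+

lemma L\<^sub>0_times: "\<xi> \<in> L\<^sub>0 \<Longrightarrow> (\<lambda>y. c * \<xi> y) \<in> L\<^sub>0" "\<xi> \<in> L\<^sub>0 \<Longrightarrow> (\<lambda>y. \<xi> y * c) \<in> L\<^sub>0"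
  by (rule L\<^sub>0I; simp add: lin algebra_simps)+

text \<open>Given the formula of \<open>t_invariant_form\<close> for the bracket of \<open>\<gg>\<^sup>*\<close>, this says that \<open>ra\<close> is a
  homomorphism of Lie algebras and \<open>rb\<close> an antihomomorphism (\<open>ra_hom\<close>, \<open>rb_hom\<close>).\<close>

lemma CYBE_contracted:
  assumes "\<xi> \<in> L\<^sub>0" "\<eta> \<in> L\<^sub>0" "\<zeta> \<in> L\<^sub>0"
  shows "\<xi> (br (rb \<eta>) (rb \<zeta>)) + \<eta> (br (ra \<xi>) (rb \<zeta>)) + \<zeta> (br (ra \<xi>) (ra \<eta>)) = 0"
proof -
  have "S (\<lambda>a b. S (\<lambda>c d. \<xi> (br a c) * \<eta> b * \<zeta> d)) = S (\<lambda>a b. \<xi> (br a (rb \<zeta>)) * \<eta> b)"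
    by (subst S_rb) (simp_all add: L\<^sub>0_br L\<^sub>0_times assms)
  also have "\<dots> = \<xi> (br (rb \<eta>) (rb \<zeta>))"
    by (rule S_rb) (simp add: L\<^sub>0_br assms)
  finally have 1: "S (\<lambda>a b. S (\<lambda>c d. \<xi> (br a c) * \<eta> b * \<zeta> d)) = \<xi> (br (rb \<eta>) (rb \<zeta>))" .
  have "S (\<lambda>a b. S (\<lambda>c d. \<xi> a * \<eta> (br b c) * \<zeta> d)) = S (\<lambda>a b. \<xi> a * \<eta> (br b (rb \<zeta>)))"
    by (subst S_rb) (simp_all add: L\<^sub>0_br L\<^sub>0_times assms)
  also have "\<dots> = \<eta> (br (ra \<xi>) (rb \<zeta>))"
    by (rule S_ra) (simp add: L\<^sub>0_br assms)
  finally have 2: "S (\<lambda>a b. S (\<lambda>c d. \<xi> a * \<eta> (br b c) * \<zeta> d)) = \<eta> (br (ra \<xi>) (rb \<zeta>))" .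
  have "S (\<lambda>a b. S (\<lambda>c d. \<xi> a * \<eta> c * \<zeta> (br b d))) = S (\<lambda>a b. S (\<lambda>c d. \<eta> c * (\<xi> a * \<zeta> (br b d))))"
    by (simp add: mult_ac)
  also have "\<dots> = S (\<lambda>a b. \<xi> a * \<zeta> (br b (ra \<eta>)))"
    by (subst S_ra) (simp_all add: L\<^sub>0_br L\<^sub>0_times assms)
  also have "\<dots> = \<zeta> (br (ra \<xi>) (ra \<eta>))"
    by (rule S_ra) (simp add: L\<^sub>0_br assms)
  finally have 3: "S (\<lambda>a b. S (\<lambda>c d. \<xi> a * \<eta> c * \<zeta> (br b d))) = \<zeta> (br (ra \<xi>) (ra \<eta>))" .
  show ?thesis
    using CYBE_S[of "\<lambda>x y z. \<xi> x * \<eta> y * \<zeta> z"] by (simp add: 1 2 3 L\<^sub>0_times assms)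
qed

text \<open>Multiplying two neighbouring legs of the classical Yang-Baxter equation gives
  \<open>[u, a] \<otimes> b + [a, c] \<otimes> [b, d] = 0\<close> and \<open>[a, c] \<otimes> [b, d] - a \<otimes> [u, b] = 0\<close>; the difference says
  that \<open>u\<close> leaves \<open>r'\<close> invariant.\<close>

lemma u_invariant:
  assumes "\<xi> \<in> L\<^sub>0" "\<zeta> \<in> L\<^sub>0"
  shows "\<xi> (br u (rb \<zeta>)) + \<zeta> (br u (ra \<xi>)) = 0"
proof -
  let ?T = "S (\<lambda>a b. S (\<lambda>c d. \<xi> (br a c) * \<zeta> (br b d)))"
  have "\<xi> (br (br a c) b) + \<xi> (br a (br b c)) = \<xi> (br (br a b) c)" for a b c
    using br_anti[of "br a c" b] br_jacobi_left[of a b c] lin[OF assms(1)] by simp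
  then have "S (\<lambda>a b. S (\<lambda>c d. \<xi> (br (br a c) b) * \<zeta> d)) + S (\<lambda>a b. S (\<lambda>c d. \<xi> (br a (br b c)) * \<zeta> d))
      = S (\<lambda>a b. S (\<lambda>c d. \<xi> (br (br a b) c) * \<zeta> d))"
    by (simp add: S_plus[symmetric] distrib_right[symmetric])
  also have "\<dots> = S (\<lambda>a b. \<xi> (br (br a b) (rb \<zeta>)))"
    by (subst S_rb) (simp_all add: L\<^sub>0_br assms)
  also have "\<dots> = \<xi> (br u (rb \<zeta>))"
    using S_u[OF L\<^sub>0_br(2)[OF assms(1)]] by simp
  finally have "\<xi> (br u (rb \<zeta>)) + ?T = 0"
    using CYBE_S[of "\<lambda>x y z. \<xi> (br x y) * \<zeta> z"] by (simp add: L\<^sub>0_times L\<^sub>0_br assms)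
  moreover have "?T + \<zeta> (br (ra \<xi>) u) = 0"
  proof -
    have "\<zeta> (br (br b c) d) + \<zeta> (br c (br b d)) = \<zeta> (br b (br c d))" for b c d
      using br_jacobi_left[of b c d] lin[OF assms(2)] by simp
    then have "S (\<lambda>a b. S (\<lambda>c d. \<xi> a * \<zeta> (br (br b c) d))) + S (\<lambda>a b. S (\<lambda>c d. \<xi> a * \<zeta> (br c (br b d))))
        = S (\<lambda>a b. S (\<lambda>c d. \<xi> a * \<zeta> (br b (br c d))))"
      by (simp add: S_plus[symmetric] distrib_left[symmetric])
    also have "\<dots> = S (\<lambda>a b. \<xi> a * \<zeta> (br b u))"
      using S_u[OF L\<^sub>0_br(1)[OF assms(2)]] by (simp add: S_times)
    also have "\<dots> = \<zeta> (br (ra \<xi>) u)"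
      by (rule S_ra) (simp add: L\<^sub>0_br assms)
    finally show ?thesis
      using CYBE_S[of "\<lambda>x y z. \<xi> x * \<zeta> (br y z)"] by (simp add: L\<^sub>0_times L\<^sub>0_br assms add.assoc)
  qed
  moreover have "\<zeta> (br (ra \<xi>) u) = - \<zeta> (br u (ra \<xi>))"
    by (subst br_anti) (simp add: lin assms)
  ultimately show ?thesis by (simp add: algebra_simps)
qed

text \<open>Since \<open>t\<close> is invariant, \<open>r'\<close> may replace its antisymmetric part in the cobracket of \<open>\<gg>\<close>.\<close>

lemma t_invariant_form:
  assumes "\<xi> \<in> L\<^sub>0" "\<eta> \<in> L\<^sub>0"
  shows "\<xi> (br x (rb \<eta>)) + \<eta> (br x (ra \<xi>)) + (\<xi> (br x (ra \<eta>)) + \<eta> (br x (rb \<xi>))) = 0"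
    and "lbr L \<xi> \<eta> x = \<xi> (br x (rb \<eta>)) + \<eta> (br x (ra \<xi>))"
proof -
  let ?\<beta> = "\<lambda>a b. \<xi> (br x a) * \<eta> b + \<xi> a * \<eta> (br x b)"
  have forms: "bilinear_form T (\<lambda>a b. \<xi> a * \<eta> b)" "bilinear_form T ?\<beta>" "bilinear_form T (\<lambda>a b. ?\<beta> b a)"
    by (simp_all add: T_form_iff lin assms br_add br_scale algebra_simps)
  have 1: "r' ?\<beta> = \<xi> (br x (rb \<eta>)) + \<eta> (br x (ra \<xi>))"
    by (simp add: r'_S forms S_plus S_rb[OF L\<^sub>0_br(1)] S_ra[OF L\<^sub>0_br(1)] assms)
  have "S (\<lambda>a b. ?\<beta> b a) = S (\<lambda>a b. \<eta> a * \<xi> (br x b)) + S (\<lambda>a b. \<eta> (br x a) * \<xi> b)"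
    by (simp add: S_plus[symmetric] mult.commute)
  then have 2: "r' (\<lambda>a b. ?\<beta> b a) = \<xi> (br x (ra \<eta>)) + \<eta> (br x (rb \<xi>))"
    by (simp add: r'_S forms S_rb[OF L\<^sub>0_br(1)] S_ra[OF L\<^sub>0_br(1)] assms)
  have "ad2 sc br x (r' + tflip r') = 0"
    using QTLBA by (simp add: QTLBA_def Let_def)
  then have "ad2 sc br x (r' + tflip r') (\<lambda>a b. \<xi> a * \<eta> b) = 0" by simp
  then show *: "\<xi> (br x (rb \<eta>)) + \<eta> (br x (ra \<xi>)) + (\<xi> (br x (ra \<eta>)) + \<eta> (br x (rb \<xi>))) = 0"
    using forms(1) by (simp add: ad2_def on_forms_def tflip_def 1 2)
  have "lbr L \<xi> \<eta> x = (r' ?\<beta> - r' (\<lambda>a b. ?\<beta> b a)) / 2"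
    using forms(1) by (simp add: dual_lie_def cobracket_def ad2_def on_forms_def tflip_def tsmul_def)
  then show "lbr L \<xi> \<eta> x = \<xi> (br x (rb \<eta>)) + \<eta> (br x (ra \<xi>))"
  proof -
    have "r' (\<lambda>a b. ?\<beta> b a) = - r' ?\<beta>"
      using * unfolding 1 2 by (simp only: eq_neg_iff_add_eq_0 add_ac)
    with \<open>lbr L \<xi> \<eta> x = _\<close> have "lbr L \<xi> \<eta> x = r' ?\<beta>" by simp
    with 1 show ?thesis by simp
  qed
qed

lemma lbr_act: "\<xi> \<in> L\<^sub>0 \<Longrightarrow> \<eta> \<in> L\<^sub>0 \<Longrightarrow> lbr L \<xi> \<eta> = act (rb \<eta>) \<xi> + act (ra \<xi>) \<eta>"
  by (simp add: fun_eq_iff t_invariant_form(2) act_def)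

lemma lbr_anti: "\<xi> \<in> L\<^sub>0 \<Longrightarrow> \<eta> \<in> L\<^sub>0 \<Longrightarrow> lbr L \<xi> \<eta> = - lbr L \<eta> \<xi>"
proof
  fix x assume L: "\<xi> \<in> L\<^sub>0" "\<eta> \<in> L\<^sub>0"
  have "lbr L \<xi> \<eta> x + lbr L \<eta> \<xi> x = 0"
    using t_invariant_form(1)[OF L, of x] L by (simp only: t_invariant_form(2) add_ac)
  then show "lbr L \<xi> \<eta> x = (- lbr L \<eta> \<xi>) x"
    by (simp only: eq_neg_iff_add_eq_0 fun_Compl_def)
qed

lemma lbr_self:
  assumes "\<xi> \<in> L\<^sub>0" shows "lbr L \<xi> \<xi> = 0"
proof
  fix x
  have "lbr L \<xi> \<xi> x = - lbr L \<xi> \<xi> x" using lbr_anti[OF assms assms] by (simp add: fun_eq_iff)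
  then show "lbr L \<xi> \<xi> x = 0 x" by (simp add: eq_neg_iff_add_eq_0 flip: mult_2)
qed

lemma L\<^sub>0_lbr: "\<xi> \<in> L\<^sub>0 \<Longrightarrow> \<eta> \<in> L\<^sub>0 \<Longrightarrow> lbr L \<xi> \<eta> \<in> L\<^sub>0"
  by (simp add: lbr_act act_L\<^sub>0 L\<^sub>0_add)

lemma t_equivariant: "\<xi> \<in> L\<^sub>0 \<Longrightarrow> ra (act y \<xi>) + rb (act y \<xi>) = br y (ra \<xi>) + br y (rb \<xi>)"
proof (rule separate)
  fix \<eta> assume L: "\<xi> \<in> L\<^sub>0" "\<eta> \<in> L\<^sub>0"
  have "\<eta> (ra (act y \<xi>)) = \<xi> (br (rb \<eta>) y)" "\<eta> (rb (act y \<xi>)) = \<xi> (br (ra \<eta>) y)"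
    using L ra_rb[of "act y \<xi>" \<eta>] ra_rb[of \<eta> "act y \<xi>"] by (simp_all add: act_L\<^sub>0) (simp_all add: act_def)
  moreover have "\<xi> (br z y) = - \<xi> (br y z)" for z
    by (subst br_anti) (simp add: L lin)
  ultimately have *: "\<eta> (ra (act y \<xi>)) = - \<xi> (br y (rb \<eta>))" "\<eta> (rb (act y \<xi>)) = - \<xi> (br y (ra \<eta>))"
    by simp_all
  show "\<eta> (ra (act y \<xi>) + rb (act y \<xi>)) = \<eta> (br y (ra \<xi>) + br y (rb \<xi>))"
  proof -
    have "\<eta> (br y (ra \<xi>)) + \<eta> (br y (rb \<xi>)) = - (\<xi> (br y (ra \<eta>)) + \<xi> (br y (rb \<eta>)))"
      using t_invariant_form(1)[OF L, of y] by (simp only: eq_neg_iff_add_eq_0 add_ac)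
    with * show ?thesis by (simp add: L lin)
  qed
qed

lemma ra_hom: "\<xi> \<in> L\<^sub>0 \<Longrightarrow> \<eta> \<in> L\<^sub>0 \<Longrightarrow> ra (lbr L \<xi> \<eta>) = br (ra \<xi>) (ra \<eta>)"
proof (rule separate)
  fix \<zeta> assume L: "\<xi> \<in> L\<^sub>0" "\<eta> \<in> L\<^sub>0" "\<zeta> \<in> L\<^sub>0"
  have "\<zeta> (ra (lbr L \<xi> \<eta>)) = lbr L \<xi> \<eta> (rb \<zeta>)" using L by (simp add: ra_rb L\<^sub>0_lbr)
  moreover have "\<xi> (br (rb \<zeta>) (rb \<eta>)) = - \<xi> (br (rb \<eta>) (rb \<zeta>))"
      "\<eta> (br (rb \<zeta>) (ra \<xi>)) = - \<eta> (br (ra \<xi>) (rb \<zeta>))"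
    by (subst br_anti, simp add: L lin)+
  moreover have "\<zeta> (br (ra \<xi>) (ra \<eta>)) = - (\<xi> (br (rb \<eta>) (rb \<zeta>)) + \<eta> (br (ra \<xi>) (rb \<zeta>)))"
    using CYBE_contracted[OF L] by (simp only: eq_neg_iff_add_eq_0 add_ac)
  ultimately show "\<zeta> (ra (lbr L \<xi> \<eta>)) = \<zeta> (br (ra \<xi>) (ra \<eta>))"
    using L by (simp add: t_invariant_form(2))
qed

lemma rb_hom: "\<xi> \<in> L\<^sub>0 \<Longrightarrow> \<eta> \<in> L\<^sub>0 \<Longrightarrow> rb (lbr L \<xi> \<eta>) = - br (rb \<xi>) (rb \<eta>)"
proof (rule separate)
  fix \<zeta> assume L: "\<xi> \<in> L\<^sub>0" "\<eta> \<in> L\<^sub>0" "\<zeta> \<in> L\<^sub>0"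
  have "\<zeta> (rb (lbr L \<xi> \<eta>)) = lbr L \<xi> \<eta> (ra \<zeta>)" using L by (simp add: ra_rb L\<^sub>0_lbr)
  moreover have "\<xi> (br (ra \<zeta>) (rb \<eta>)) + \<eta> (br (ra \<zeta>) (ra \<xi>)) = - \<zeta> (br (rb \<xi>) (rb \<eta>))"
    using CYBE_contracted[OF L(3,1,2)] by (simp only: eq_neg_iff_add_eq_0 add_ac)
  ultimately show "\<zeta> (rb (lbr L \<xi> \<eta>)) = \<zeta> (- br (rb \<xi>) (rb \<eta>))"
    using L by (simp add: t_invariant_form(2) lin)
qed

text \<open>Both sides are expanded in the coadjoint action. The terms that act on \<open>\<zeta>\<close> cancel because \<open>ra\<close>
  is a homomorphism. In those that act on \<open>\<xi>\<close> and \<open>\<eta>\<close> the symmetric part \<open>t = ra + rb\<close> survives, and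
  they cancel because \<open>t\<close> is equivariant and the bracket is antisymmetric.\<close>

lemma lbr_jacobi:
  assumes "\<xi> \<in> L\<^sub>0" "\<eta> \<in> L\<^sub>0" "\<zeta> \<in> L\<^sub>0"
  shows "lbr L \<xi> (lbr L \<eta> \<zeta>) = lbr L (lbr L \<xi> \<eta>) \<zeta> + lbr L \<eta> (lbr L \<xi> \<zeta>)"
proof -
  have t_anti: "act (rb \<eta>) \<phi> + act (ra \<eta>) \<phi> = - (act (rb \<phi>) \<eta> + act (ra \<phi>) \<eta>)" if "\<phi> \<in> L\<^sub>0" for \<phi>
    using lbr_anti[OF that assms(2)] that assms
    by (simp add: lbr_act algebra_simps eq_neg_iff_add_eq_0)
  have "act (rb \<eta>) (act (rb \<zeta>) \<xi>) + act (ra \<eta>) (act (rb \<zeta>) \<xi>) =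
      - (act (ra (act (rb \<zeta>) \<xi>) + rb (act (rb \<zeta>) \<xi>)) \<eta>)"
    by (subst t_anti[OF act_L\<^sub>0[OF assms(1)]]) (simp add: act_fst(1)[OF assms(2)] add.commute)
  also have "\<dots> = - (act (br (rb \<zeta>) (ra \<xi>)) \<eta> + act (br (rb \<zeta>) (rb \<xi>)) \<eta>)"
    using assms by (simp only: t_equivariant act_fst)
  finally have "act (rb \<eta>) (act (rb \<zeta>) \<xi>) + act (ra \<eta>) (act (rb \<zeta>) \<xi>) =
      - (act (br (rb \<zeta>) (ra \<xi>)) \<eta> + act (br (rb \<zeta>) (rb \<xi>)) \<eta>)" .
  then show ?thesis
    using assms
    by (simp add: lbr_act[OF _ L\<^sub>0_lbr] lbr_act[OF L\<^sub>0_lbr] ra_hom rb_hom)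
      (simp add: lbr_act act_linear act_fst act_br algebra_simps)
qed

end

section \<open>The dual cobracket and the points of \<open>\<gg>\<close>\<close>

lemma tensor2_tflip:
  fixes V :: "('k::field, 'a, 'm) vspace_scheme"
  assumes "t \<in> tensor2 V" shows "tflip t \<in> tensor2 V"
  using assms
proof induction
  case zero
  then show ?case using tensor2.zero by (simp add: tflip_def zero_fun_def)
next
  case (add_pure t a b)
  have flip: "bilinear_form V (\<lambda>a b. \<beta> b a) = bilinear_form V \<beta>" for \<beta> :: "'a \<Rightarrow> 'a \<Rightarrow> 'k"
    by (auto simp: bilinear_form_def)
  have "tflip (t + pure V a b) = tflip t + pure V b a"
  proof
    show "tflip (t + pure V a b) \<beta> = (tflip t + pure V b a) \<beta>" for \<beta>
      using flip[of \<beta>] by (simp add: tflip_def pure_def on_forms_def)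
  qed
  then show ?case
    using tensor2.add_pure[OF add_pure.IH add_pure.hyps(3,2)] by (simp only:)
qed

lemma tensor2_sum_list_closed: "(\<And>p. p \<in> set ps \<Longrightarrow> f p \<in> tensor2 V) \<Longrightarrow> (\<Sum>p\<leftarrow>ps. f p) \<in> tensor2 V"
  by (induction ps) (auto intro: tensor2.zero tensor2_add)

lemma sum_list_fun_apply: "(\<Sum>p\<leftarrow>ps. f p) x = (\<Sum>p\<leftarrow>ps. f p x :: 'b::comm_monoid_add)"
  by (induction ps) simp_all

context qtlba
begin

definition basis_list :: "'g list" where
  "basis_list = (SOME basis_list. set basis_list = Basis \<and> distinct basis_list)"

lemma basis_list: "set basis_list = Basis" "distinct basis_list"
  using someI_ex[OF finite_distinct_list[OF finite_Basis]] by (simp_all add: basis_list_def)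

definition dual_basis :: "'g \<Rightarrow> 'g \<Rightarrow> 'k" where
  "dual_basis b x = representation Basis x b"

lemma dual_basis_L\<^sub>0: "dual_basis b \<in> L\<^sub>0"
  by (rule L\<^sub>0I) (simp_all add: dual_basis_def representation_add representation_scale independent_Basis
      span_Basis)

lemma basis_list_expand: "x = (\<Sum>b\<leftarrow>basis_list. sc (dual_basis b x) b)"
proof -
  have "(\<Sum>b\<in>Basis. sc (representation Basis x b) b) = x"
    by (rule sum_representation_eq) (simp_all add: independent_Basis span_Basis finite_Basis)
  then show ?thesis
    using sum.distinct_set_conv_list[OF basis_list(2), of "\<lambda>b. sc (dual_basis b x) b"]
        by (simp add: basis_list(1) dual_basis_def)
qed

lemma lin_expand: "\<phi> \<in> L\<^sub>0 \<Longrightarrow> \<phi> x = (\<Sum>b\<leftarrow>basis_list. dual_basis b x * \<phi> b)"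
  by (subst basis_list_expand[of x]) (simp add: lin_sum_list lin)

lemma L\<^sub>0_functional_expand:
  assumes add: "\<And>\<phi> \<psi>. \<phi> \<in> L\<^sub>0 \<Longrightarrow> \<psi> \<in> L\<^sub>0 \<Longrightarrow> G (\<phi> + \<psi>) = G \<phi> + G \<psi>"
    and smul: "\<And>c \<phi>. \<phi> \<in> L\<^sub>0 \<Longrightarrow> G (tsmul c \<phi>) = c * G \<phi>"
    and "\<phi> \<in> L\<^sub>0"
  shows "G \<phi> = (\<Sum>b\<leftarrow>basis_list. \<phi> b * G (dual_basis b))"
proof -
  have zero: "G 0 = 0" using add[OF L\<^sub>0_zero L\<^sub>0_zero] by simp
  have "(\<Sum>b\<leftarrow>xs. tsmul (\<phi> b) (dual_basis b)) \<in> L\<^sub>0 \<and>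
      G (\<Sum>b\<leftarrow>xs. tsmul (\<phi> b) (dual_basis b)) = (\<Sum>b\<leftarrow>xs. \<phi> b * G (dual_basis b))" for xs
  proof (induction xs)
    case Nil
    show ?case unfolding list.map sum_list.Nil using L\<^sub>0_zero zero by (rule conjI)
  next
    case (Cons b xs)
    have b: "tsmul (\<phi> b) (dual_basis b) \<in> L\<^sub>0" by (intro L\<^sub>0_tsmul dual_basis_L\<^sub>0)
    show ?case
      unfolding list.map sum_list.Cons
      using Cons
      by (intro conjI L\<^sub>0_add[OF b] trans[OF add[OF b]] arg_cong2[of _ _ _ _
          "(+)"] smul[OF dual_basis_L\<^sub>0]) blast+
  qed
  moreover have "\<phi> = (\<Sum>b\<leftarrow>basis_list. tsmul (\<phi> b) (dual_basis b))"
  proof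
    show "\<phi> x = (\<Sum>b\<leftarrow>basis_list. tsmul (\<phi> b) (dual_basis b)) x" for x
      using lin_expand[OF assms(3), of x] by (simp add: sum_list_fun_apply tsmul_apply mult.commute)
  qed
  ultimately show ?thesis by metis
qed

lemma reflexive:
  assumes "\<And>\<phi> \<psi>. \<phi> \<in> L\<^sub>0 \<Longrightarrow> \<psi> \<in> L\<^sub>0 \<Longrightarrow> G (\<phi> + \<psi>) = G \<phi> + G \<psi>"
    and "\<And>c \<phi>. \<phi> \<in> L\<^sub>0 \<Longrightarrow> G (tsmul c \<phi>) = c * G \<phi>"
  shows "\<exists>y. \<forall>\<phi>\<in>L\<^sub>0. G \<phi> = \<phi> y"
proof (intro exI ballI)
  show "G \<phi> = \<phi> (\<Sum>b\<leftarrow>basis_list. sc (G (dual_basis b)) b)" if "\<phi> \<in> L\<^sub>0" for \<phi>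
    using L\<^sub>0_functional_expand[of G, OF assms that] that
    by (simp add: lin_sum_list lin mult.commute)
qed

lemma L_form_iff: "bilinear_form L \<beta> \<longleftrightarrow>
    (\<forall>x\<in>L\<^sub>0. \<forall>y\<in>L\<^sub>0. \<forall>z\<in>L\<^sub>0. \<beta> (x + y) z = \<beta> x z + \<beta> y z \<and> \<beta> z (x + y) = \<beta> z x + \<beta> z y) \<and>
    (\<forall>c. \<forall>x\<in>L\<^sub>0. \<forall>z\<in>L\<^sub>0. \<beta> (tsmul c x) z = c * \<beta> x z \<and> \<beta> z (tsmul c x) = c * \<beta> z x)"
  by (simp add: bilinear_form_def L_ops)

lemma L_formD:
  assumes "bilinear_form L \<beta>" "x \<in> L\<^sub>0" "y \<in> L\<^sub>0" "z \<in> L\<^sub>0"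
  shows "\<beta> (x + y) z = \<beta> x z + \<beta> y z" "\<beta> z (x + y) = \<beta> z x + \<beta> z y"
    "\<beta> (tsmul c x) z = c * \<beta> x z" "\<beta> z (tsmul c x) = c * \<beta> z x"
  using assms unfolding L_form_iff by blast+

lemma L_eval_form: "bilinear_form L (\<lambda>\<eta> \<zeta>. \<eta> x * \<zeta> y)"
  by (simp add: L_form_iff tsmul_apply algebra_simps)

lemma L_tensor_cong:
  assumes "t \<in> tensor2 L" "\<And>a b. a \<in> L\<^sub>0 \<Longrightarrow> b \<in> L\<^sub>0 \<Longrightarrow> \<beta> a b = \<gamma> a b"
  shows "t \<beta> = t \<gamma>"
  using assms by (rule tensor2_cong) (simp_all add: L_ops L\<^sub>0_add L\<^sub>0_tsmul)

lemma L_tensor_eval: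
  assumes t: "t \<in> tensor2 L" and \<beta>: "bilinear_form L \<beta>"
  shows "t \<beta> = (\<Sum>b\<leftarrow>basis_list. \<Sum>b'\<leftarrow>basis_list. \<beta> (dual_basis b) (dual_basis b') * t (\<lambda>\<eta> \<zeta>. \<eta> b * \<zeta> b'))"
proof -
  note form = bilinear_form_times[OF L_eval_form]
  have "t \<beta> = t (\<lambda>\<eta> \<zeta>. \<Sum>b\<leftarrow>basis_list. \<Sum>b'\<leftarrow>basis_list. \<beta> (dual_basis b) (dual_basis b') * (\<eta> b * \<zeta> b'))"
  proof (rule L_tensor_cong[OF t])
    fix \<eta> \<zeta> assume L: "\<eta> \<in> L\<^sub>0" "\<zeta> \<in> L\<^sub>0"
    have outer: "\<beta> \<eta> \<zeta> = (\<Sum>b\<leftarrow>basis_list. \<eta> b * \<beta> (dual_basis b) \<zeta>)"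
      by (rule L\<^sub>0_functional_expand[of "\<lambda>\<phi>. \<beta> \<phi> \<zeta>", OF _ _ L(1)])
        (rule L_formD[OF \<beta> _ _ L(2)] L_formD(3)[OF \<beta> _ L(2) L(2)]; assumption)+
    have inner: "\<beta> (dual_basis b) \<zeta> = (\<Sum>b'\<leftarrow>basis_list. \<zeta> b' * \<beta> (dual_basis b) (dual_basis b'))" for b
      by (rule L\<^sub>0_functional_expand[of "\<lambda>\<phi>. \<beta> (dual_basis b) \<phi>", OF _ _ L(2)])
        (rule L_formD[OF \<beta> _ _ dual_basis_L\<^sub>0] L_formD(4)[OF \<beta> _ dual_basis_L\<^sub>0 dual_basis_L\<^sub>0];
            assumption)+
    show "\<beta> \<eta> \<zeta> = (\<Sum>b\<leftarrow>basis_list. \<Sum>b'\<leftarrow>basis_list. \<beta> (dual_basis b) (dual_basis b') * (\<eta> b * \<zeta> b'))"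
      unfolding outer by (simp only: inner) (simp add: sum_list_const_mult[symmetric] mult_ac)
  qed
  also have "\<dots> = (\<Sum>b\<leftarrow>basis_list. t (\<lambda>\<eta> \<zeta>. \<Sum>b'\<leftarrow>basis_list. \<beta> (dual_basis b) (dual_basis b') * (\<eta> b * \<zeta> b')))"
    by (rule tensor2_sum_list(1)[OF t tensor2_sum_list(2)[OF t form]])
  also have "\<dots> = (\<Sum>b\<leftarrow>basis_list. \<Sum>b'\<leftarrow>basis_list. \<beta> (dual_basis b) (dual_basis b') * t (\<lambda>\<eta> \<zeta>. \<eta> b * \<zeta> b'))"
    by (simp only: tensor2_sum_list(1)[OF t form] tensor2_times[OF t L_eval_form])
  finally show ?thesis .
qed

lemma L_tensor_eqI:
  assumes "t \<in> tensor2 L" "t' \<in> tensor2 L" "\<And>x y. t (\<lambda>\<eta> \<zeta>. \<eta> x * \<zeta> y) = t' (\<lambda>\<eta> \<zeta>. \<eta> x * \<zeta> y)"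
  shows "t = t'"
proof
  show "t \<beta> = t' \<beta>" for \<beta>
    by (cases "bilinear_form L \<beta>")
      (simp_all add: L_tensor_eval[OF assms(1)] L_tensor_eval[OF assms(2)] assms(3)
        tensor2_not_form[OF assms(1)] tensor2_not_form[OF assms(2)])
qed

lemma dcob_exists:
  assumes "\<xi> \<in> L\<^sub>0"
  shows "\<exists>t. t \<in> tensor2 L \<and> (\<forall>x y. t (\<lambda>\<eta> \<zeta>. \<eta> x * \<zeta> y) = \<xi> (br x y))"
proof -
  define t where "t = (\<Sum>b\<leftarrow>basis_list. \<Sum>b'\<leftarrow>basis_list. pure L (tsmul (\<xi> (br b b')) (dual_basis b))
      (dual_basis b'))"
  have "t \<in> tensor2 L"
    unfolding t_def by (intro tensor2_sum_list_closed pure_in_tensor2 L\<^sub>0_tsmul dual_basis_L\<^sub>0)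
  moreover have "t (\<lambda>\<eta> \<zeta>. \<eta> x * \<zeta> y) = \<xi> (br x y)" for x y
  proof -
    have "t (\<lambda>\<eta> \<zeta>. \<eta> x * \<zeta> y)
        = (\<Sum>b\<leftarrow>basis_list. \<Sum>b'\<leftarrow>basis_list. \<xi> (br b b') * dual_basis b x * dual_basis b' y)"
      by (simp add: t_def sum_list_fun_apply pure_def on_forms_def L_eval_form tsmul_apply)
    also have "\<dots> = (\<Sum>b\<leftarrow>basis_list. dual_basis b x * (\<Sum>b'\<leftarrow>basis_list. dual_basis b' y * \<xi> (br b b')))"
      by (simp add: sum_list_const_mult[symmetric] mult_ac)
    also have "\<dots> = (\<Sum>b\<leftarrow>basis_list. dual_basis b x * \<xi> (br b y))"
      using lin_expand[OF L\<^sub>0_br(1)[OF assms], of _ y] by (simp only:)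
    also have "\<dots> = \<xi> (br x y)"
      using lin_expand[OF L\<^sub>0_br(2)[OF assms, of y], of x] by (simp only:)
    finally show ?thesis .
  qed
  ultimately show ?thesis by blast
qed

lemma dcob:
  assumes "\<xi> \<in> L\<^sub>0"
  shows dcob_tensor: "dcob \<xi> \<in> tensor2 L"
    and dcob_eval: "dcob \<xi> (\<lambda>\<eta> \<zeta>. \<eta> x * \<zeta> y) = \<xi> (br x y)"
proof -
  obtain t where t: "t \<in> tensor2 L \<and> (\<forall>x y. t (\<lambda>\<eta> \<zeta>. \<eta> x * \<zeta> y) = \<xi> (br x y))"
    using dcob_exists[OF assms] by blast
  have "dcob \<xi> = t"
    unfolding dual_cobracket_def
  proof (rule the_equality)
    show "t' = t" if "t' \<in> tensor2 L \<and> (\<forall>x y. t' (\<lambda>\<eta> \<zeta>. \<eta> x * \<zeta> y) = \<xi> (br x y))" for t'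
      by (rule L_tensor_eqI) (use t that in simp_all)
  qed (rule t)
  with t show "dcob \<xi> \<in> tensor2 L" "dcob \<xi> (\<lambda>\<eta> \<zeta>. \<eta> x * \<zeta> y) = \<xi> (br x y)" by simp_all
qed

lemma dcob_skew:
  assumes "\<xi> \<in> L\<^sub>0" shows "tflip (dcob \<xi>) = - dcob \<xi>"
proof -
  have "tflip (dcob \<xi>) (\<lambda>\<eta> \<zeta>. \<eta> x * \<zeta> y) = dcob \<xi> (\<lambda>\<eta> \<zeta>. \<eta> y * \<zeta> x)" for x y
    by (simp add: tflip_def mult.commute)
  moreover have "\<xi> (br y x) + \<xi> (br x y) = 0" for x y
    by (subst br_anti) (simp add: lin assms)
  ultimately have "(tflip (dcob \<xi>) + dcob \<xi>) (\<lambda>\<eta> \<zeta>. \<eta> x * \<zeta> y) = 0 (\<lambda>\<eta> \<zeta>. \<eta> x * \<zeta> y)" for x y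
    by (simp only: plus_fun_apply zero_fun_apply dcob_eval[OF assms])
  then have "tflip (dcob \<xi>) + dcob \<xi> = 0"
    by (rule L_tensor_eqI[OF tensor2_add[OF tensor2_tflip[OF dcob_tensor[OF assms]] dcob_tensor[OF
        assms]] tensor2.zero])
  then show ?thesis by (simp only: eq_neg_iff_add_eq_0)
qed

lemma dcob_contract:
  assumes "\<xi> \<in> L\<^sub>0" and G: "\<And>\<phi> \<psi>. \<phi> \<in> L\<^sub>0 \<Longrightarrow> \<psi> \<in> L\<^sub>0 \<Longrightarrow> G (\<phi> + \<psi>) = G \<phi> + G \<psi>"
    "\<And>c \<phi>. \<phi> \<in> L\<^sub>0 \<Longrightarrow> G (tsmul c \<phi>) = c * G \<phi>"
  shows "dcob \<xi> (\<lambda>\<alpha> \<beta>. \<alpha> x * G \<beta>) = G (\<lambda>y. \<xi> (br x y))"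
proof -
  obtain y where y: "\<forall>\<phi>\<in>L\<^sub>0. G \<phi> = \<phi> y" using reflexive[of G, OF G] by (rule exE)
  have "dcob \<xi> (\<lambda>\<alpha> \<beta>. \<alpha> x * G \<beta>) = dcob \<xi> (\<lambda>\<alpha> \<beta>. \<alpha> x * \<beta> y)"
    by (rule L_tensor_cong[OF dcob_tensor[OF assms(1)]]) (simp add: y)
  also have "\<dots> = G (\<lambda>y. \<xi> (br x y))"
    using bspec[OF y L\<^sub>0_br(1)[OF assms(1)]] by (simp only: dcob_eval[OF assms(1)])
  finally show ?thesis .
qed

text \<open>The bracket of \<open>\<gg>\<^sup>*\<close> is dual to \<open>x \<mapsto> \<Sum> [x, a] \<otimes> b + a \<otimes> [x, b]\<close>. Evaluated on the cobracket of
  \<open>\<xi>\<close> it therefore gives \<open>\<Sum> \<xi> ([[x, a], b] + [a, [x, b]])\<close>, which is \<open>\<xi> [x, u]\<close> by the Jacobi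
  identity.\<close>

lemma DL_act:
  assumes "\<xi> \<in> L\<^sub>0" shows "DL \<xi> = act u \<xi>"
proof
  fix x
  have form: "bilinear_form L (\<lambda>\<eta> \<zeta>. \<eta> (br x a) * \<zeta> b + \<eta> a * \<zeta> (br x b))" for a b
    by (intro bilinear_form_plus L_eval_form)
  have "DL \<xi> x = dcob \<xi> (\<lambda>\<eta> \<zeta>. lbr L \<eta> \<zeta> x)" by (simp add: dual_D_def)
  also have "\<dots> = dcob \<xi> (\<lambda>\<eta> \<zeta>. \<Sum>p\<leftarrow>terms. \<eta> (br x (fst p)) * \<zeta> (snd p) + \<eta> (fst p) * \<zeta> (br x (snd p)))"
  proof (rule L_tensor_cong[OF dcob_tensor[OF assms]])
    fix \<eta> \<zeta> assume L: "\<eta> \<in> L\<^sub>0" "\<zeta> \<in> L\<^sub>0"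
    have "lbr L \<eta> \<zeta> x = S (\<lambda>a b. \<eta> (br x a) * \<zeta> b) + S (\<lambda>a b. \<eta> a * \<zeta> (br x b))"
      by (simp add: t_invariant_form(2) L S_rb[OF L\<^sub>0_br(1)] S_ra[OF L\<^sub>0_br(1)])
    then show "lbr L \<eta> \<zeta> x = (\<Sum>p\<leftarrow>terms. \<eta> (br x (fst p)) * \<zeta> (snd p) + \<eta> (fst p) * \<zeta> (br x (snd p)))"
      by (simp add: S_def case_prod_unfold sum_list_addf)
  qed
  also have "\<dots> = (\<Sum>p\<leftarrow>terms. dcob \<xi> (\<lambda>\<eta> \<zeta>. \<eta> (br x (fst p)) * \<zeta> (snd p) + \<eta> (fst p) * \<zeta> (br x (snd p))))"
    by (rule tensor2_sum_list(1)[OF dcob_tensor[OF assms] form])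
  also have "\<dots> = (\<Sum>p\<leftarrow>terms. \<xi> (br (br x (fst p)) (snd p)) + \<xi> (br (fst p) (br x (snd p))))"
    by (simp only: tensor2_plus[OF dcob_tensor[OF assms] L_eval_form L_eval_form] dcob_eval[OF assms])
  also have "\<dots> = (\<Sum>p\<leftarrow>terms. \<xi> (br x (br (fst p) (snd p))))"
    using br_jacobi_left lin(5)[OF assms] by simp
  also have "\<dots> = act u \<xi> x"
    using S_u[OF L\<^sub>0_br(1)[OF assms], of x] by (simp add: act_def S_def case_prod_unfold)
  finally show "DL \<xi> x = act u \<xi> x" .
qed

sublocale enveloping L
  by unfold_locales (simp_all add: L_ops L\<^sub>0_add L\<^sub>0_tsmul L\<^sub>0_lbr)

lemma ra_tsmul: "ra (tsmul c \<xi>) = sc c (ra \<xi>)"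
  and rb_tsmul: "rb (tsmul c \<xi>) = sc c (rb \<xi>)"
proof -
  have "(\<Sum>p\<leftarrow>ps. sc (c * f p) (g p)) = sc c (\<Sum>p\<leftarrow>ps. sc (f p) (g p))" for ps :: "('g \<times> 'g) list" and f g
    by (induction ps) (simp_all add: scale_right_distrib)
  then show "ra (tsmul c \<xi>) = sc c (ra \<xi>)" "rb (tsmul c \<xi>) = sc c (rb \<xi>)"
    by (simp_all add: ra_def rb_def tsmul_apply case_prod_unfold)
qed

lemma lbr_linear:
  assumes "\<xi> \<in> L\<^sub>0" "\<eta> \<in> L\<^sub>0" "\<zeta> \<in> L\<^sub>0"
  shows "lbr L (\<xi> + \<eta>) \<zeta> x = lbr L \<xi> \<zeta> x + lbr L \<eta> \<zeta> x" "lbr L (tsmul c \<xi>) \<zeta> x = c * lbr L \<xi> \<zeta> x"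
    "lbr L \<zeta> (\<xi> + \<eta>) x = lbr L \<zeta> \<xi> x + lbr L \<zeta> \<eta> x" "lbr L \<zeta> (tsmul c \<xi>) x = c * lbr L \<zeta> \<xi> x"
  using assms
  by (simp_all add: t_invariant_form(2) L\<^sub>0_add L\<^sub>0_tsmul ra_linear rb_linear ra_tsmul rb_tsmul
      br_add br_scale lin tsmul_apply algebra_simps)

text \<open>Points of \<open>\<gg>\<close> are linear functionals on \<open>\<gg>\<^sup>*\<close>, so they extend to functionals on \<open>U(\<gg>\<^sup>*)\<close>. The
  dual basis \<open>f\<close> is continued by zero beyond the dimension, so that the structure constants \<open>c\<close> are
  antisymmetric and satisfy the Jacobi identity for all indices.\<close>

lemma evaluation_extends:
  obtains F where "F \<in> \<Phi>" "\<And>\<xi>. \<xi> \<in> L\<^sub>0 \<Longrightarrow> F (\<iota> \<xi>) = \<xi> x"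
proof -
  define n where "n = length basis_list"
  define f where "f i = (if i < n then dual_basis (basis_list ! i) else 0)" for i
  define c where "c i j k = lbr L (f i) (f j) (basis_list ! k)" for i j k
  have f: "f i \<in> L\<^sub>0" for i by (simp add: f_def dual_basis_L\<^sub>0 L\<^sub>0_zero)
  have expand: "G \<phi> = (\<Sum>m<n. \<phi> (basis_list ! m) * G (f m))"
    if "\<And>\<phi> \<psi>. \<phi> \<in> L\<^sub>0 \<Longrightarrow> \<psi> \<in> L\<^sub>0 \<Longrightarrow> G (\<phi> + \<psi>) = G \<phi> + G \<psi>" "\<And>c \<phi>. \<phi> \<in> L\<^sub>0 \<Longrightarrow> G (tsmul c \<phi>) = c * G \<phi>"
      "\<phi> \<in> L\<^sub>0" for G \<phi>
    using L\<^sub>0_functional_expand[of G, OF that]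
    by (simp add: sum_list_sum_nth atLeast0LessThan n_def f_def)
  have cc: "(\<Sum>m<n. c i j m * c m k l) = lbr L (lbr L (f i) (f j)) (f k) (basis_list ! l)" for i j k l
    unfolding c_def by (rule expand[symmetric, of "\<lambda>\<phi>. lbr L \<phi> (f k) (basis_list ! l)"])
      (simp_all add: lbr_linear f L\<^sub>0_lbr)
  have sconst: "structure_constants n c"
  proof
    fix i j k l
    show "c i i k = 0" by (simp add: c_def lbr_self f)
    show "c i j k = - c j i k" using lbr_anti[OF f f, of i j] by (simp add: c_def)
    have "lbr L (lbr L (f i) (f j)) (f k) = lbr L (f i) (lbr L (f j) (f k))
        - lbr L (f j) (lbr L (f i) (f k))"
      using lbr_jacobi[OF f f f, of i j k] by simp
    moreover have "lbr L (lbr L (f j) (f k)) (f i) = - lbr L (f i) (lbr L (f j) (f k))"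
      by (rule lbr_anti) (simp_all add: f L\<^sub>0_lbr)
    moreover have "lbr L (lbr L (f k) (f i)) (f j) = lbr L (f j) (lbr L (f i) (f k))"
    proof -
      have "lbr L (f k) (f i) = tsmul (-1) (lbr L (f i) (f k))"
        using lbr_anti[OF f f, of k i] by (simp add: fun_eq_iff tsmul_apply)
      moreover have "lbr L (lbr L (f k) (f i)) (f j) = - lbr L (f j) (lbr L (f k) (f i))"
        by (rule lbr_anti) (simp_all add: f L\<^sub>0_lbr)
      moreover have "- lbr L (f j) (tsmul (-1) (lbr L (f i) (f k))) = lbr L (f j) (lbr L (f i) (f k))"
        using lbr_linear(4)[OF L\<^sub>0_lbr[OF f f] f f] by (simp add: fun_eq_iff)
      ultimately show ?thesis by (simp only:)
    qed
    ultimately show "(\<Sum>m<n. c i j m * c m k l + c j k m * c m i l + c k i m * c m j l) = 0"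
      by (simp add: sum.distrib cc)
  qed
  have coord_br: "lbr L \<xi> \<eta> (basis_list ! k)
      = (\<Sum>i<n. \<Sum>j<n. \<xi> (basis_list ! i) * \<eta> (basis_list ! j) * c i j k)"
    if "\<xi> \<in> L\<^sub>0" "\<eta> \<in> L\<^sub>0" for \<xi> \<eta> k
  proof -
    have inner: "lbr L (f i) \<eta> (basis_list ! k) = (\<Sum>j<n. \<eta> (basis_list ! j) * c i j k)" for i
      unfolding c_def by (rule expand[of
          "\<lambda>\<phi>. lbr L (f i) \<phi> (basis_list ! k)"]) (simp_all add: lbr_linear that f)
    have "lbr L \<xi> \<eta> (basis_list ! k) = (\<Sum>i<n. \<xi> (basis_list ! i) * lbr L (f i) \<eta> (basis_list ! k))"
      by (rule expand[of "\<lambda>\<phi>. lbr L \<phi> \<eta> (basis_list ! k)"]) (simp_all add: lbr_linear that f)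
    also have "\<dots> = (\<Sum>i<n. \<xi> (basis_list ! i) * (\<Sum>j<n. \<eta> (basis_list ! j) * c i j k))"
      by (simp only: inner)
    finally show ?thesis by (simp add: sum_distrib_left mult.assoc)
  qed
  have coord_lin: "vadd L \<xi> \<eta> (basis_list ! i) = \<xi> (basis_list ! i) + \<eta> (basis_list ! i)"
    "vsmul L r \<xi> (basis_list ! i) = r * \<xi> (basis_list ! i)" for \<xi> \<eta> r i
    by (simp_all add: L_ops tsmul_apply)
  have "\<exists>F. F \<in> \<Phi> \<and> (\<forall>\<xi>\<in>L\<^sub>0. F (\<iota> \<xi>) = (\<Sum>i<n. \<xi> (basis_list ! i) * dual_basis (basis_list ! i) x))"
    by (rule functional_extends[of n c "\<lambda>\<xi> i. \<xi> (basis_list ! i)"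
        "\<lambda>i. dual_basis (basis_list ! i) x", OF sconst coord_lin coord_br])
      (assumption+, intro exI conjI ballI, assumption, simp)
  then obtain F where F: "F \<in> \<Phi>"
      "\<forall>\<xi>\<in>L\<^sub>0. F (\<iota> \<xi>) = (\<Sum>i<n. \<xi> (basis_list ! i) * dual_basis (basis_list ! i) x)" by blast
  have "F (\<iota> \<xi>) = \<xi> x" if "\<xi> \<in> L\<^sub>0" for \<xi>
    using lin_expand[OF that, of x] bspec[OF F(2) that]
    by (simp add: sum_list_sum_nth atLeast0LessThan n_def mult.commute)
  with F(1) show ?thesis by (rule that)
qed

end

section \<open>The action of the double\<close>

locale qtlba_env = qtlba sc Basis br r'
  for sc :: "'k::field_char_0 \<Rightarrow> 'g::ab_group_add \<Rightarrow> 'g" and Basis br r' +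
  fixes \<Delta> \<delta> :: "('g \<Rightarrow> 'k, 'k) env \<Rightarrow>
      (('g \<Rightarrow> 'k, 'k) env \<Rightarrow> ('g \<Rightarrow> 'k, 'k) env \<Rightarrow> 'k) \<Rightarrow> 'k"
    and D :: "('g \<Rightarrow> 'k, 'k) env \<Rightarrow> ('g \<Rightarrow> 'k, 'k) env" and s :: 'k
  assumes coproduct_L: "cocommutative_coproduct L \<Delta>"
    and co_Poisson_L: "co_Poisson L dcob \<Delta> \<delta>"
    and derivation_L: "induced_derivation L DL D"
begin

notation Uadd (infixl "\<boxplus>" 65) and Umul (infixl "\<odot>" 70) and Usmul (infixr "\<boxdot>" 75)

lemma \<Phi>_incl_linear:
  assumes "F \<in> \<Phi>"
  shows "\<xi> \<in> L\<^sub>0 \<Longrightarrow> \<eta> \<in> L\<^sub>0 \<Longrightarrow> F (\<iota> (\<xi> + \<eta>)) = F (\<iota> \<xi>) + F (\<iota> \<eta>)"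
    and "\<xi> \<in> L\<^sub>0 \<Longrightarrow> F (\<iota> (tsmul c \<xi>)) = c * F (\<iota> \<xi>)"
    and "\<xi> \<in> L\<^sub>0 \<Longrightarrow> F (\<iota> (- \<xi>)) = - F (\<iota> \<xi>)"
proof -
  show add: "\<xi> \<in> L\<^sub>0 \<Longrightarrow> \<eta> \<in> L\<^sub>0 \<Longrightarrow> F (\<iota> (\<xi> + \<eta>)) = F (\<iota> \<xi>) + F (\<iota> \<eta>)" for \<xi> \<eta>
    using incl_add[of \<xi> \<eta>] assms by (simp add: L_ops \<Phi>_add U_incl)
  show smul: "\<xi> \<in> L\<^sub>0 \<Longrightarrow> F (\<iota> (tsmul c \<xi>)) = c * F (\<iota> \<xi>)" for \<xi> c
    using incl_smul[of \<xi> c] assms by (simp add: L_ops \<Phi>_smul U_incl)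
  have "- \<xi> = tsmul (-1) \<xi>" by (simp add: fun_eq_iff tsmul_apply)
  then show "\<xi> \<in> L\<^sub>0 \<Longrightarrow> F (\<iota> (- \<xi>)) = - F (\<iota> \<xi>)" using smul[of \<xi> "-1"] by simp
qed

lemma bracket_dcob:
  assumes "\<xi> \<in> L\<^sub>0" "F \<in> \<Phi>"
  shows "dcob \<xi> (\<lambda>\<alpha> \<beta>. F (\<iota> (lbr L \<alpha> \<beta>))) = F (\<iota> (DL \<xi>))"
proof -
  obtain y where y: "\<forall>\<phi>\<in>L\<^sub>0. F (\<iota> \<phi>) = \<phi> y"
    using reflexive[of "\<lambda>\<phi>. F (\<iota> \<phi>)", OF \<Phi>_incl_linear(1,2)[OF assms(2)]] by (rule exE)
  have "dcob \<xi> (\<lambda>\<alpha> \<beta>. F (\<iota> (lbr L \<alpha> \<beta>))) = dcob \<xi> (\<lambda>\<alpha> \<beta>. lbr L \<alpha> \<beta> y)"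
    by (rule L_tensor_cong[OF dcob_tensor[OF assms(1)]]) (simp add: y L\<^sub>0_lbr)
  also have "\<dots> = DL \<xi> y" by (simp add: dual_D_def)
  also have "\<dots> = F (\<iota> (DL \<xi>))" using y DL_act[OF assms(1)] act_L\<^sub>0[OF assms(1)] by simp
  finally show ?thesis .
qed

sublocale co_poisson_env L dcob DL \<Delta> \<delta> D s
  by unfold_locales (simp_all add: coproduct_L co_Poisson_L derivation_L dcob_tensor dcob_skew
      bracket_dcob DL_act act_L\<^sub>0)

definition \<theta> :: "'g \<Rightarrow> ('g \<Rightarrow> 'k, 'k) env \<Rightarrow> 'k" where
  "\<theta> x = (SOME F. F \<in> \<Phi> \<and> (\<forall>\<xi>\<in>L\<^sub>0. F (\<iota> \<xi>) = \<xi> x))"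

lemma \<theta>: "\<theta> x \<in> \<Phi>" "\<xi> \<in> L\<^sub>0 \<Longrightarrow> \<theta> x (\<iota> \<xi>) = \<xi> x"
proof -
  have "\<exists>F. F \<in> \<Phi> \<and> (\<forall>\<xi>\<in>L\<^sub>0. F (\<iota> \<xi>) = \<xi> x)" 
    by (rule evaluation_extends[of x]) (intro exI conjI ballI, assumption, simp)
  from someI_ex[OF this] show "\<theta> x \<in> \<Phi>" "\<xi> \<in> L\<^sub>0 \<Longrightarrow> \<theta> x (\<iota> \<xi>) = \<xi> x" by (simp_all add: \<theta>_def)
qed

definition dress_at :: "'g \<Rightarrow> (('g \<Rightarrow> 'k, 'k) env \<Rightarrow> 'k) \<Rightarrow> ('g \<Rightarrow> 'k, 'k) env \<Rightarrow> 'k" where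
  "dress_at x F = dress (\<theta> x) F"

text \<open>The transpose of \<open>ad \<xi>\<close> on \<open>\<gg>\<^sup>*\<close>, applied to \<open>x\<close> (\<open>lbr_coad\<close>). Up to sign this is the
  \<open>\<gg>\<close>-component of the bracket of \<open>x\<close> and \<open>\<xi>\<close> in the double.\<close>

definition coad :: "'g \<Rightarrow> ('g \<Rightarrow> 'k) \<Rightarrow> 'g" where
  "coad x \<xi> = br x (ra \<xi>) - ra (act x \<xi>)"

lemma lbr_coad:
  assumes "\<xi> \<in> L\<^sub>0" "\<eta> \<in> L\<^sub>0"
  shows "lbr L \<xi> \<eta> x = \<eta> (coad x \<xi>)"
proof -
  have "\<eta> (ra (act x \<xi>)) = \<xi> (br (rb \<eta>) x)"
    using ra_rb[OF act_L\<^sub>0[OF assms(1)] assms(2), of x] by (simp add: act_def)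
  also have "\<dots> = - \<xi> (br x (rb \<eta>))"
    by (subst br_anti) (simp add: lin assms)
  finally show ?thesis by (simp add: t_invariant_form(2) coad_def lin assms)
qed

text \<open>A component of the Jacobi identity of the double.\<close>

lemma coad_br:
  assumes "\<xi> \<in> L\<^sub>0"
  shows "coad (br x y) \<xi> = br x (coad y \<xi>) + br (coad x \<xi>) y - coad y (act x \<xi>) + coad x (act y \<xi>)"
proof -
  have "br (coad x \<xi>) y = br y (ra (act x \<xi>)) - br y (br x (ra \<xi>))"
    by (subst br_anti) (simp add: coad_def br_diff)
  then show ?thesis
    by (simp add: coad_def br_diff act_br[OF assms] ra_linear br_jacobi_left[of x y "ra \<xi>"])
qed

lemma dress_at_\<Phi>: "F \<in> \<Phi> \<Longrightarrow> dress_at x F \<in> \<Phi>"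
  by (simp add: dress_at_def dress_\<Phi> \<theta>)

lemma dress_at_one: "dress_at x F (aone U) = 0"
  by (simp add: dress_at_def dress_one)

lemma dress_at_linear:
  assumes "F \<in> \<Phi>" "G \<in> \<Phi>"
  shows "dress_at x (F + G) = dress_at x F + dress_at x G"
      "dress_at x (tsmul c F) = tsmul c (dress_at x F)" "dress_at x (F - G) = dress_at x F - dress_at x G"
proof -
  have add: "dress_at x (F + G) = dress_at x F + dress_at x G" if "F \<in> \<Phi>" "G \<in> \<Phi>" for F G
    using that by (simp add: dress_at_def dress_linear(3)[OF \<theta>(1) \<theta>(1)])
  have smul: "dress_at x (tsmul c F) = tsmul c (dress_at x F)" if "F \<in> \<Phi>" for F c
    using that by (simp add: dress_at_def dress_linear(4)[OF \<theta>(1) \<theta>(1) that that])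
  show "dress_at x (F + G) = dress_at x F + dress_at x G" "dress_at x (tsmul c F) = tsmul c (dress_at x F)"
    by (rule add smul; rule assms)+
  show "dress_at x (F - G) = dress_at x F - dress_at x G"
    unfolding minus_tsmul using assms by (simp only: add smul \<Phi>_tsmul)
qed

lemma dress_at_fst:
  assumes "F \<in> \<Phi>"
  shows "dress_at (x + y) F = dress_at x F + dress_at y F"
      "dress_at (x - y) F = dress_at x F - dress_at y F" "dress_at (- x) F = - dress_at x F"
proof -
  show add: "dress_at (x + y) F = dress_at x F + dress_at y F" for x y
    unfolding dress_at_def dress_linear(1)[OF \<theta>(1) \<theta>(1) assms assms, symmetric]
    by (rule dress_cong) (simp_all add: \<theta> \<Phi>_plus assms lin)
  show diff: "dress_at (x - y) F = dress_at x F - dress_at y F" for x y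
    using add[of "x - y" y] by (simp add: eq_diff_eq)
  show "dress_at (- x) F = - dress_at x F"
    using diff[of 0 x] diff[of 0 0] by simp
qed

text \<open>The multiple of the character \<open>u\<close> that absorbs the term of \<open>dress_mult\<close> that depends on \<open>s\<close>.\<close>

definition \<kappa> :: 'k where "\<kappa> = - (s + 1/2)"

text \<open>The commutation rule of the double, with the extra term \<open>\<kappa> (D \<xi>) x = \<kappa> \<xi> [x, u]\<close>.\<close>

lemma dress_at_mult:
  assumes F: "F \<in> \<Phi>" and \<xi>: "\<xi> \<in> L\<^sub>0" and X: "X \<in> vset U"
  shows "dress_at x F (\<iota> \<xi> \<odot> X) = dress_at x (lmul (\<iota> \<xi>) F) X + dress_at (coad x \<xi>) F X
      - F (\<iota> (act x \<xi>) \<odot> X)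
      + \<kappa> * \<xi> (br x u) * F X"
proof -
  have "dress (lmul (\<iota> \<xi>) (\<theta> x) - rmul (\<iota> \<xi>) (\<theta> x)) F = dress (\<theta> (coad x \<xi>)) F"
  proof (rule dress_cong)
    fix \<eta> assume \<eta>: "\<eta> \<in> L\<^sub>0"
    then have "\<theta> x (\<iota> \<xi> \<odot> \<iota> \<eta>) = \<theta> x (\<iota> \<eta> \<odot> \<iota> \<xi>) + lbr L \<xi> \<eta> x"
      using \<xi> by (simp add: incl_comm[of \<xi> \<eta>] \<Phi>_add \<theta> U_mul U_incl L\<^sub>0_lbr)
    then show "(lmul (\<iota> \<xi>) (\<theta> x) - rmul (\<iota> \<xi>) (\<theta> x)) (\<iota> \<eta>) = \<theta> (coad x \<xi>) (\<iota> \<eta>)"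
      using \<xi> \<eta> by (simp add: lmul_apply rmul_apply U_incl \<theta> lbr_coad)
  qed (simp_all add: \<Phi>_minus lmul_\<Phi> rmul_\<Phi> \<theta> U_incl F \<xi>)
  moreover have "dcob \<xi> (\<lambda>\<alpha> \<beta>. \<theta> x (\<iota> \<alpha>) * F (\<iota> \<beta> \<odot> X)) = - F (\<iota> (act x \<xi>) \<odot> X)"
  proof -
    have G: "rmul X F \<in> \<Phi>" using F X by (rule rmul_\<Phi>)
    have "dcob \<xi> (\<lambda>\<alpha> \<beta>. \<theta> x (\<iota> \<alpha>) * F (\<iota> \<beta> \<odot> X)) = dcob \<xi> (\<lambda>\<alpha> \<beta>. \<alpha> x * rmul X F (\<iota> \<beta>))"
      by (rule L_tensor_cong[OF dcob_tensor[OF \<xi>]]) (simp add: \<theta> rmul_apply U_incl)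
    also have "\<dots> = rmul X F (\<iota> (\<lambda>y. \<xi> (br x y)))"
      by (rule dcob_contract[of \<xi> "\<lambda>\<beta>. rmul X F (\<iota> \<beta>)", OF \<xi>]) (simp_all add: \<Phi>_incl_linear[OF G])
    also have "(\<lambda>y. \<xi> (br x y)) = - act x \<xi>"
      by (rule ext) (subst br_anti, simp add: act_def lin \<xi>)
    finally show ?thesis
      by (simp only: \<Phi>_incl_linear(3)[OF G act_L\<^sub>0[OF \<xi>]] rmul_apply[OF U_incl[OF act_L\<^sub>0[OF \<xi>]]])
  qed
  moreover have "\<theta> x (\<iota> (DL \<xi>)) = \<xi> (br x u)"
    using \<xi> by (simp add: DL_act \<theta> act_L\<^sub>0) (simp add: act_def)
  ultimately show ?thesis
    using dress_mult[OF \<theta>(1) F \<xi> X, of x]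
        by (simp only: dress_at_def \<kappa>_def) (simp only: mult_minus_left, simp)
qed

definition shifted_lmul :: "('g \<Rightarrow> 'k) \<Rightarrow> (('g \<Rightarrow> 'k, 'k) env \<Rightarrow> 'k) \<Rightarrow> ('g \<Rightarrow> 'k, 'k) env \<Rightarrow> 'k" where
  "shifted_lmul \<xi> F = lmul (\<iota> \<xi>) F + tsmul (\<kappa> * \<xi> u) F"

lemma shifted_lmul_\<Phi>: "F \<in> \<Phi> \<Longrightarrow> \<xi> \<in> L\<^sub>0 \<Longrightarrow> shifted_lmul \<xi> F \<in> \<Phi>"
  by (simp only: shifted_lmul_def \<Phi>_plus lmul_\<Phi> \<Phi>_tsmul U_incl)

lemma tsmul_linear: "tsmul c (F + G) = tsmul c F + tsmul c G" "tsmul c (F - G) = tsmul c F - tsmul c G"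
    "tsmul c (tsmul d F) = tsmul (c * d) F" "tsmul (c + d) F = tsmul c F + tsmul d F"
  by (simp_all add: fun_eq_iff tsmul_apply algebra_simps)

lemma shifted_lmul_linear: "shifted_lmul \<xi> (F + G) = shifted_lmul \<xi> F + shifted_lmul \<xi> G"
    "shifted_lmul \<xi> (F - G) = shifted_lmul \<xi> F - shifted_lmul \<xi> G"
    "shifted_lmul \<xi> (tsmul c F) = tsmul c (shifted_lmul \<xi> F)"
  by (simp_all add: shifted_lmul_def lmul_linear tsmul_linear mult.commute algebra_simps)

lemma shifted_lmul_fst:
  assumes "F \<in> \<Phi>" "\<xi> \<in> L\<^sub>0" "\<eta> \<in> L\<^sub>0"
  shows "shifted_lmul (\<xi> + \<eta>) F = shifted_lmul \<xi> F + shifted_lmul \<eta> F"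
  using assms incl_add[of \<xi> \<eta>]
  by (simp add: shifted_lmul_def L_ops lmul_add U_incl distrib_left tsmul_linear algebra_simps)

lemma shifted_lmul_minus:
  assumes "F \<in> \<Phi>" "\<xi> \<in> L\<^sub>0" "\<eta> \<in> L\<^sub>0"
  shows "shifted_lmul (\<xi> - \<eta>) F = shifted_lmul \<xi> F - shifted_lmul \<eta> F"
  using shifted_lmul_fst[OF assms(1) L\<^sub>0_minus[OF assms(2,3)] assms(3)] by (simp add: eq_diff_eq)

lemma \<Phi>_ext:
  assumes "F \<in> \<Phi>" "G \<in> \<Phi>" "\<And>X. X \<in> vset U \<Longrightarrow> F X = G X"
  shows "F = G"
  using assms by (intro \<Phi>_eqI) (simp_all add: env_word_in)

lemma shifted_lmul_dress_at:
  assumes F: "F \<in> \<Phi>" and \<xi>: "\<xi> \<in> L\<^sub>0"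
  shows "shifted_lmul \<xi> (dress_at x F) = dress_at x (shifted_lmul \<xi> F) + dress_at (coad x \<xi>) F
      - shifted_lmul (act x \<xi>) F"
proof (rule \<Phi>_ext)
  fix X assume X: "X \<in> vset U"
  have "dress_at x (shifted_lmul \<xi> F) = dress_at x (lmul (\<iota> \<xi>) F) + tsmul (\<kappa> * \<xi> u) (dress_at x F)"
    using F \<xi> by (simp only: shifted_lmul_def dress_at_linear lmul_\<Phi> \<Phi>_tsmul U_incl)
  moreover have "act x \<xi> u = - \<xi> (br x u)"
    unfolding act_def by (subst br_anti) (simp add: lin \<xi>)
  ultimately show "shifted_lmul \<xi> (dress_at x F) X = (dress_at x (shifted_lmul \<xi> F)
      + dress_at (coad x \<xi>) F - shifted_lmul (act x \<xi>) F) X"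
    using X F \<xi> by (simp add: shifted_lmul_def lmul_apply dress_at_mult tsmul_apply)
qed (simp_all only: F \<xi> dress_at_\<Phi> shifted_lmul_\<Phi> \<Phi>_plus \<Phi>_minus act_L\<^sub>0)

text \<open>The shift preserves brackets because \<open>\<xi> \<mapsto> \<xi> u\<close> is a character of \<open>\<gg>\<^sup>*\<close>.\<close>

lemma shifted_lmul_shifted_lmul:
  assumes F: "F \<in> \<Phi>" and \<xi>: "\<xi> \<in> L\<^sub>0" and \<eta>: "\<eta> \<in> L\<^sub>0"
  shows "shifted_lmul \<eta> (shifted_lmul \<xi> F) = shifted_lmul \<xi> (shifted_lmul \<eta> F) + shifted_lmul (lbr L \<xi> \<eta>) F"
proof -
  have "lbr L \<xi> \<eta> u = 0" using u_invariant[OF \<xi> \<eta>] by (simp add: t_invariant_form(2) \<xi> \<eta>)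
  moreover have "lmul (\<iota> \<eta>) (lmul (\<iota> \<xi>) F) = lmul (\<iota> \<xi>) (lmul (\<iota> \<eta>) F) + lmul (\<iota> (lbr L \<xi> \<eta>)) F"
    using F \<xi> \<eta> by (simp add: lmul_lmul U_incl incl_comm[of \<xi> \<eta>] lmul_add U_mul L\<^sub>0_lbr)
  ultimately show ?thesis
    by (simp add: shifted_lmul_def lmul_linear tsmul_linear mult.commute algebra_simps fun_eq_iff
        tsmul_apply)
qed

text \<open>The defect \<open>E\<close> of this identity vanishes at \<open>1\<close>. By the Jacobi identity of the double it
  commutes with the shifted multiplications up to other values of \<open>E\<close>, so it vanishes by induction
  on words.\<close>

lemma dress_at_dress_at: "F \<in> \<Phi> \<Longrightarrow>
    dress_at x (dress_at y F) = dress_at y (dress_at x F) + dress_at (br x y) F"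
proof (rule \<Phi>_ext)
  define E where "E x y F = dress_at x (dress_at y F) - dress_at y (dress_at x F) - dress_at (br x y) F"
      for x y F
  have E_\<Phi>: "E x y F \<in> \<Phi>" if "F \<in> \<Phi>" for x y F
    unfolding E_def using that by (simp only: dress_at_\<Phi> \<Phi>_minus)
  have shifted_lmul_E: "shifted_lmul \<xi> (E x y F) = E x y (shifted_lmul \<xi> F) + E x (coad y \<xi>) F
      + E (coad x \<xi>) y F"
    if F: "F \<in> \<Phi>" and \<xi>: "\<xi> \<in> L\<^sub>0" for \<xi> x y F
  proof -
    note mem = F \<xi> dress_at_\<Phi> shifted_lmul_\<Phi> \<Phi>_plus \<Phi>_minus act_L\<^sub>0
    have two: "shifted_lmul \<xi> (dress_at x (dress_at y F)) = dress_at x (dress_at y (shifted_lmul \<xi> F))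
        + dress_at x (dress_at (coad y \<xi>) F) - dress_at x (shifted_lmul (act y \<xi>) F)
        + dress_at (coad x \<xi>) (dress_at y F) - (dress_at y (shifted_lmul (act x \<xi>) F)
            + dress_at (coad y (act x \<xi>)) F - shifted_lmul (act y (act x \<xi>)) F)" for x y
      by (simp only: shifted_lmul_dress_at mem dress_at_linear)
    have one: "shifted_lmul \<xi> (dress_at (br x y) F) = dress_at (br x y) (shifted_lmul \<xi> F)
        + (dress_at (br x (coad y \<xi>)) F + dress_at (br (coad x \<xi>) y) F - dress_at (coad y (act x \<xi>)) F
            + dress_at (coad x (act y \<xi>)) F)
        - (shifted_lmul (act x (act y \<xi>)) F - shifted_lmul (act y (act x \<xi>)) F)"
      by (simp only: shifted_lmul_dress_at mem coad_br act_br dress_at_fst shifted_lmul_minus)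
    show ?thesis
      unfolding E_def shifted_lmul_linear two one by (simp add: algebra_simps)
  qed
  fix X assume F: "F \<in> \<Phi>" and X: "X \<in> vset U"
  from X F have "E x y F X = 0"
  proof (induction X arbitrary: x y F rule: U_induct)
    case one
    then show ?case by (simp add: E_def dress_at_one)
  next
    case (mul \<xi> X)
    have "shifted_lmul \<xi> (E x y F) X = E x y F (\<iota> \<xi> \<odot> X) + \<kappa> * \<xi> u * E x y F X"
      using mul(2) by (simp add: shifted_lmul_def lmul_apply tsmul_apply)
    moreover have "shifted_lmul \<xi> (E x y F) X = 0"
      using mul by (simp add: shifted_lmul_E shifted_lmul_\<Phi>)
    ultimately show ?case using mul by simp
  qed (simp_all add: \<Phi>_add[OF E_\<Phi>] \<Phi>_smul[OF E_\<Phi>])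
  then show "dress_at x (dress_at y F) X = (dress_at y (dress_at x F) + dress_at (br x y) F) X"
    by (simp add: E_def algebra_simps)
qed (simp_all only: dress_at_\<Phi> \<Phi>_plus)

section \<open>Two commuting ideals of the double\<close>

text \<open>The action of the element \<open>\<xi> + p \<xi>\<close> of the graph of \<open>p\<close> in the double.\<close>

definition graph_op :: "(('g \<Rightarrow> 'k) \<Rightarrow> 'g) \<Rightarrow> ('g \<Rightarrow> 'k) \<Rightarrow>
    (('g \<Rightarrow> 'k, 'k) env \<Rightarrow> 'k) \<Rightarrow> ('g \<Rightarrow> 'k, 'k) env \<Rightarrow> 'k" where
  "graph_op p \<xi> F = shifted_lmul \<xi> F + dress_at (p \<xi>) F"

lemma graph_op_\<Phi>: "F \<in> \<Phi> \<Longrightarrow> \<xi> \<in> L\<^sub>0 \<Longrightarrow> graph_op p \<xi> F \<in> \<Phi>"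
  by (simp only: graph_op_def \<Phi>_plus shifted_lmul_\<Phi> dress_at_\<Phi>)

lemma graph_op_linear:
  assumes "F \<in> \<Phi>" "G \<in> \<Phi>"
  shows "graph_op p \<xi> (F + G) = graph_op p \<xi> F + graph_op p \<xi> G"
      "graph_op p \<xi> (tsmul c F) = tsmul c (graph_op p \<xi> F)"
  using assms by (simp_all add: graph_op_def shifted_lmul_linear dress_at_linear tsmul_linear algebra_simps)

text \<open>The graphs of \<open>- rb\<close> and \<open>ra\<close> are orthogonal ideals of the double, since
  \<open>\<xi> (rb \<eta>) = \<eta> (ra \<xi>)\<close>, so their brackets vanish. In components: the \<open>\<gg>\<^sup>*\<close>-part is the formula for
  the bracket of \<open>\<gg>\<^sup>*\<close>, and the \<open>\<gg>\<close>-part is that \<open>ra\<close> is a homomorphism.\<close>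

lemma graph_op_commute:
  assumes F: "F \<in> \<Phi>" and \<xi>: "\<xi> \<in> L\<^sub>0" and \<eta>: "\<eta> \<in> L\<^sub>0"
  shows "graph_op (\<lambda>\<xi>. - rb \<xi>) \<xi> (graph_op ra \<eta> F) = graph_op ra \<eta> (graph_op (\<lambda>\<xi>. - rb \<xi>) \<xi> F)"
proof -
  let ?b = "rb \<xi>" and ?a = "ra \<eta>"
  note mem = F \<xi> \<eta> dress_at_\<Phi> shifted_lmul_\<Phi> \<Phi>_plus \<Phi>_minus act_L\<^sub>0 L\<^sub>0_lbr
  have "ra (act ?a \<xi>) + ra (act ?b \<eta>) = br (ra \<eta>) (ra \<xi>)"
  proof -
    have "ra (act ?a \<xi>) + ra (act ?b \<eta>) = ra (lbr L \<eta> \<xi>)"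
      by (simp only: lbr_act[OF \<eta> \<xi>] ra_linear add.commute)
    then show ?thesis by (simp only: ra_hom[OF \<eta> \<xi>])
  qed
  then have coad: "coad ?a \<xi> + coad ?b \<eta> = br ?b ?a"
    by (simp add: coad_def algebra_simps)
  have act: "lbr L \<eta> \<xi> = act ?b \<eta> + act ?a \<xi>"
    by (rule lbr_act[OF \<eta> \<xi>])
  have LL: "shifted_lmul \<xi> (shifted_lmul \<eta> F) = shifted_lmul \<eta> (shifted_lmul \<xi> F)
      + (shifted_lmul (act ?b \<eta>) F + shifted_lmul (act ?a \<xi>) F)"
    using shifted_lmul_shifted_lmul[OF F \<eta> \<xi>] by (simp only: act shifted_lmul_fst mem)
  have D: "dress_at ?b (dress_at ?a F) = dress_at ?a (dress_at ?b F) + (dress_at (coad ?a \<xi>) F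
      + dress_at (coad ?b \<eta>) F)"
    by (simp only: dress_at_dress_at[OF F, of ?b ?a] coad[symmetric] dress_at_fst[OF F])
  show ?thesis
    unfolding graph_op_def dress_at_fst(3)[OF F]
    by (simp add: dress_at_fst(3) dress_at_linear shifted_lmul_linear mem LL D shifted_lmul_dress_at
        algebra_simps)
qed

text \<open>Elements of \<open>C\<^sub>s\<close> are \<open>\<gg>\<close>-invariant, so right multiplication by them commutes with \<open>\<gg>\<close>.\<close>

lemma dress_at_rmul:
  assumes Y: "Y \<in> C_ker U \<Delta> \<delta> D s" and F: "F \<in> \<Phi>"
  shows "rmul Y (dress_at x F) = dress_at x (rmul Y F)"
proof (rule \<Phi>_ext)
  have YU: "Y \<in> vset U" using Y by (simp add: C_ker_def)
  show "rmul Y (dress_at x F) \<in> \<Phi>" "dress_at x (rmul Y F) \<in> \<Phi>"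
    by (simp_all only: rmul_\<Phi> dress_at_\<Phi> F YU)
  fix X assume X: "X \<in> vset U"
  from X F show "rmul Y (dress_at x F) X = dress_at x (rmul Y F) X"
  proof (induction X arbitrary: x F rule: U_induct)
    case one
    then show ?case
      using dress_C_ker[OF Y] by (simp add: rmul_apply U_one U_one_mul YU dress_at_one) (simp add:
          dress_at_def)
  next
    case (mul \<xi> X)
    note IH = mul.IH[unfolded rmul_apply[OF mul(2)]]
    have "rmul Y (dress_at x F) (\<iota> \<xi> \<odot> X) = dress_at x F (\<iota> \<xi> \<odot> (X \<odot> Y))"
      using mul YU by (simp add: rmul_apply U_mul U_incl U_assoc)
    also have "\<dots> = dress_at x (rmul Y (lmul (\<iota> \<xi>) F)) X + dress_at (coad x \<xi>) (rmul Y F) X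
        - F (\<iota> (act x \<xi>) \<odot> (X \<odot> Y)) + \<kappa> * \<xi> (br x u) * F (X \<odot> Y)"
      using mul YU by (simp add: dress_at_mult U_mul IH lmul_\<Phi> U_incl)
    also have "\<dots> = dress_at x (rmul Y F) (\<iota> \<xi> \<odot> X)"
      using mul YU by (simp add: dress_at_mult rmul_\<Phi> lmul_rmul U_incl rmul_apply U_mul U_assoc act_L\<^sub>0)
    finally show ?case .
  next
    case (smul c X)
    then show ?case using rmul_\<Phi> dress_at_\<Phi> YU
        by (simp add: \<Phi>_smul[OF rmul_\<Phi>[OF dress_at_\<Phi>]] \<Phi>_smul[OF dress_at_\<Phi>[OF rmul_\<Phi>]])
  next
    case (add X X')
    then show ?case using YU by (simp add: \<Phi>_add[OF rmul_\<Phi>[OF dress_at_\<Phi>]] \<Phi>_add[OF dress_at_\<Phi>[OF rmul_\<Phi>]])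
  qed
qed

lemma graph_op_rmul:
  assumes Y: "Y \<in> C_ker U \<Delta> \<delta> D s" and F: "F \<in> \<Phi>" and \<xi>: "\<xi> \<in> L\<^sub>0"
  shows "rmul Y (graph_op p \<xi> F) = graph_op p \<xi> (rmul Y F)"
proof -
  have "Y \<in> vset U" using Y by (simp add: C_ker_def)
  then show ?thesis
    using \<xi> by (simp add: graph_op_def shifted_lmul_def rmul_linear dress_at_rmul[OF Y F] lmul_rmul U_incl)
qed

text \<open>Since functionals carry the transposed action, a polynomial \<open>a\<close> in the operators represents
  the element \<open>X\<close> of \<open>U\<close> (that is, \<open>X = a \<cdot> 1\<close>) if \<open>F X = a F 1\<close> for all functionals \<open>F\<close>.\<close>

inductive_set ops :: "(('g \<Rightarrow> 'k) \<Rightarrow> 'g) \<Rightarrow> ((('g \<Rightarrow> 'k, 'k) env \<Rightarrow> 'k) \<Rightarrow>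
    ('g \<Rightarrow> 'k, 'k) env \<Rightarrow> 'k) set" for p where
  ops_id: "(\<lambda>F. F) \<in> ops p"
| ops_comp: "a \<in> ops p \<Longrightarrow> \<xi> \<in> L\<^sub>0 \<Longrightarrow> (\<lambda>F. a (graph_op p \<xi> F)) \<in> ops p"
| ops_add: "a \<in> ops p \<Longrightarrow> b \<in> ops p \<Longrightarrow> (\<lambda>F. a F + b F) \<in> ops p"
| ops_scale: "a \<in> ops p \<Longrightarrow> (\<lambda>F. tsmul c (a F)) \<in> ops p"

lemma ops_\<Phi>: "a \<in> ops p \<Longrightarrow> F \<in> \<Phi> \<Longrightarrow> a F \<in> \<Phi>"
  by (induction arbitrary: F rule: ops.induct) (simp_all only: graph_op_\<Phi> \<Phi>_plus \<Phi>_tsmul)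

lemma ops_linear:
  "a \<in> ops p \<Longrightarrow> F \<in> \<Phi> \<Longrightarrow> G \<in> \<Phi> \<Longrightarrow> a (F + G) = a F + a G \<and> a (tsmul c F) = tsmul c (a F)"
proof (induction arbitrary: F G rule: ops.induct)
  case (ops_comp a \<xi>)
  then show ?case by (simp only: graph_op_linear graph_op_\<Phi>)
next
  case (ops_add a b)
  show ?case
    by (simp only: ops_add.IH(1)[OF ops_add.prems] ops_add.IH(2)[OF ops_add.prems] tsmul_linear add_ac)
next
  case (ops_scale a d)
  show ?case
    by (simp only: ops_scale.IH[OF ops_scale.prems] tsmul_linear mult.commute)
qed simp

lemma ops_rmul:
  "a \<in> ops p \<Longrightarrow> Y \<in> C_ker U \<Delta> \<delta> D s \<Longrightarrow> F \<in> \<Phi> \<Longrightarrow> a (rmul Y F) = rmul Y (a F)"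
proof (induction arbitrary: F rule: ops.induct)
  case (ops_comp a \<xi>)
  show ?case
    unfolding graph_op_rmul[OF ops_comp.prems ops_comp.hyps(2), symmetric]
    by (rule ops_comp.IH[OF ops_comp.prems(1) graph_op_\<Phi>[OF ops_comp.prems(2) ops_comp.hyps(2)]])
qed (simp_all add: rmul_linear)

lemma ops_graph_op:
  "a \<in> ops (\<lambda>\<xi>. - rb \<xi>) \<Longrightarrow> \<eta> \<in> L\<^sub>0 \<Longrightarrow> F \<in> \<Phi> \<Longrightarrow> a (graph_op ra \<eta> F) = graph_op ra \<eta> (a F)"
proof (induction arbitrary: F rule: ops.induct)
  case (ops_comp a \<xi>)
  then show ?case by (simp only: graph_op_commute graph_op_\<Phi>)
next
  case (ops_add a b)
  then show ?case by (simp only: graph_op_linear ops_\<Phi>)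
next
  case (ops_scale a c)
  then show ?case by (simp only: graph_op_linear(2)[OF ops_\<Phi> ops_\<Phi>])
qed simp

lemma ops_commute:
  assumes a: "a \<in> ops (\<lambda>\<xi>. - rb \<xi>)"
  shows "b \<in> ops ra \<Longrightarrow> F \<in> \<Phi> \<Longrightarrow> a (b F) = b (a F)"
proof (induction arbitrary: F rule: ops.induct)
  case (ops_comp b \<eta>)
  then show ?case by (simp only: graph_op_\<Phi> ops_graph_op[OF a])
next
  case (ops_add b b')
  then show ?case using ops_linear[OF a] by (simp only: ops_\<Phi>)
next
  case (ops_scale b c)
  then show ?case using ops_linear[OF a] by (simp only: ops_\<Phi>)
qed simp

inductive degree_le :: "nat \<Rightarrow> ('g \<Rightarrow> 'k, 'k) env \<Rightarrow> bool" where
  degree_le_one: "degree_le n (aone U)"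
| degree_le_mul: "degree_le n X \<Longrightarrow> \<xi> \<in> L\<^sub>0 \<Longrightarrow> degree_le (Suc n) (\<iota> \<xi> \<odot> X)"
| degree_le_add: "degree_le n X \<Longrightarrow> degree_le n Y \<Longrightarrow> degree_le n (X \<boxplus> Y)"
| degree_le_smul: "degree_le n X \<Longrightarrow> degree_le n (c \<boxdot> X)"

lemma degree_le_U: "degree_le n X \<Longrightarrow> X \<in> vset U"
  by (induction rule: degree_le.induct) (simp_all add: U_one U_mul U_incl U_add U_smul)

lemma degree_le_Suc: "degree_le n X \<Longrightarrow> degree_le (Suc n) X"
  by (induction rule: degree_le.induct) (auto intro: degree_le.intros)

lemma degree_le_mono: "n \<le> m \<Longrightarrow> degree_le n X \<Longrightarrow> degree_le m X"
  by (induction rule: dec_induct) (auto intro: degree_le_Suc)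

lemma degree_le_exhaustive: "X \<in> vset U \<Longrightarrow> \<exists>n. degree_le n X"
proof (induction X rule: U_induct)
  case (add X Y)
  then obtain n m where "degree_le n X" "degree_le m Y" by blast
  then have "degree_le (max n m) X" "degree_le (max n m) Y"
      by (auto intro: degree_le_mono[OF max.cobounded1] degree_le_mono[OF max.cobounded2])
  then show ?case by (blast intro: degree_le_add)
qed (blast intro: degree_le.intros)+

text \<open>Dressing operators preserve \<open>U\<close>, and not just its bidual, and they do not raise the degree.\<close>

lemma degree_le_dress_at: "degree_le n X \<Longrightarrow> \<exists>Z. degree_le n Z \<and> (\<forall>F\<in>\<Phi>. dress_at x F X = F Z)"
proof (induction arbitrary: x rule: degree_le.induct)
  case (degree_le_one n)
  \<comment> \<open>\<open>0 \<boxdot> aone U\<close> is the zero of \<open>U\<close>\<close>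
  show ?case
    by (intro exI[of _ "0 \<boxdot> aone U"]) (simp add: degree_le.intros dress_at_one \<Phi>_smul U_one)
next
  case (degree_le_mul n X \<xi>)
  obtain Z where Z: "degree_le n Z" "\<forall>F\<in>\<Phi>. dress_at x F X = F Z" using degree_le_mul.IH by blast
  obtain Z' where Z': "degree_le n Z'" "\<forall>F\<in>\<Phi>. dress_at (coad x \<xi>) F X = F Z'" using degree_le_mul.IH
      by blast
  note U = degree_le_U[OF Z(1)] degree_le_U[OF Z'(1)] degree_le_U[OF degree_le_mul(1)] U_incl[OF
      degree_le_mul(2)] U_incl[OF act_L\<^sub>0[OF degree_le_mul(2)]]
  show ?case
  proof (intro exI conjI ballI)
    let ?W = "\<iota> \<xi> \<odot> Z \<boxplus> Z' \<boxplus> (-1) \<boxdot> (\<iota> (act x \<xi>) \<odot> X) \<boxplus> (\<kappa> * \<xi> (br x u)) \<boxdot> X"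
    show "degree_le (Suc n) ?W"
      by (intro degree_le_add degree_le_smul degree_le.degree_le_mul Z(1) degree_le_Suc[OF Z'(1)]
          degree_le_mul act_L\<^sub>0 degree_le_Suc[OF degree_le_mul(1)])
    fix F assume F: "F \<in> \<Phi>"
    show "dress_at x F (\<iota> \<xi> \<odot> X) = F ?W"
      using Z(2) Z'(2) F degree_le_mul(2)
          by (simp add: dress_at_mult U \<Phi>_add \<Phi>_smul U_add U_smul U_mul lmul_\<Phi> lmul_apply)
  qed
next
  case (degree_le_add n X Y)
  obtain Z where Z: "degree_le n Z" "\<forall>F\<in>\<Phi>. dress_at x F X = F Z" using degree_le_add.IH by blast
  obtain Z' where Z': "degree_le n Z'" "\<forall>F\<in>\<Phi>. dress_at x F Y = F Z'" using degree_le_add.IH by blast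
  show ?case
    by (intro exI[of _ "Z \<boxplus> Z'"])
      (use Z Z' degree_le_add in \<open>simp add: degree_le.intros \<Phi>_add[OF dress_at_\<Phi>] \<Phi>_add degree_le_U\<close>)
next
  case (degree_le_smul n X c)
  obtain Z where Z: "degree_le n Z" "\<forall>F\<in>\<Phi>. dress_at x F X = F Z" using degree_le_smul.IH by blast
  show ?case
    by (intro exI[of _ "c \<boxdot> Z"])
      (use Z degree_le_smul in \<open>simp add: degree_le.intros \<Phi>_smul[OF dress_at_\<Phi>] \<Phi>_smul degree_le_U\<close>)
qed

text \<open>As \<open>\<xi> = (\<xi> + p \<xi>) - p \<xi>\<close> and \<open>p \<xi>\<close> does not raise the degree, the graph of any \<open>p\<close> generates
  \<open>U\<close> from \<open>1\<close>, by induction on the degree.\<close>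

lemma degree_le_ops: "degree_le n X \<Longrightarrow> \<exists>a\<in>ops p. \<forall>F\<in>\<Phi>. F X = a F (aone U)"
proof (induction n arbitrary: X rule: less_induct)
  case (less n)
  have "m \<le> n \<Longrightarrow> \<exists>a\<in>ops p. \<forall>F\<in>\<Phi>. F X = a F (aone U)" if "degree_le m X" for m X
    using that
  proof (induction rule: degree_le.induct)
    case (degree_le_one m)
    show ?case by (rule bexI[of _ "\<lambda>F. F"]) (simp_all add: ops.intros)
  next
    case (degree_le_mul m X \<xi>)
    obtain a where a: "a \<in> ops p" "\<forall>F\<in>\<Phi>. F X = a F (aone U)" using degree_le_mul by auto
    obtain Z where Z: "degree_le m Z" "\<forall>F\<in>\<Phi>. dress_at (p \<xi>) F X = F Z"
        using degree_le_dress_at[OF degree_le_mul(1)] by blast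
    obtain b where b: "b \<in> ops p" "\<forall>F\<in>\<Phi>. F Z = b F (aone U)"
      using less.IH[OF _ Z(1)] degree_le_mul.prems by auto
    have c: "(\<lambda>F. a (graph_op p \<xi> F) + tsmul (-1) (b F) + tsmul (- (\<kappa> * \<xi> u)) (a F)) \<in> ops p"
      by (intro ops_add ops_scale ops_comp a b degree_le_mul)
    show ?case
    proof (rule bexI[OF _ c], rule ballI)
      fix F assume F: "F \<in> \<Phi>"
      have "F (\<iota> \<xi> \<odot> X) = graph_op p \<xi> F X - dress_at (p \<xi>) F X - \<kappa> * \<xi> u * F X"
        by (simp add: graph_op_def shifted_lmul_def lmul_apply tsmul_apply degree_le_U[OF degree_le_mul(1)])
      also have "\<dots> = a (graph_op p \<xi> F) (aone U) - b F (aone U) - \<kappa> * \<xi> u * a F (aone U)"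
        using a(2) b(2) Z(2) F graph_op_\<Phi>[OF F degree_le_mul(2)] by simp
      finally show "F (\<iota> \<xi> \<odot> X) = (a (graph_op p \<xi> F) + tsmul (-1) (b F)
          + tsmul (- (\<kappa> * \<xi> u)) (a F)) (aone U)"
        by (simp add: tsmul_apply)
    qed
  next
    case (degree_le_add m X Y)
    then obtain a b where "a \<in> ops p" "\<forall>F\<in>\<Phi>. F X = a F (aone U)" "b \<in> ops p" "\<forall>F\<in>\<Phi>. F Y = b F (aone U)"
      by blast
    then show ?case
      using degree_le_add by (intro bexI[OF _ ops.ops_add[of a p b]]) (simp_all add: \<Phi>_add degree_le_U)
  next
    case (degree_le_smul m X c)
    then obtain a where "a \<in> ops p" "\<forall>F\<in>\<Phi>. F X = a F (aone U)" by blast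
    then show ?case
      using degree_le_smul by (intro bexI[OF _ ops.ops_scale[of a p c]]) (simp_all add: \<Phi>_smul
          degree_le_U tsmul_apply)
  qed
  then show ?case using less.prems by blast
qed

text \<open>Each step below is the transpose of one step in the chain
  \<open>X Y = a \<cdot> Y = a b \<cdot> 1 = b a \<cdot> 1 = b \<cdot> X = Y X\<close>.\<close>

lemma C_ker_commute:
  assumes X: "X \<in> C_ker U \<Delta> \<delta> D s" and Y: "Y \<in> C_ker U \<Delta> \<delta> D s"
  shows "X \<odot> Y = Y \<odot> X"
proof (rule \<Phi>_separate)
  have U: "X \<in> vset U" "Y \<in> vset U" using X Y by (simp_all add: C_ker_def)
  show "X \<odot> Y \<in> vset U" "Y \<odot> X \<in> vset U" using U by (simp_all add: U_mul)
  obtain a where a: "a \<in> ops (\<lambda>\<xi>. - rb \<xi>)" "\<forall>F\<in>\<Phi>. F X = a F (aone U)"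
    using degree_le_exhaustive[OF U(1)] degree_le_ops by blast
  obtain b where b: "b \<in> ops ra" "\<forall>F\<in>\<Phi>. F Y = b F (aone U)"
    using degree_le_exhaustive[OF U(2)] degree_le_ops by blast
  fix F assume F: "F \<in> \<Phi>"
  have "F (X \<odot> Y) = rmul Y F X" by (simp add: rmul_apply U)
  also have "\<dots> = a (rmul Y F) (aone U)" using a(2) rmul_\<Phi>[OF F U(2)] by blast
  also have "\<dots> = a F Y" by (simp add: ops_rmul[OF a(1) Y F] rmul_apply U U_one U_one_mul)
  also have "\<dots> = b (a F) (aone U)" using b(2) ops_\<Phi>[OF a(1) F] by blast
  also have "\<dots> = a (b F) (aone U)" by (simp add: ops_commute[OF a(1) b(1) F])
  also have "\<dots> = b F X" using a(2) ops_\<Phi>[OF b(1) F] by simp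
  also have "\<dots> = b (rmul X F) (aone U)" by (simp add: ops_rmul[OF b(1) X F] rmul_apply U U_one U_one_mul)
  also have "\<dots> = rmul X F Y" using b(2) rmul_\<Phi>[OF F U(1)] by simp
  also have "\<dots> = F (Y \<odot> X)" by (simp add: rmul_apply U)
  finally show "F (X \<odot> Y) = F (Y \<odot> X)" .
qed

end

theorem proposition8p1:
  fixes sc :: "'k::field_char_0 \<Rightarrow> 'g::ab_group_add \<Rightarrow> 'g"
    and Basis :: "'g set"
    and br :: "'g \<Rightarrow> 'g \<Rightarrow> 'g"
    and r' :: "('g \<Rightarrow> 'g \<Rightarrow> 'k) \<Rightarrow> 'k"
    and s :: 'k
    and \<Delta>\<^sub>0 \<delta> :: "(('g \<Rightarrow> 'k) word \<Rightarrow>\<^sub>0 'k) set \<Rightarrow>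
      ((('g \<Rightarrow> 'k) word \<Rightarrow>\<^sub>0 'k) set \<Rightarrow> (('g \<Rightarrow> 'k) word \<Rightarrow>\<^sub>0 'k) set \<Rightarrow> 'k) \<Rightarrow> 'k"
    and D :: "(('g \<Rightarrow> 'k) word \<Rightarrow>\<^sub>0 'k) set \<Rightarrow> (('g \<Rightarrow> 'k) word \<Rightarrow>\<^sub>0 'k) set"
  assumes "finite_dimensional_vector_space sc Basis"
    and "QTLBA sc br r'"
    and "cocommutative_coproduct (dual_lie sc br r') \<Delta>\<^sub>0"
    and "co_Poisson (dual_lie sc br r') (dual_cobracket sc br r') \<Delta>\<^sub>0 \<delta>"
    and "induced_derivation (dual_lie sc br r') (dual_D sc br r') D"
  shows "commutative_subalgebra (env_alg (dual_lie sc br r'))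
           (C_ker (env_alg (dual_lie sc br r')) \<Delta>\<^sub>0 \<delta> D s)"
proof -
  interpret finite_dimensional_vector_space sc Basis by fact
  interpret qtlba_env sc Basis br r' \<Delta>\<^sub>0 \<delta> D s
    by unfold_locales fact+
  show ?thesis
    unfolding commutative_subalgebra_def
    using C_ker_subalgebra C_ker_commute by blast
qed

end
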